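(* For every $C\in[0,\infty]$ there exist a compact group $X$ and an automorphism $T:X\to X$ of compact groups such that $\operatorname{F}_n(T)<\infty$ for all $n\ge 1$ and $$ \frac{1}{n}\log \operatorname{F}_n(T)\longrightarrow C\quad\text{as } n\to\infty . $$
   Context: A compact group is a compact Hausdorff topological group, and an automorphism of a compact group $X$ is a group automorphism $T:X\to X$ that is also a homeomorphism. For a map $T:X\to X$ and an integer $n\ge1$, $\operatorname{F}_n(T)=\left|\{x\in X\mid T^n(x)=x\}\right|$ denotes the number of points of period $n$ under $T$ (not necessarily least period), where $T^n$ is the $n$-fold composition of $T$ with itself. For $C=\infty$, the convergence means that the sequence diverges to $+\infty$. *)

theory Defs
  imports "HOL-Algebra.Group" "HOL-Analysis.Analysis"
begin

definition topological_group :: "('a, 'b) monoid_scheme \<Rightarrow> 'a topology \<Rightarrow> bool" where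
  "topological_group G X \<longleftrightarrow>
     group G \<and> topspace X = carrier G \<and>
     continuous_map (prod_topology X X) X (\<lambda>(x, y). x \<otimes>\<^bsub>G\<^esub> y) \<and>
     continuous_map X X (\<lambda>x. inv\<^bsub>G\<^esub> x)"

definition compact_group :: "('a, 'b) monoid_scheme \<Rightarrow> 'a topology \<Rightarrow> bool" where
  "compact_group G X \<longleftrightarrow> topological_group G X \<and> compact_space X \<and> Hausdorff_space X"

definition compact_group_automorphism ::
    "('a, 'b) monoid_scheme \<Rightarrow> 'a topology \<Rightarrow> ('a \<Rightarrow> 'a) \<Rightarrow> bool" where
  "compact_group_automorphism G X T \<longleftrightarrow> T \<in> iso G G \<and> homeomorphic_map X X T"

definition periodic_points :: "('a, 'b) monoid_scheme \<Rightarrow> ('a \<Rightarrow> 'a) \<Rightarrow> nat \<Rightarrow> 'a set" where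
  "periodic_points G T n = {x \<in> carrier G. (T ^^ n) x = x}"

text \<open>
  As \<^term>\<open>card\<close> is 0 on infinite sets, the number below is meaningful only together with
  finiteness of the set of periodic points, which has to be stated separately.
\<close>

definition num_periodic_points :: "('a, 'b) monoid_scheme \<Rightarrow> ('a \<Rightarrow> 'a) \<Rightarrow> nat \<Rightarrow> nat" where
  "num_periodic_points G T n = card (periodic_points G T n)"

text \<open>
  HOL cannot quantify existentially over types, so an existence claim about compact groups has
  to name a type for the underlying sets. The type \<^typ>\<open>nat \<Rightarrow> int\<close> has the cardinality of the
  continuum. Hence every second countable compact group (in particular every countable product
  of finite groups) is isomorphic to one whose carrier is a set of this type. The
  group structure and the topology on that carrier are arbitrary; they need not be the
  pointwise operations or the product topology.
\<close>

type_synonym point = "nat \<Rightarrow> int"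

end

theory Submission
  imports Defs "HOL-Number_Theory.Number_Theory" "HOL-Real_Asymp.Real_Asymp"
begin

text \<open>
  If \<open>p\<close> is a prime with \<open>p \<equiv> 1 (mod d)\<close>, then \<open>\<int>/p\<^sup>k\<close> has an automorphism all of whose nonzero points have least
  period \<open>d\<close>. On the product over all \<open>d\<close> of such groups, of orders \<open>m\<^sub>d\<close>, there are \<open>\<Prod>m\<^sub>d\<close> points of period \<open>n\<close>, the product
  being over the divisors \<open>d\<close> of \<open>n\<close>. As \<open>\<Sum>\<phi>(d) = n\<close> over these \<open>d\<close>, it suffices that \<open>ln m\<^sub>d = C \<phi>(d) + o(\<phi>(d))\<close>, which
  can be arranged if there are primes \<open>p \<equiv> 1 (mod d)\<close> with \<open>ln p = o(\<phi>(d))\<close>.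

  Linnik's theorem would give such primes, but this weak form has a shorter proof. The sum over all characters \<open>\<psi>\<close> modulo \<open>d\<close>
  of the \<open>k\<close>-th Taylor coefficients of \<open>-L'/L(s, \<psi>)\<close> at \<open>s = 1 + \<delta>\<close>, where \<open>\<delta> = d\<^bsup>-9/10\<^esup>\<close> and \<open>k\<close> is of order \<open>ln d\<close>, weighs the prime
  powers congruent to 1 by a kernel that is negligible beyond \<open>exp(d\<^bsup>19/20\<^esup>)\<close>. The principal character contributes about
  \<open>\<delta>\<^bsup>-k-1\<^esup>\<close> and dominates as soon as the other \<open>L\<close>-functions do not vanish at distance \<open>2\<delta>\<close> from \<open>1 + \<delta>\<close>. For this,
  \<open>|L(1 + \<delta>, \<psi>)| \<ge> d\<^bsup>-7/10\<^esup>\<close> is enough. It follows from the 3-4-1 inequality if \<open>\<psi>\<^sup>2\<close> is not principal. For real \<open>\<psi>\<close>, the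
  convolution \<open>1 * \<psi>\<close> is nonnegative and at least 1 at squares, and a midpoint rule turns this into a lower bound of order
  \<open>d\<^bsup>-2/3\<^esup>\<close> for \<open>L(1, \<psi>)\<close>.
\<close>

section \<open>Dirichlet characters\<close>

text \<open>The exponents come from competing constraints. Put \<delta> = d^(-\<theta>) and let
  d^(-\<lambda>) be the lower bound required of |L(1 + \<delta>, \<psi>)|. Only the Taylor
  coefficients of index 0 and 1 are known to be logarithmic in d; the others are bounded by 3 d.
  Domination of the constant term at radius 2 \<delta> therefore costs d \<delta>^2 and forces
  \<lambda> < 2 \<theta> - 1. The 3-4-1 inequality yields \<delta>^(3/4) up to logarithms, so
  \<lambda> > 3 \<theta> / 4, and real characters ask for \<lambda> > 2/3. This is consistent for
  5/6 < \<theta> < 1; the values 9/10 and 7/10 are one choice. The kernel is negligible once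
  \<delta> ln n exceeds a positive power of d, so 19/20 has to lie between 9/10 and 1, the latter
  being the limit for o(\<phi>(d)). The radius 2 \<delta> is what beats the number of characters:
  each contributes an error of at most d^2 / (2 \<delta>)^k against the main term \<delta>^(-k-1),
  and 2^k outweighs d^3 when k is a suitable multiple of ln d.\<close>

definition dchars :: "nat \<Rightarrow> (nat \<Rightarrow> complex) set" where
  "dchars d = {\<psi>. (\<forall>m n. \<psi> (m * n) = \<psi> m * \<psi> n) \<and>
                  (\<forall>m n. [m = n] (mod d) \<longrightarrow> \<psi> m = \<psi> n) \<and>
                  (\<forall>n. \<psi> n \<noteq> 0 \<longleftrightarrow> coprime n d)}"

text \<open>\<open>H\<close> is the full preimage in the naturals of a subgroup of the units modulo
  \<open>d\<close>, and \<open>\<psi>\<close> a character of that subgroup, with arbitrary values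
  outside \<open>H\<close>. Inverses are powers, see \<open>partial_char_cancel\<close>.\<close>

definition partial_char :: "nat \<Rightarrow> nat set \<Rightarrow> (nat \<Rightarrow> complex) \<Rightarrow> bool" where
  "partial_char d H \<psi> \<longleftrightarrow> 1 \<in> H \<and> (\<forall>m\<in>H. coprime m d \<and> \<psi> m \<noteq> 0) \<and>
     (\<forall>m\<in>H. \<forall>n. [n = m] (mod d) \<longrightarrow> n \<in> H \<and> \<psi> n = \<psi> m) \<and>
     (\<forall>m\<in>H. \<forall>n\<in>H. m * n \<in> H \<and> \<psi> (m * n) = \<psi> m * \<psi> n)"

lemma partial_charD:
  assumes "partial_char d H \<psi>"
  shows "1 \<in> H" "m \<in> H \<Longrightarrow> coprime m d" "m \<in> H \<Longrightarrow> \<psi> m \<noteq> 0"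
    "m \<in> H \<Longrightarrow> [n = m] (mod d) \<Longrightarrow> n \<in> H" "m \<in> H \<Longrightarrow> [n = m] (mod d) \<Longrightarrow> \<psi> n = \<psi> m"
    "m \<in> H \<Longrightarrow> n \<in> H \<Longrightarrow> m * n \<in> H" "m \<in> H \<Longrightarrow> n \<in> H \<Longrightarrow> \<psi> (m * n) = \<psi> m * \<psi> n"
  using assms unfolding partial_char_def by blast+

lemma partial_char_one: "partial_char d H \<psi> \<Longrightarrow> \<psi> 1 = 1"
  using partial_charD(7)[of d H \<psi> 1 1] partial_charD(1,3)[of d H \<psi>] by auto

lemma partial_char_power:
  assumes "partial_char d H \<psi>" "m \<in> H"
  shows "m ^ k \<in> H \<and> \<psi> (m ^ k) = \<psi> m ^ k"
proof (induction k)
  case 0 thus ?case using assms partial_charD(1) partial_char_one by auto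
next
  case (Suc k) thus ?case using partial_charD(6,7)[OF assms(1,2), of "m ^ k"] by auto
qed

text \<open>Euler's theorem makes \<open>m ^ (totient d - 1)\<close> an inverse of \<open>m\<close>
  modulo \<open>d\<close>, and it lies in \<open>H\<close> as a power of \<open>m\<close>.\<close>

lemma partial_char_cancel:
  assumes "partial_char d H \<psi>" "m \<in> H" "m * n \<in> H" "d > 0"
  shows "n \<in> H"
proof -
  have cop: "coprime m d" using assms partial_charD(2) by blast
  have "[m ^ totient d = 1] (mod d)" using cop by (rule euler_theorem)
  hence "[m ^ (totient d - 1) * (m * n) = 1 * n] (mod d)"
    using assms(4) by (metis cong_scalar_right mult.assoc power_minus_mult totient_gt_0_iff)
  hence *: "[n = m ^ (totient d - 1) * (m * n)] (mod d)" by (simp add: cong_sym_eq)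
  have "m ^ (totient d - 1) * (m * n) \<in> H"
    using partial_char_power[OF assms(1,2)] partial_charD(6)[OF assms(1)] assms(3) by blast
  thus ?thesis using * partial_charD(4)[OF assms(1)] by blast
qed

text \<open>Here \<open>m\<close> is the order of \<open>x\<close> modulo \<open>H\<close>. The
  elements of the enlarged subgroup are the \<open>h * x ^ j\<close>, and
  \<open>\<psi> h * c ^ j\<close> is independent of the representation because
  \<open>c ^ m = \<psi> (x ^ m)\<close>. The root \<open>c\<close> stays a parameter: extending to
  all units accepts any root, separating points needs a particular one.\<close>

lemma partial_char_extend:
  fixes x m :: nat
  assumes pc: "partial_char d H \<psi>" and d: "d > 0" and x: "coprime x d"
    and m: "m > 0" "x ^ m \<in> H" and least: "\<And>j. 0 < j \<Longrightarrow> j < m \<Longrightarrow> x ^ j \<notin> H"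
    and c: "c ^ m = \<psi> (x ^ m)"
  shows "\<exists>H' \<psi>'. partial_char d H' \<psi>' \<and> H \<subseteq> H' \<and> x \<in> H' \<and> (\<forall>h\<in>H. \<psi>' h = \<psi> h) \<and> \<psi>' x = c"
proof -
  note D = partial_charD[OF pc]
  \<comment> \<open>\<open>P n h j\<close> says that \<open>h\<close> and \<open>j\<close> represent
    \<open>n\<close>. Representations are not unique, so \<open>\<psi>'\<close> picks one with
    \<open>SOME\<close>; \<open>key\<close> shows that the value does not depend on the
    choice.\<close>
  define P where "P = (\<lambda>n h j. h \<in> H \<and> [n = h * x ^ j] (mod d))"
  define H' where "H' = {n. \<exists>h j. P n h j}"
  define \<psi>' where "\<psi>' = (\<lambda>n. case (SOME (h, j). P n h j) of (h, j) \<Rightarrow> \<psi> h * c ^ j)"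
  have dvd: "m dvd l" if "x ^ l \<in> H" for l
  proof -
    have "x ^ l = (x ^ m) ^ (l div m) * x ^ (l mod m)"
      by (simp flip: power_mult power_add)
    hence "x ^ (l mod m) \<in> H"
      using partial_char_cancel[OF pc _ _ d] partial_char_power[OF pc m(2)] that by metis
    hence "l mod m = 0" using least[of "l mod m"] m by auto
    thus ?thesis by auto
  qed
  have key0: "\<psi> h * c ^ i = \<psi> h' * c ^ j" if P: "P n h i" "P n h' j" and "i \<le> j" for n h h' i j
  proof -
    have hh: "h \<in> H" "h' \<in> H" using P by (auto simp: P_def)
    have "[h * x ^ i = h' * x ^ j] (mod d)" using P unfolding P_def by (meson cong_sym cong_trans)
    hence "[h * x ^ i = (h' * x ^ (j - i)) * x ^ i] (mod d)"
      using \<open>i \<le> j\<close> by (simp add: mult.assoc flip: power_add)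
    hence *: "[h = h' * x ^ (j - i)] (mod d)"
      using x by (simp add: cong_mult_rcancel_nat coprime_commute)
    hence 1: "h' * x ^ (j - i) \<in> H" using D(4)[OF hh(1)] by (simp add: cong_sym_eq)
    hence 2: "x ^ (j - i) \<in> H" using partial_char_cancel[OF pc hh(2) _ d] by blast
    obtain q where q: "j - i = m * q" using dvd[OF 2] by auto
    have "\<psi> h = \<psi> h' * \<psi> (x ^ (j - i))" using D(5)[OF 1 *] D(7)[OF hh(2) 2] by simp
    also have "\<psi> (x ^ (j - i)) = c ^ (j - i)"
      using partial_char_power[OF pc m(2), of q] by (simp add: q power_mult c)
    finally show ?thesis using \<open>i \<le> j\<close> by (simp add: mult.assoc flip: power_add)
  qed
  have key: "\<psi> h * c ^ i = \<psi> h' * c ^ j" if P: "P n h i" "P n h' j" for n h h' i j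
    using key0[OF P] key0[OF P(2) P(1)] by (cases "i \<le> j") auto
  have val: "\<psi>' n = \<psi> h * c ^ j" if "P n h j" for n h j
  proof -
    have "\<exists>p. case p of (h, j) \<Rightarrow> P n h j" using that by auto
    hence "case (SOME (h, j). P n h j) of (h, j) \<Rightarrow> P n h j" by (rule someI_ex)
    thus ?thesis unfolding \<psi>'_def using key[OF _ that] by (auto split: prod.splits)
  qed
  have c0: "c \<noteq> 0" using c D(3)[OF m(2)] m(1) by (metis zero_power)
  have Px: "P x 1 1" unfolding P_def using D(1) by auto
  have Pmult: "P (n * n') (h * h') (j + j')" if "P n h j" "P n' h' j'" for n n' h h' j j'
  proof -
    have "[n * n' = (h * x ^ j) * (h' * x ^ j')] (mod d)"
      using that unfolding P_def by (intro cong_mult) auto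
    thus ?thesis using that D(6) by (auto simp: P_def power_add algebra_simps)
  qed
  have "partial_char d H' \<psi>'" unfolding partial_char_def
  proof (intro conjI ballI allI impI)
    have "P 1 1 0" unfolding P_def using D(1) by simp
    thus "1 \<in> H'" by (auto simp: H'_def)
  next
    fix n assume "n \<in> H'"
    then obtain h j where P: "P n h j" by (auto simp: H'_def)
    hence "coprime (h * x ^ j) d" using x D(2) by (auto simp: P_def)
    thus "coprime n d" using P unfolding P_def by (metis cong_imp_coprime cong_sym_eq)
    show "\<psi>' n \<noteq> 0" using val[OF P] P D(3) c0 by (auto simp: P_def)
    { fix n' assume "[n' = n] (mod d)"
      hence P': "P n' h j" using P unfolding P_def by (meson cong_trans)
      show "n' \<in> H'" using P' by (auto simp: H'_def)
      show "\<psi>' n' = \<psi>' n" using val[OF P] val[OF P'] by simp }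
    fix n' assume "n' \<in> H'"
    then obtain h' j' where P': "P n' h' j'" by (auto simp: H'_def)
    note PP = Pmult[OF P P']
    show "n * n' \<in> H'" using PP by (auto simp: H'_def)
    show "\<psi>' (n * n') = \<psi>' n * \<psi>' n'"
      using val[OF PP] val[OF P] val[OF P'] D(7) P P' by (auto simp: P_def power_add)
  qed
  moreover have "h \<in> H' \<and> \<psi>' h = \<psi> h" if "h \<in> H" for h
  proof -
    have "P h h 0" using that by (auto simp: P_def)
    thus ?thesis using val[of h h 0] by (auto simp: H'_def)
  qed
  moreover have "x \<in> H'" using Px by (auto simp: H'_def)
  moreover have "\<psi>' x = c" using val[OF Px] partial_char_one[OF pc] by simp
  ultimately show ?thesis by blast
qed

lemma partial_char_extend':
  assumes pc: "partial_char d H \<psi>" and d: "d > 0" and x: "coprime x d" "x \<notin> H"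
  obtains m where "m > 0" "x ^ m \<in> H" "\<And>j. 0 < j \<Longrightarrow> j < m \<Longrightarrow> x ^ j \<notin> H" "m > 1"
proof -
  define Q where "Q = (\<lambda>m. m > 0 \<and> x ^ m \<in> H)"
  have "[x ^ totient d = 1] (mod d)" using x(1) by (rule euler_theorem)
  hence "Q (totient d)" using partial_charD(1,4)[OF pc] d by (auto simp: Q_def)
  hence "Q (LEAST m. Q m)" by (rule LeastI)
  moreover have "x ^ j \<notin> H" if "0 < j" "j < (LEAST m. Q m)" for j
    using not_less_Least[OF that(2)] that(1) by (auto simp: Q_def)
  moreover have "(LEAST m. Q m) \<noteq> 1" using calculation(1) x(2) by (auto simp: Q_def)
  ultimately show ?thesis using that[of "LEAST m. Q m"] by (auto simp: Q_def)
qed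

text \<open>Missing units are adjoined one at a time; the induction is on the number of reduced
  residues outside \<open>H\<close>.\<close>

lemma partial_char_total:
  assumes "partial_char d H \<psi>" and d: "d > 0"
  shows "\<exists>\<psi>'\<in>dchars d. \<forall>n\<in>H. \<psi>' n = \<psi> n"
  using assms(1)
proof (induction "card ({n. n < d \<and> coprime n d} - H)" arbitrary: H \<psi> rule: less_induct)
  case less
  note D = partial_charD[OF less.prems]
  show ?case
  proof (cases "{n. coprime n d} \<subseteq> H")
    case True
    hence H: "H = {n. coprime n d}" using D(2) by auto
    define \<psi>' where "\<psi>' = (\<lambda>n. if coprime n d then \<psi> n else 0)"
    have "\<psi>' \<in> dchars d" unfolding dchars_def
    proof (safe, goal_cases)
      case (1 m n) thus ?case using D(7)[of m n] by (auto simp: \<psi>'_def H)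
    next
      case (2 m n) thus ?case using D(5)[of n m] D(4)[of m n] D(4)[of n m]
        by (auto simp: \<psi>'_def H cong_sym_eq)
    next
      case (3 n) thus ?case by (auto simp: \<psi>'_def split: if_splits)
    next
      case (4 n) thus ?case using D(3)[of n] by (auto simp: \<psi>'_def H)
    qed
    thus ?thesis by (intro bexI[of _ \<psi>']) (auto simp: \<psi>'_def H)
  next
    case False
    then obtain x where x: "coprime x d" "x \<notin> H" by auto
    obtain m where m: "m > 0" "x ^ m \<in> H" "\<And>j. 0 < j \<Longrightarrow> j < m \<Longrightarrow> x ^ j \<notin> H"
      using partial_char_extend'[OF less.prems d x] by metis
    obtain c where c: "\<psi> (x ^ m) = c ^ m" using exists_complex_root[of m] m by auto
    obtain H' \<psi>' where H': "partial_char d H' \<psi>'" "H \<subseteq> H'" "x \<in> H'" "\<forall>h\<in>H. \<psi>' h = \<psi> h"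
      using partial_char_extend[OF less.prems d x(1) m, of c] c by metis
    \<comment> \<open>The measure counts residues below \<open>d\<close>, so its decrease is
      witnessed by \<open>x mod d\<close> rather than by \<open>x\<close>.\<close>
    have "x mod d \<in> H'" using partial_charD(4)[OF H'(1,3), of "x mod d"] by (simp add: cong_def)
    moreover have "x mod d \<notin> H" using D(4)[of "x mod d" x] x by (auto simp: cong_def)
    moreover have "coprime (x mod d) d" using x d by simp
    ultimately have "card ({n. n < d \<and> coprime n d} - H') < card ({n. n < d \<and> coprime n d} - H)"
      using H'(2) d by (intro psubset_card_mono psubsetI) (auto simp: set_eq_iff intro!: exI[of _ "x mod d"])
    from less.hyps[OF this H'(1)] H'(2,4) show ?thesis by (metis subsetD)
  qed
qed

text \<open>The trivial character on the class of 1 extends to the subgroup generated by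
  \<open>g\<close> with any \<open>m\<close>-th root of unity as value at \<open>g\<close>, where
  \<open>m > 1\<close> is the order of \<open>g\<close>; a primitive root is chosen.\<close>

lemma dchars_separate:
  assumes d: "d > 1" and g: "coprime g d" "\<not> [g = 1] (mod d)"
  shows "\<exists>\<psi>\<in>dchars d. \<psi> g \<noteq> 1"
proof -
  define H where "H = {n. [n = 1] (mod d)}"
  have "partial_char d H (\<lambda>_. 1)" unfolding partial_char_def H_def
    using cong_imp_coprime[of 1 _ d]
    by (auto intro: cong_trans cong_mult[of _ 1 d _ 1, simplified] simp: cong_sym_eq[of "Suc 0"])
  moreover have "g \<notin> H" using g by (auto simp: H_def)
  ultimately obtain m where m: "m > 0" "g ^ m \<in> H" "\<And>j. 0 < j \<Longrightarrow> j < m \<Longrightarrow> g ^ j \<notin> H" "m > 1"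
    using partial_char_extend'[of d H "\<lambda>_. 1" g] d g by (metis gr_implies_not0 not_gr0)
  define c where "c = cis (2 * pi / m)"
  have c: "c ^ m = 1" unfolding c_def Complex.DeMoivre using m(1) by simp
  have c1: "c \<noteq> 1"
  proof
    assume "c = 1"
    hence "cos (2 * pi / m) = 1" by (auto simp: c_def complex_eq_iff)
    then obtain k :: int where k: "2 * pi / m = of_int k * 2 * pi" by (auto simp: cos_one_2pi_int)
    hence "1 / real m = of_int k" using m by (simp add: field_simps)
    moreover have "1 / real m < 1" "1 / real m > 0" using m by auto
    ultimately show False by auto
  qed
  obtain H' \<psi>' where "partial_char d H' \<psi>'" "g \<in> H'" "\<psi>' g = c"
    using partial_char_extend[OF \<open>partial_char d H (\<lambda>_. 1)\<close> _ g(1) m(1-3), of c] d c by auto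
  moreover from this obtain \<psi>'' where "\<psi>'' \<in> dchars d" "\<forall>n\<in>H'. \<psi>'' n = \<psi>' n"
    using partial_char_total[of d H' \<psi>'] d by (metis less_trans zero_less_one)
  ultimately show ?thesis using c1 by metis
qed

section \<open>Values, orthogonality and number of the characters\<close>

lemma dcharsD:
  assumes "\<psi> \<in> dchars d"
  shows dchar_mult: "\<psi> (m * n) = \<psi> m * \<psi> n"
    and dchar_cong: "[m = n] (mod d) \<Longrightarrow> \<psi> m = \<psi> n"
    and dchar_eq_0_iff: "\<psi> n = 0 \<longleftrightarrow> \<not> coprime n d"
  using assms unfolding dchars_def by blast+

lemma dchar_1: "\<psi> \<in> dchars d \<Longrightarrow> \<psi> (Suc 0) = 1"
  using dchar_mult[of \<psi> d 1 1] dchar_eq_0_iff[of \<psi> d 1] by auto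

lemma dchar_power: "\<psi> \<in> dchars d \<Longrightarrow> \<psi> (n ^ k) = \<psi> n ^ k"
  by (induction k) (auto simp: dchar_1 dchar_mult)

lemma dchar_root_unity:
  assumes "\<psi> \<in> dchars d" "coprime n d"
  shows "\<psi> n ^ totient d = 1"
  using dchar_cong[OF assms(1) euler_theorem[OF assms(2)]] by (simp add: dchar_power[OF assms(1)] dchar_1[OF assms(1)])

lemma norm_dchar:
  assumes "\<psi> \<in> dchars d" "coprime n d" "d > 0"
  shows "norm (\<psi> n) = 1"
proof -
  have "norm (\<psi> n) ^ totient d = 1"
    using dchar_root_unity[OF assms(1,2)] by (metis norm_one norm_power)
  thus ?thesis using power_eq_1_iff[of "norm (\<psi> n)" "totient d"] assms(3) by auto
qed

lemma norm_dchar_le: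
  assumes "\<psi> \<in> dchars d" "d > 0"
  shows "norm (\<psi> n) \<le> 1"
proof (cases "coprime n d")
  case True
  thus ?thesis using norm_dchar[OF assms(1) True assms(2)] by simp
next
  case False
  hence "\<psi> n = 0" using dchar_eq_0_iff[OF assms(1)] by blast
  thus ?thesis by simp
qed

lemma finite_dchars: "d > 0 \<Longrightarrow> finite (dchars d)"
proof -
  assume d: "d > 0"
  define Z where "Z = insert 0 {z :: complex. z ^ totient d = 1}"
  have "finite Z" unfolding Z_def using d by (auto intro!: finite_roots_unity simp: Suc_le_eq)
  hence "finite ({..<d} \<rightarrow>\<^sub>E Z)" by (intro finite_PiE) auto
  moreover have "(\<lambda>\<psi>. restrict \<psi> {..<d}) ` dchars d \<subseteq> {..<d} \<rightarrow>\<^sub>E Z"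
    using dchar_root_unity dchar_eq_0_iff by (intro image_subsetI, subst restrict_PiE_iff) (auto simp: Z_def)
  ultimately have "finite ((\<lambda>\<psi>. restrict \<psi> {..<d}) ` dchars d)" by (rule rev_finite_subset)
  moreover have "inj_on (\<lambda>\<psi>. restrict \<psi> {..<d}) (dchars d)"
  proof (rule inj_onI, rule ext)
    fix \<psi> \<psi>' n assume *: "\<psi> \<in> dchars d" "\<psi>' \<in> dchars d" "restrict \<psi> {..<d} = restrict \<psi>' {..<d}"
    have "\<psi> (n mod d) = \<psi>' (n mod d)" using fun_cong[OF *(3), of "n mod d"] d by auto
    moreover have "\<psi> (n mod d) = \<psi> n" "\<psi>' (n mod d) = \<psi>' n"
      by (rule dchar_cong[OF *(1)] dchar_cong[OF *(2)], simp)+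
    ultimately show "\<psi> n = \<psi>' n" by simp
  qed
  ultimately show ?thesis by (rule finite_imageD)
qed

definition principal_dchar :: "nat \<Rightarrow> nat \<Rightarrow> complex" where
  "principal_dchar d n = (if coprime n d then 1 else 0)"

lemma principal_in_dchars: "principal_dchar d \<in> dchars d"
  unfolding dchars_def principal_dchar_def using cong_imp_coprime[of _ _ d] by (auto simp: cong_sym_eq)

lemma mult_in_dchars: "\<psi> \<in> dchars d \<Longrightarrow> \<psi>' \<in> dchars d \<Longrightarrow> (\<lambda>n. \<psi> n * \<psi>' n) \<in> dchars d"
  unfolding dchars_def by (auto simp: algebra_simps)

text \<open>Multiplication by a unit \<open>g\<close> with \<open>\<psi> g \<noteq> 1\<close>
  permutes the residues modulo \<open>d\<close> and multiplies the sum by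
  \<open>\<psi> g\<close>.\<close>

lemma sum_dchar_eq_0:
  assumes "\<psi> \<in> dchars d" "\<psi> \<noteq> principal_dchar d" "d > 0"
  shows "(\<Sum>n<d. \<psi> n) = 0"
proof -
  obtain g where g: "\<psi> g \<noteq> principal_dchar d g" using assms by auto
  hence g1: "coprime g d" "\<psi> g \<noteq> 1"
    using dchar_eq_0_iff[OF assms(1), of g] by (auto simp: principal_dchar_def split: if_splits)
  have inj: "inj_on (\<lambda>n. (g * n) mod d) {..<d}"
  proof (rule inj_onI)
    fix a b assume "a \<in> {..<d}" "b \<in> {..<d}" "(g * a) mod d = (g * b) mod d"
    hence "[g * a = g * b] (mod d)" "a < d" "b < d" by (auto simp: cong_def)
    thus "a = b" using g1 by (simp add: cong_mult_lcancel_nat coprime_commute cong_less_modulus_unique_nat)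
  qed
  have "(\<lambda>n. (g * n) mod d) ` {..<d} = {..<d}"
    using assms(3) by (intro endo_inj_surj inj) auto
  hence "bij_betw (\<lambda>n. (g * n) mod d) {..<d} {..<d}" using inj by (simp add: bij_betw_def)
  hence "(\<Sum>n<d. \<psi> n) = (\<Sum>n<d. \<psi> ((g * n) mod d))" by (rule sum.reindex_bij_betw [symmetric])
  also have "\<dots> = (\<Sum>n<d. \<psi> g * \<psi> n)"
  proof (intro sum.cong refl)
    fix n
    have "\<psi> ((g * n) mod d) = \<psi> (g * n)" by (rule dchar_cong[OF assms(1)]) simp
    thus "\<psi> ((g * n) mod d) = \<psi> g * \<psi> n" by (simp only: dchar_mult[OF assms(1)])
  qed
  finally have "(\<Sum>n<d. \<psi> n) = \<psi> g * (\<Sum>n<d. \<psi> n)" by (simp flip: sum_distrib_left)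
  thus ?thesis using g1 by simp
qed

text \<open>The dual argument: multiplication by a character \<open>\<xi>\<close> with
  \<open>\<xi> g \<noteq> 1\<close> permutes the characters.\<close>

lemma sum_dchars_eq_0:
  assumes d: "d > 1" and g: "\<not> [g = 1] (mod d)"
  shows "(\<Sum>\<psi>\<in>dchars d. \<psi> g) = 0"
proof (cases "coprime g d")
  case False
  thus ?thesis using dchar_eq_0_iff by (intro sum.neutral) auto
next
  case True
  obtain \<xi> where \<xi>: "\<xi> \<in> dchars d" "\<xi> g \<noteq> 1" using dchars_separate[OF d True g] by auto
  have inj: "inj_on (\<lambda>\<psi> n. \<xi> n * \<psi> n) (dchars d)"
  proof (rule inj_onI, rule ext)
    fix a b n assume *: "a \<in> dchars d" "b \<in> dchars d" "(\<lambda>n. \<xi> n * a n) = (\<lambda>n. \<xi> n * b n)"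
    show "a n = b n"
      using fun_cong[OF *(3), of n] dchar_eq_0_iff[OF \<xi>(1), of n] dchar_eq_0_iff[OF *(1), of n]
        dchar_eq_0_iff[OF *(2), of n] by (cases "coprime n d") auto
  qed
  have "(\<lambda>\<psi> n. \<xi> n * \<psi> n) ` dchars d = dchars d"
    using inj mult_in_dchars[OF \<xi>(1)] finite_dchars[of d] d by (intro endo_inj_surj) auto
  hence "bij_betw (\<lambda>\<psi> n. \<xi> n * \<psi> n) (dchars d) (dchars d)" using inj by (simp add: bij_betw_def)
  hence "(\<Sum>\<psi>\<in>dchars d. \<psi> g) = (\<Sum>\<psi>\<in>dchars d. \<xi> g * \<psi> g)"
    by (rule sum.reindex_bij_betw [symmetric])
  hence "(\<Sum>\<psi>\<in>dchars d. \<psi> g) = \<xi> g * (\<Sum>\<psi>\<in>dchars d. \<psi> g)" by (simp flip: sum_distrib_left)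
  thus ?thesis using \<xi> by simp
qed

lemma sum_principal_dchar:
  assumes "d > 1"
  shows "(\<Sum>n<d. principal_dchar d n) = of_nat (totient d)"
proof -
  have "{n. n < d \<and> coprime n d} = totatives d"
  proof (intro equalityI subsetI)
    fix n assume "n \<in> {n. n < d \<and> coprime n d}"
    thus "n \<in> totatives d" using assms by (cases "n = 0") (auto simp: totatives_def)
  next
    fix n assume "n \<in> totatives d"
    thus "n \<in> {n. n < d \<and> coprime n d}" using assms by (cases "n = d") (auto simp: totatives_def)
  qed
  thus ?thesis unfolding principal_dchar_def totient_def by (simp add: sum.If_cases Int_def)
qed

text \<open>The double sum over characters and residues is evaluated by both orthogonality
  relations: summing over residues first leaves only the principal character, summing over
  characters first only the residue 1.\<close>

lemma card_dchars:
  assumes d: "d > 1"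
  shows "card (dchars d) = totient d"
proof -
  have "(\<Sum>\<psi>\<in>dchars d. \<Sum>n<d. \<psi> n) = (\<Sum>\<psi>\<in>dchars d. if \<psi> = principal_dchar d then of_nat (totient d) else 0)"
  proof (intro sum.cong refl)
    fix \<psi> assume "\<psi> \<in> dchars d"
    have "(\<Sum>n<d. principal_dchar d n) = of_nat (totient d)"
      using d by (rule sum_principal_dchar)
    thus "(\<Sum>n<d. \<psi> n) = (if \<psi> = principal_dchar d then of_nat (totient d) else 0)"
      using sum_dchar_eq_0[OF \<open>\<psi> \<in> dchars d\<close>] d by auto
  qed
  also have "\<dots> = of_nat (totient d)"
    using finite_dchars[of d] d principal_in_dchars[of d] by simp
  finally have "of_nat (totient d) = (\<Sum>n<d. \<Sum>\<psi>\<in>dchars d. \<psi> n)" by (subst sum.swap) simp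
  also have "\<dots> = (\<Sum>n<d. if n = 1 then of_nat (card (dchars d)) else 0)"
  proof (intro sum.cong refl)
    fix n assume "n \<in> {..<d}"
    thus "(\<Sum>\<psi>\<in>dchars d. \<psi> n) = (if n = 1 then of_nat (card (dchars d)) else 0)"
    proof (cases "n = 1")
      case True
      have "(\<Sum>\<psi>\<in>dchars d. \<psi> n) = (\<Sum>\<psi>\<in>dchars d. 1)"
        using dchar_1 True by (intro sum.cong) auto
      thus ?thesis using True by simp
    next
      case False
      hence "\<not> [n = 1] (mod d)" using \<open>n \<in> {..<d}\<close> d by (auto simp: cong_def)
      thus ?thesis using sum_dchars_eq_0[OF d, of n] False by simp
    qed
  qed
  also have "\<dots> = of_nat (card (dchars d))" using d by simp
  finally show ?thesis by (simp only: of_nat_eq_iff)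
qed

section \<open>Periodic coefficients with mean value zero\<close>

text \<open>Up to the factor \<open>s ^ (k + 1)\<close> a gamma density: unimodal in
  \<open>u \<ge> 0\<close> with maximum at \<open>k / s\<close>, which is the source of all
  variation bounds. With \<open>u = ln n\<close> it gives the weights \<open>lweight\<close>; with
  \<open>u = n\<close> it reappears in \<open>abs_S_le\<close>.\<close>

definition log_kernel :: "real \<Rightarrow> nat \<Rightarrow> real \<Rightarrow> real" where
  "log_kernel s k u = exp (- s * u) * u ^ k / fact k"

definition lweight :: "real \<Rightarrow> nat \<Rightarrow> nat \<Rightarrow> real" where
  "lweight \<delta> k n = real n powr (- 1 - \<delta>) * ln (real n) ^ k / fact k"

lemma lweight_0 [simp]: "lweight \<delta> k 0 = 0"
  by (simp add: lweight_def)

lemma lweight_eq: "n > 0 \<Longrightarrow> lweight \<delta> k n = log_kernel (1 + \<delta>) k (ln (real n))"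
  by (simp add: lweight_def log_kernel_def powr_def algebra_simps)

lemma power_le_fact_exp:
  fixes x :: real assumes "x \<ge> 0" shows "x ^ k / fact k \<le> exp x"
proof -
  have "(\<Sum>i\<in>{k}. x ^ i /\<^sub>R fact i) \<le> (\<Sum>i. x ^ i /\<^sub>R fact i)"
    using assms by (intro sum_le_suminf summable_exp_generic) (auto intro!: mult_nonneg_nonneg)
  thus ?thesis by (simp add: exp_def field_simps)
qed

lemma log_kernel_nonneg: "u \<ge> 0 \<Longrightarrow> log_kernel s k u \<ge> 0"
  by (simp add: log_kernel_def)

lemma log_kernel_le:
  assumes "u \<ge> 0" "s > 0"
  shows "log_kernel s k u \<le> (1 / s) ^ k"
proof -
  have "(s * u) ^ k / fact k \<le> exp (s * u)" using assms by (intro power_le_fact_exp) auto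
  thus ?thesis using assms by (simp add: log_kernel_def exp_minus field_simps)
qed

text \<open>Part of the exponential is spent on the power of \<open>u\<close>; the factor
  \<open>exp (- r * u)\<close> is kept as decay.\<close>

lemma log_kernel_le_exp:
  assumes "u \<ge> 0" "s > r"
  shows "log_kernel s k u \<le> (1 / (s - r)) ^ k * exp (- r * u)"
proof -
  have "log_kernel s k u = log_kernel (s - r) k u * exp (- r * u)"
    by (simp add: log_kernel_def algebra_simps flip: exp_add)
  thus ?thesis using log_kernel_le[OF assms(1), of "s - r" k] assms by (simp add: mult_right_mono)
qed

lemma has_real_derivative_log_kernel:
  "(log_kernel s k has_real_derivative
     (exp (- s * u) * (of_nat k * u ^ (k - 1) - s * u ^ k) / fact k)) (at u)"
proof -
  have "((\<lambda>u. exp (- s * u) * u ^ k) has_real_derivative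
     exp (- s * u) * (of_nat k * u ^ (k - 1) - s * u ^ k)) (at u)"
    by (auto intro!: derivative_eq_intros simp: algebra_simps)
  from DERIV_cdivide[OF this, of "fact k"] show ?thesis
    by (simp add: log_kernel_def [abs_def] field_simps)
qed

lemma log_kernel_mono:
  assumes s: "s > 0" and "0 \<le> x" "x \<le> y" "y \<le> k / s"
  shows "log_kernel s k x \<le> log_kernel s k y"
proof (cases "k = 0")
  case True
  hence "x = y" using assms by auto
  thus ?thesis by simp
next
  case k: False
  show ?thesis
  proof (rule DERIV_nonneg_imp_nondecreasing[OF \<open>x \<le> y\<close>])
  fix u assume u: "x \<le> u" "u \<le> y"
  have "s * u ^ k \<le> of_nat k * u ^ (k - 1)"
  proof (cases k)
    case 0 thus ?thesis using k by auto
  next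
    case (Suc j)
    have "s * u \<le> s * y" using u s by (intro mult_left_mono) auto
    also have "\<dots> \<le> of_nat k" using assms by (simp add: field_simps)
    finally have "s * u \<le> of_nat k" .
    hence "(s * u) * u ^ j \<le> of_nat k * u ^ j" using u assms by (intro mult_right_mono) auto
    thus ?thesis by (simp add: Suc algebra_simps)
  qed
  hence "0 \<le> exp (- s * u) * (of_nat k * u ^ (k - 1) - s * u ^ k) / fact k" by simp
  thus "\<exists>y. (log_kernel s k has_real_derivative y) (at u) \<and> 0 \<le> y"
    using has_real_derivative_log_kernel by blast
  qed
qed

lemma log_kernel_antimono:
  assumes s: "s > 0" and "0 \<le> x" "x \<le> y" "k / s \<le> x"
  shows "log_kernel s k y \<le> log_kernel s k x"
proof (rule DERIV_nonpos_imp_nonincreasing[OF \<open>x \<le> y\<close>])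
  fix u assume u: "x \<le> u" "u \<le> y"
  have "s * u ^ k \<ge> of_nat k * u ^ (k - 1)"
  proof (cases k)
    case 0 thus ?thesis using assms u by auto
  next
    case (Suc j)
    have "s * u \<ge> s * x" using u s by (intro mult_left_mono) auto
    moreover have "s * x \<ge> of_nat k" using assms by (simp add: field_simps)
    ultimately have "s * u \<ge> of_nat k" by linarith
    hence "(s * u) * u ^ j \<ge> of_nat k * u ^ j" using u assms by (intro mult_right_mono) auto
    thus ?thesis by (simp add: Suc algebra_simps)
  qed
  hence "exp (- s * u) * (of_nat k * u ^ (k - 1) - s * u ^ k) / fact k \<le> 0"
    by (intro divide_nonpos_nonneg mult_nonneg_nonpos) auto
  thus "\<exists>y. (log_kernel s k has_real_derivative y) (at u) \<and> y \<le> 0"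
    using has_real_derivative_log_kernel by blast
qed

text \<open>\<open>V\<close> is the variation function up to a constant: the kernel up to its
  maximum, then its mirror image about the maximal value. Sums of absolute increments are thus
  dominated by telescoping sums of \<open>V\<close>.\<close>

lemma log_kernel_variation:
  assumes s: "s > 0"
  obtains V where "\<And>x. x \<ge> 0 \<Longrightarrow> 0 \<le> V x \<and> V x \<le> 2 * (1 / s) ^ k"
    "\<And>x y. 0 \<le> x \<Longrightarrow> x \<le> y \<Longrightarrow> \<bar>log_kernel s k y - log_kernel s k x\<bar> \<le> V y - V x"
proof
  define c where "c = k / s"
  have c: "c \<ge> 0" using s by (auto simp: c_def)
  let ?f = "log_kernel s k"
  let ?V = "\<lambda>x. if x \<le> c then ?f x else 2 * ?f c - ?f x"
  have up: "?f x \<le> ?f y" if "0 \<le> x" "x \<le> y" "y \<le> c" for x y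
    using log_kernel_mono[OF s that(1,2), of k] that by (auto simp: c_def)
  have down: "?f y \<le> ?f x" if "x \<le> y" "c \<le> x" for x y
    using log_kernel_antimono[OF s _ that(1), of k] that c by (auto simp: c_def)
  have "?f c \<le> (1 / s) ^ k" using log_kernel_le[OF c s] .
  thus "0 \<le> ?V x \<and> ?V x \<le> 2 * (1 / s) ^ k" if "x \<ge> 0" for x
    using log_kernel_nonneg[OF that, of s k] log_kernel_nonneg[OF c, of s k] up[of x c] down[of c x] that c by auto
  show "\<bar>?f y - ?f x\<bar> \<le> ?V y - ?V x" if "0 \<le> x" "x \<le> y" for x y
    using up[of x y] up[of x c] down[of c y] down[of x y] that by (auto simp: abs_le_iff)
qed

section \<open>Partial summation for periodic coefficients\<close>

lemma abel_summation_bound: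
  fixes g :: "nat \<Rightarrow> complex" and w :: "nat \<Rightarrow> real"
  assumes S: "\<And>n. norm (\<Sum>i\<in>{m..<n}. g i) \<le> S" and mN: "m \<le> N"
  shows "norm (\<Sum>n\<in>{m..<N}. g n * w n) \<le> S * ((\<Sum>n\<in>{m..<N}. \<bar>w n - w (Suc n)\<bar>) + \<bar>w N\<bar>)"
proof -
  define T where "T = (\<lambda>n. \<Sum>i\<in>{m..<n}. g i)"
  have eq: "(\<Sum>n\<in>{m..<N}. g n * w n) = T N * w N + (\<Sum>n\<in>{m..<N}. T (Suc n) * (w n - w (Suc n)))"
    using mN
  proof (induction N rule: dec_induct)
    case (step N)
    have "T (Suc N) = T N + g N" using step by (simp add: T_def)
    thus ?case using step by (simp add: algebra_simps)
  qed (auto simp: T_def)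
  have "norm (\<Sum>n\<in>{m..<N}. g n * w n) \<le> norm (T N * w N) + (\<Sum>n\<in>{m..<N}. norm (T (Suc n) * (w n - w (Suc n))))"
    unfolding eq by (intro order.trans[OF norm_triangle_ineq] add_left_mono norm_sum)
  also have "\<dots> \<le> S * \<bar>w N\<bar> + (\<Sum>n\<in>{m..<N}. S * \<bar>w n - w (Suc n)\<bar>)"
    unfolding norm_mult of_real_diff [symmetric] norm_of_real using S
    by (intro add_mono mult_right_mono sum_mono) (auto simp: T_def simp del: sum.op_ivl_Suc)
  finally show ?thesis by (simp add: sum_distrib_left algebra_simps)
qed

text \<open>Besides the nonprincipal characters this covers the principal character minus its mean
  value, so the bounds below serve both.\<close>

definition oscillating :: "nat \<Rightarrow> (nat \<Rightarrow> complex) \<Rightarrow> bool" where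
  "oscillating d g \<longleftrightarrow> d > 0 \<and> (\<forall>n. norm (g n) \<le> 1) \<and> (\<forall>n. g (n + d) = g n) \<and> (\<Sum>n<d. g n) = 0"

lemma oscillating_window:
  assumes "oscillating d g"
  shows "(\<Sum>i\<in>{m..<m+d}. g i) = 0"
proof (induction m)
  case 0 thus ?case using assms by (simp add: oscillating_def lessThan_atLeast0)
next
  case (Suc m)
  have d: "d > 0" and p: "g (m + d) = g m" using assms by (auto simp: oscillating_def)
  have "(\<Sum>i\<in>{m..<m+d}. g i) = g m + (\<Sum>i\<in>{Suc m..<m+d}. g i)"
    using d by (intro sum.atLeast_Suc_lessThan) auto
  moreover have "(\<Sum>i\<in>{Suc m..<Suc m+d}. g i) = (\<Sum>i\<in>{Suc m..<m+d}. g i) + g (m + d)"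
    using d by (simp add: sum.atLeastLessThan_Suc)
  ultimately show ?case using Suc p d by (simp add: add.commute)
qed

lemma oscillating_partial_sum:
  assumes "oscillating d g"
  shows "norm (\<Sum>i\<in>{m..<n}. g i) \<le> d"
proof (induction "n - m" arbitrary: m rule: less_induct)
  case less
  have g: "norm (g i) \<le> 1" and d: "d > 0" for i using assms by (auto simp: oscillating_def)
  show ?case
  proof (cases "n < m + d")
    case True
    have "norm (\<Sum>i\<in>{m..<n}. g i) \<le> (\<Sum>i\<in>{m..<n}. 1)" by (intro sum_norm_le g)
    also have "\<dots> \<le> d" using True by simp
    finally show ?thesis .
  next
    case False
    hence "(\<Sum>i\<in>{m..<n}. g i) = (\<Sum>i\<in>{m..<m+d}. g i) + (\<Sum>i\<in>{m+d..<n}. g i)"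
      by (intro sum.atLeastLessThan_concat [symmetric]) auto
    also have "\<dots> = (\<Sum>i\<in>{m+d..<n}. g i)" using oscillating_window[OF assms] by simp
    finally show ?thesis using less.hyps[of "m + d"] False d by simp
  qed
qed

lemma oscillating_dchar:
  "\<psi> \<in> dchars d \<Longrightarrow> \<psi> \<noteq> principal_dchar d \<Longrightarrow> d > 0 \<Longrightarrow> oscillating d \<psi>"
  unfolding oscillating_def using norm_dchar_le sum_dchar_eq_0 by (auto intro!: dchar_cong simp: cong_def)

text \<open>The first period is estimated by absolute values and only the rest by partial summation,
  where the variation telescopes to \<open>w d\<close>. For weights of size 1/n this is logarithmic
  in \<open>d\<close>, where partial summation from the start would give order
  \<open>d\<close>.\<close>

lemma oscillating_antimono_bound:
  assumes g: "oscillating d g" and w: "\<And>n. n \<ge> d \<Longrightarrow> 0 \<le> w (Suc n) \<and> w (Suc n) \<le> w n"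
  shows "norm (\<Sum>n<N. g n * of_real (w n)) \<le> (\<Sum>n<d. \<bar>w n\<bar>) + d * w d"
proof -
  have g1: "norm (g i) \<le> 1" and d: "d > 0" for i using g by (auto simp: oscillating_def)
  have w0: "w d \<ge> 0" using w[of d] by auto
  have tri: "norm (\<Sum>n<M. g n * of_real (w n)) \<le> (\<Sum>n<M. \<bar>w n\<bar>)" for M
    using g1 by (intro sum_norm_le) (auto simp: norm_mult intro: mult_left_le_one_le)
  show ?thesis
  proof (cases "N \<le> d")
    case True
    have "(\<Sum>n<N. \<bar>w n\<bar>) \<le> (\<Sum>n<d. \<bar>w n\<bar>)" using True by (intro sum_mono2) auto
    thus ?thesis using tri[of N] w0 by (smt (verit) mult_nonneg_nonneg of_nat_0_le_iff)
  next
    case False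
    have tel: "(\<Sum>n\<in>{d..<N}. \<bar>w n - w (Suc n)\<bar>) + \<bar>w N\<bar> = w d" if "d \<le> N" for N
      using that
    proof (induction N rule: dec_induct)
      case (step n) thus ?case using w[of n] by auto
    qed (use w0 in auto)
    have "(\<Sum>n<N. g n * of_real (w n)) = (\<Sum>n<d. g n * of_real (w n)) + (\<Sum>n\<in>{d..<N}. g n * of_real (w n))"
      using False by (subst (1 2) lessThan_atLeast0) (intro sum.atLeastLessThan_concat [symmetric], auto)
    also have "norm \<dots> \<le> (\<Sum>n<d. \<bar>w n\<bar>) + d * ((\<Sum>n\<in>{d..<N}. \<bar>w n - w (Suc n)\<bar>) + \<bar>w N\<bar>)"
      using False by (intro order.trans[OF norm_triangle_ineq] add_mono tri abel_summation_bound
        oscillating_partial_sum[OF g]) auto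
    also have "\<dots> = (\<Sum>n<d. \<bar>w n\<bar>) + d * w d" using tel False by simp
    finally show ?thesis .
  qed
qed

text \<open>
  For the Dirichlet series $F(s) = \sum_n f(n) n^{-s}$, \<open>lcoeff \<delta> f k\<close> is the $k$-th coefficient of
  $F(1 + \delta - w)$ as a power series in $w$; the sign change of the variable makes all weights nonnegative.
\<close>

definition lcoeff :: "real \<Rightarrow> (nat \<Rightarrow> complex) \<Rightarrow> nat \<Rightarrow> complex" where
  "lcoeff \<delta> f k = (\<Sum>\<^sub>\<infinity>n. f n * of_real (lweight \<delta> k n))"

lemma lweight_nonneg: "lweight \<delta> k n \<ge> 0"
  by (cases "n = 0") (auto simp: lweight_eq intro!: log_kernel_nonneg)

lemma lweight_le_powr:
  assumes "r < 1 + \<delta>"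
  shows "lweight \<delta> k n \<le> (1 / (1 + \<delta> - r)) ^ k * real n powr - r"
proof (cases "n = 0")
  case False
  hence "lweight \<delta> k n \<le> (1 / (1 + \<delta> - r)) ^ k * exp (- r * ln n)"
    using assms log_kernel_le_exp[of "ln (real n)" r "1 + \<delta>" k] by (simp add: lweight_eq)
  thus ?thesis using False by (simp add: powr_def)
qed simp

lemma lweight_le_1: "\<delta> > 0 \<Longrightarrow> lweight \<delta> k n \<le> 1"
  using lweight_le_powr[of 0 \<delta> k n] power_le_one[of "1 / (1 + \<delta>)" k]
  by (cases "n = 0") auto

text \<open>Multiplication by \<open>ln n\<close> is differentiation of the Dirichlet series up to
  sign; the factor \<open>k + 1\<close> comes from the Taylor normalisation.\<close>

lemma ln_times_lweight:
  "ln (real n) * lweight \<delta> k n = real (k + 1) * lweight \<delta> (k + 1) n"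
proof -
  have "(fact (k + 1) :: real) = real (k + 1) * fact k" by simp
  thus ?thesis unfolding lweight_def by (simp add: divide_simps del: of_nat_Suc of_nat_add fact_Suc)
qed

lemma lweight_summable: "\<delta> > 0 \<Longrightarrow> lweight \<delta> k summable_on UNIV"
proof -
  assume \<delta>: "\<delta> > 0"
  have "summable (\<lambda>n. (1 / (1 + \<delta> - (1 + \<delta> / 2))) ^ k * real n powr - (1 + \<delta> / 2))"
    using \<delta> by (intro summable_mult) (subst summable_real_powr_iff, auto)
  hence "summable (lweight \<delta> k)"
    by (rule summable_comparison_test[rotated])
      (use \<delta> lweight_le_powr[of "1 + \<delta> / 2" \<delta> k] lweight_nonneg in \<open>auto intro!: exI[of _ 0]\<close>)
  thus ?thesis by (subst summable_on_UNIV_nonneg_real_iff) (auto simp: lweight_nonneg)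
qed

text \<open>The growth condition admits characters and their products with \<open>mangoldt\<close>;
  the logarithm is absorbed by the weight of index \<open>k + 1\<close>.\<close>

lemma lcoeff_abs_summable:
  fixes f :: "nat \<Rightarrow> complex"
  assumes "\<delta> > 0" "\<And>n. norm (f n) \<le> 1 + ln (real n)"
  shows "(\<lambda>n. norm (f n * of_real (lweight \<delta> k n))) summable_on UNIV"
proof (rule Infinite_Sum.abs_summable_on_comparison_test')
  show "(\<lambda>n. lweight \<delta> k n + real (k + 1) * lweight \<delta> (k + 1) n) summable_on UNIV"
    by (intro summable_on_add summable_on_cmult_right lweight_summable assms)
  fix n
  have "norm (f n * of_real (lweight \<delta> k n)) \<le> (1 + ln n) * lweight \<delta> k n"
    using assms(2)[of n] lweight_nonneg[of \<delta> k n] by (simp add: norm_mult mult_right_mono)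
  thus "norm (f n * of_real (lweight \<delta> k n)) \<le> lweight \<delta> k n + real (k + 1) * lweight \<delta> (k + 1) n"
    using ln_times_lweight[of n \<delta> k] by (simp add: algebra_simps)
qed

lemma lcoeff_sums:
  assumes "\<delta> > 0" "\<And>n. norm (f n) \<le> 1 + ln (real n)"
  shows "(\<lambda>n. f n * of_real (lweight \<delta> k n)) sums lcoeff \<delta> f k"
  unfolding lcoeff_def
  by (rule has_sum_imp_sums[OF has_sum_infsum[OF abs_summable_summable[OF lcoeff_abs_summable[OF assms]]]])

lemma norm_le_oneplus_ln: "norm (z::complex) \<le> 1 \<Longrightarrow> norm z \<le> 1 + ln (real n)"
  by (cases "n = 0") (auto intro: order.trans[of _ 1])

lemma norm_lcoeff_le:
  assumes "\<delta> > 0" "\<And>n. norm (f n) \<le> 1 + ln (real n)"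
    and "\<And>N. norm (\<Sum>n<N. f n * of_real (lweight \<delta> k n)) \<le> B"
  shows "norm (lcoeff \<delta> f k) \<le> B"
proof (rule tendsto_le)
  show "(\<lambda>N. norm (\<Sum>n<N. f n * of_real (lweight \<delta> k n))) \<longlonglongrightarrow> norm (lcoeff \<delta> f k)"
    using lcoeff_sums[OF assms(1,2)] unfolding sums_def by (intro tendsto_norm)
qed (use assms in \<open>auto intro!: tendsto_const\<close>)

lemma lweight_variation:
  assumes \<delta>: "\<delta> > 0"
  shows "(\<Sum>n\<in>{1..<N}. \<bar>lweight \<delta> k n - lweight \<delta> k (Suc n)\<bar>) \<le> 2"
proof -
  have s: "1 + \<delta> > 0" using \<delta> by simp
  obtain V where V: "\<And>x. x \<ge> 0 \<Longrightarrow> 0 \<le> V x \<and> V x \<le> 2 * (1 / (1 + \<delta>)) ^ k"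
    "\<And>x y. 0 \<le> x \<Longrightarrow> x \<le> y \<Longrightarrow> \<bar>log_kernel (1 + \<delta>) k y - log_kernel (1 + \<delta>) k x\<bar> \<le> V y - V x"
    using log_kernel_variation[OF s, of k] by blast
  have 1: "(1 / (1 + \<delta>)) ^ k \<le> 1" using \<delta> by (intro power_le_one) auto
  show ?thesis
  proof (cases "N \<ge> 1")
    case True
    have "(\<Sum>n\<in>{1..<N}. \<bar>lweight \<delta> k n - lweight \<delta> k (Suc n)\<bar>)
        \<le> (\<Sum>n\<in>{1..<N}. V (ln (Suc n)) - V (ln n))"
      by (intro sum_mono order.trans[OF _ V(2)]) (auto simp: lweight_eq abs_minus_commute)
    also have "\<dots> = V (ln N) - V (ln 1)"
      using True by (subst sum_Suc_diff') auto
    also have "\<dots> \<le> 2" using V(1)[of "ln N"] V(1)[of "ln 1"] True 1 by auto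
    finally show ?thesis .
  qed auto
qed

text \<open>The variation of the weights is at most 2 and the last weight at most 1, whatever
  \<open>k\<close> is. This uniformity controls the Taylor series on every disc of radius below
  1.\<close>

lemma oscillating_lcoeff_bound:
  assumes g: "oscillating d g" and \<delta>: "\<delta> > 0"
  shows "norm (lcoeff \<delta> g k) \<le> 3 * d"
proof (rule norm_lcoeff_le[OF \<delta>])
  show "norm (g n) \<le> 1 + ln (real n)" for n
    using g by (intro norm_le_oneplus_ln) (auto simp: oscillating_def)
  fix N
  show "norm (\<Sum>n<N. g n * of_real (lweight \<delta> k n)) \<le> 3 * d"
  proof (cases "N \<ge> 1")
    case True
    have "(\<Sum>n<N. g n * of_real (lweight \<delta> k n)) = (\<Sum>n\<in>{1..<N}. g n * of_real (lweight \<delta> k n))"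
      by (intro sum.mono_neutral_right) (auto simp: not_le)
    also have "norm \<dots> \<le> d * ((\<Sum>n\<in>{1..<N}. \<bar>lweight \<delta> k n - lweight \<delta> k (Suc n)\<bar>) + \<bar>lweight \<delta> k N\<bar>)"
      using True by (intro abel_summation_bound oscillating_partial_sum g) auto
    also have "\<dots> \<le> real d * (2 + 1)"
      using lweight_variation[OF \<delta>, of k N] lweight_le_1[OF \<delta>, of k N] lweight_nonneg[of \<delta> k N]
      by (intro mult_left_mono add_mono) auto
    finally show ?thesis by simp
  next
    case False
    thus ?thesis by (cases N) auto
  qed
qed

lemma sum_inverse_le:
  assumes "d > 0"
  shows "(\<Sum>n<d. 1 / real n) \<le> 1 + ln (real d)"
proof -
  have *: "(\<Sum>n<Suc m. 1 / real n) \<le> 1 + ln (real m)" if "m > 0" for m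
    using that
  proof (induction m rule: nat_induct_non_zero)
    case (Suc m)
    have "ln (real m / real (m + 1)) \<le> real m / real (m + 1) - 1" using Suc by (intro ln_le_minus_one) auto
    also have "\<dots> = - (1 / real (m + 1))" by (simp add: field_simps)
    finally have "1 / real (Suc m) \<le> ln (real (Suc m)) - ln (real m)"
      using Suc by (simp add: ln_div)
    thus ?case using Suc.IH by simp
  qed auto
  show ?thesis
  proof (cases "d = 1")
    case False
    hence "(\<Sum>n<Suc (d - 1). 1 / real n) \<le> 1 + ln (real (d - 1))" using assms by (intro *) auto
    also have "ln (real (d - 1)) \<le> ln (real d)" using assms False by (subst ln_le_cancel_iff) auto
    finally show ?thesis using assms by simp
  qed auto
qed

text \<open>The kernel decreases from \<open>k / (1 + \<delta>)\<close> on, which for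
  \<open>k \<le> 1\<close> is below \<open>ln 3\<close>.\<close>

lemma lweight_Suc_le:
  assumes \<delta>: "\<delta> > 0" and n: "n \<ge> 3" and k: "k \<le> 1"
  shows "lweight \<delta> k (Suc n) \<le> lweight \<delta> k n"
proof -
  have "exp 1 \<le> real n" using exp_le n by linarith
  hence "1 \<le> ln (real n)" using n by (subst ln_ge_iff) auto
  moreover have "real k / (1 + \<delta>) \<le> 1" using \<delta> k by (simp add: field_simps)
  ultimately have "real k / (1 + \<delta>) \<le> ln (real n)" by linarith
  hence "log_kernel (1 + \<delta>) k (ln (Suc n)) \<le> log_kernel (1 + \<delta>) k (ln n)"
    using \<delta> n by (intro log_kernel_antimono) auto
  thus ?thesis using n by (simp add: lweight_eq)
qed

text \<open>For \<open>k \<le> 1\<close> the weights already decrease after the first period, which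
  permits the logarithmic bound. Coefficients of higher index enter only with a factor of order
  \<open>\<delta> ^ 2\<close>, where \<open>3 * d\<close> is good enough.\<close>

lemma oscillating_lcoeff_0_1:
  assumes g: "oscillating d g" and \<delta>: "\<delta> > 0" and d: "d \<ge> 3" and k: "k \<le> 1"
  shows "norm (lcoeff \<delta> g k) \<le> ln d ^ k * (2 + ln d)"
proof (rule norm_lcoeff_le[OF \<delta>])
  show "norm (g n) \<le> 1 + ln (real n)" for n
    using g by (intro norm_le_oneplus_ln) (auto simp: oscillating_def)
  have fk: "fact k = (1::real)" using k by (cases k) auto
  have le: "lweight \<delta> k n \<le> ln d ^ k * (1 / real n)" if "n \<le> d" for n
  proof (cases "n = 0")
    case False
    have "lweight \<delta> k n = ln n ^ k * real n powr (- 1 - \<delta>)" by (simp add: lweight_def fk)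
    also have "\<dots> \<le> ln d ^ k * real n powr (-1)"
      using False that \<delta> d by (intro mult_mono power_mono powr_mono) auto
    finally show ?thesis using False by (simp add: powr_minus_divide)
  qed auto
  have lnd: "ln (real d) \<ge> 0" using d by auto
  fix N
  have "norm (\<Sum>n<N. g n * of_real (lweight \<delta> k n)) \<le>
      (\<Sum>n<d. \<bar>lweight \<delta> k n\<bar>) + d * lweight \<delta> k d"
    using d by (intro oscillating_antimono_bound g conjI lweight_nonneg lweight_Suc_le \<delta> k) auto
  also have "(\<Sum>n<d. \<bar>lweight \<delta> k n\<bar>) \<le> (\<Sum>n<d. ln d ^ k * (1 / real n))"
    using le lweight_nonneg by (intro sum_mono) auto
  also have "\<dots> = ln d ^ k * (\<Sum>n<d. 1 / real n)" by (simp only: sum_distrib_left)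
  also have "\<dots> \<le> ln d ^ k * (1 + ln d)" using sum_inverse_le[of d] d lnd by (intro mult_left_mono) auto
  also have "d * lweight \<delta> k d \<le> d * (ln d ^ k * (1 / real d))" by (intro mult_left_mono le) auto
  also have "\<dots> = ln d ^ k" using d by simp
  finally show "norm (\<Sum>n<N. g n * of_real (lweight \<delta> k n)) \<le> ln d ^ k * (2 + ln d)"
    by (simp add: algebra_simps)
qed

text \<open>Repeated integration by parts. At \<open>t = 1\<close> only the term
  \<open>i = 0\<close> survives; up to sign it is the coefficient
  \<open>(1 / \<delta>) ^ (k + 1)\<close> of the pole.\<close>

lemma log_kernel_antiderivative:
  fixes \<delta> t :: real
  assumes "\<delta> \<noteq> 0" "t > 0"
  shows "((\<lambda>t. - (\<Sum>i\<le>k. log_kernel \<delta> i (ln t) / \<delta> ^ (k + 1 - i))) has_real_derivative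
           log_kernel (1 + \<delta>) k (ln t)) (at t)"
proof (induction k)
  case 0
  have "((\<lambda>t. - (exp (- \<delta> * ln t) / \<delta>)) has_real_derivative exp (- \<delta> * ln t) / t) (at t)"
    using assms by (auto intro!: derivative_eq_intros)
  moreover have "exp (- \<delta> * ln t) / t = exp (- (1 + \<delta>) * ln t)"
    using assms by (simp add: algebra_simps exp_diff exp_minus inverse_eq_divide)
  ultimately show ?case by (simp add: log_kernel_def)
next
  case (Suc k)
  have "((\<lambda>t. - (\<Sum>i\<le>k. log_kernel \<delta> i (ln t) / \<delta> ^ (k + 1 - i)) / \<delta> - log_kernel \<delta> (Suc k) (ln t) / \<delta>)
     has_real_derivative log_kernel (1 + \<delta>) k (ln t) / \<delta> -
       exp (- \<delta> * ln t) * (of_nat (Suc k) * ln t ^ k - \<delta> * ln t ^ Suc k) / fact (Suc k) * (1 / t) / \<delta>) (at t)"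
    using assms has_real_derivative_log_kernel[of \<delta> "Suc k" "ln t"]
    by (intro DERIV_diff DERIV_cdivide DERIV_chain2[where g = ln] Suc DERIV_ln_divide) auto
  moreover have "exp (- \<delta> * ln t) * (1 / t) = exp (- (1 + \<delta>) * ln t)"
    using assms by (simp add: algebra_simps exp_diff exp_minus inverse_eq_divide)
  hence "log_kernel (1 + \<delta>) k (ln t) / \<delta> -
       exp (- \<delta> * ln t) * (of_nat (Suc k) * ln t ^ k - \<delta> * ln t ^ Suc k) / fact (Suc k) * (1 / t) / \<delta>
     = log_kernel (1 + \<delta>) (Suc k) (ln t)"
    unfolding log_kernel_def using assms by (simp add: divide_simps) (simp add: algebra_simps)
  moreover have "- (\<Sum>i\<le>Suc k. log_kernel \<delta> i (ln t) / \<delta> ^ (Suc k + 1 - i)) =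
     - (\<Sum>i\<le>k. log_kernel \<delta> i (ln t) / \<delta> ^ (k + 1 - i)) / \<delta> - log_kernel \<delta> (Suc k) (ln t) / \<delta>" for t
    by (simp add: sum_divide_distrib Suc_diff_le mult.commute)
  ultimately show ?case by simp
qed

text \<open>The zeta function at 1 + \<delta> - w is 1 / (\<delta> - w) plus a regular part, and
  \<open>(1 / \<delta>) ^ (k + 1)\<close> is the coefficient of the polar term. The error is the
  difference of a sum and an integral, hence at most the variation of the kernel.\<close>

lemma lcoeff_one:
  assumes \<delta>: "\<delta> > 0"
  shows "norm (lcoeff \<delta> (\<lambda>_. 1) k - of_real ((1 / \<delta>) ^ (k + 1))) \<le> 2"
proof -
  define H where "H = (\<lambda>t. - (\<Sum>i\<le>k. log_kernel \<delta> i (ln t) / \<delta> ^ (k + 1 - i)))"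
  have s: "1 + \<delta> > 0" using \<delta> by simp
  obtain V where V: "\<And>x. x \<ge> 0 \<Longrightarrow> 0 \<le> V x \<and> V x \<le> 2 * (1 / (1 + \<delta>)) ^ k"
    "\<And>x y. 0 \<le> x \<Longrightarrow> x \<le> y \<Longrightarrow> \<bar>log_kernel (1 + \<delta>) k y - log_kernel (1 + \<delta>) k x\<bar> \<le> V y - V x"
    using log_kernel_variation[OF s, of k] by blast
  have 1: "(1 / (1 + \<delta>)) ^ k \<le> 1" using \<delta> by (intro power_le_one) auto
  \<comment> \<open>The integral over [n, n + 1] is the kernel at an intermediate point, so the
    error of this term is at most the variation on that interval.\<close>
  have step: "\<bar>lweight \<delta> k n - (H (Suc n) - H n)\<bar> \<le> V (ln (Suc n)) - V (ln n)" if n: "n \<ge> 1" for n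
  proof -
    obtain z where z: "real n < z" "z < real (Suc n)"
      "H (real (Suc n)) - H (real n) = (real (Suc n) - real n) * log_kernel (1 + \<delta>) k (ln z)"
      using MVT2[of "real n" "real (Suc n)" H "\<lambda>t. log_kernel (1 + \<delta>) k (ln t)"]
        log_kernel_antiderivative[of \<delta> _ k] \<delta> n by (auto simp: H_def)
    have "\<bar>log_kernel (1 + \<delta>) k (ln z) - log_kernel (1 + \<delta>) k (ln n)\<bar> \<le> V (ln z) - V (ln n)"
      using z n by (intro V(2)) auto
    moreover have "V (ln z) \<le> V (ln (Suc n))" using V(2)[of "ln z" "ln (Suc n)"] z n by auto
    ultimately show ?thesis using z n by (simp add: lweight_eq abs_minus_commute)
  qed
  have part: "\<bar>(\<Sum>n<N. lweight \<delta> k n) - (H N - H 1)\<bar> \<le> 2" if N: "N \<ge> 1" for N :: nat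
  proof -
    have "(\<Sum>n<N. lweight \<delta> k n) = (\<Sum>n\<in>{1..<N}. lweight \<delta> k n)"
      by (intro sum.mono_neutral_right) (auto simp: not_le)
    moreover have "H N - H 1 = (\<Sum>n\<in>{1..<N}. H (Suc n) - H n)" using N by (subst sum_Suc_diff') auto
    ultimately have "\<bar>(\<Sum>n<N. lweight \<delta> k n) - (H N - H 1)\<bar> =
        \<bar>\<Sum>n\<in>{1..<N}. lweight \<delta> k n - (H (Suc n) - H n)\<bar>" by (simp add: sum_subtractf)
    also have "\<dots> \<le> (\<Sum>n\<in>{1..<N}. V (ln (Suc n)) - V (ln n))"
      by (intro order.trans[OF sum_abs] sum_mono step) auto
    also have "\<dots> = V (ln N) - V (ln 1)" using N by (subst sum_Suc_diff') auto
    also have "\<dots> \<le> 2" using V(1)[of "ln N"] V(1)[of "ln 1"] N 1 by auto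
    finally show ?thesis .
  qed
  have H1: "H 1 = - ((1 / \<delta>) ^ (k + 1))"
  proof -
    have "(\<Sum>i\<le>k. log_kernel \<delta> i (ln 1) / \<delta> ^ (k + 1 - i)) = (\<Sum>i\<in>{0}. log_kernel \<delta> i (ln 1) / \<delta> ^ (k + 1 - i))"
      by (intro sum.mono_neutral_right) (auto simp: log_kernel_def)
    thus ?thesis by (simp add: H_def log_kernel_def power_one_over)
  qed
  have lk0: "(\<lambda>N. log_kernel \<delta> i (ln (real N))) \<longlonglongrightarrow> 0" for i
  proof (rule tendsto_sandwich)
    show "eventually (\<lambda>N. 0 \<le> log_kernel \<delta> i (ln (real N))) sequentially"
      using eventually_gt_at_top[of 0] by eventually_elim (auto intro!: log_kernel_nonneg)
    show "eventually (\<lambda>N. log_kernel \<delta> i (ln (real N)) \<le> (1 / (\<delta> / 2)) ^ i * real N powr - (\<delta> / 2)) sequentially"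
      using eventually_gt_at_top[of 0]
    proof eventually_elim
      case (elim N)
      thus ?case using log_kernel_le_exp[of "ln (real N)" "\<delta> / 2" \<delta> i] \<delta> by (simp add: powr_def)
    qed
    have "(\<lambda>N. real N powr - (\<delta> / 2)) \<longlonglongrightarrow> 0" using \<delta> by real_asymp
    from tendsto_mult_right_zero[OF this] show "(\<lambda>N. (1 / (\<delta> / 2)) ^ i * real N powr - (\<delta> / 2)) \<longlonglongrightarrow> 0" .
  qed auto
  have H0: "(\<lambda>N. H (real N)) \<longlonglongrightarrow> 0" unfolding H_def
    by (rule tendsto_eq_rhs, rule tendsto_minus, rule tendsto_sum, rule tendsto_divide[OF lk0 tendsto_const])
       (use \<delta> in auto)
  have lim: "(\<lambda>N. (\<Sum>n<N. 1 * complex_of_real (lweight \<delta> k n)) - of_real (H N - H 1)) \<longlonglongrightarrow>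
     lcoeff \<delta> (\<lambda>_. 1) k - of_real (0 - H 1)"
    using lcoeff_sums[of \<delta> "\<lambda>_. 1" k] \<delta> norm_le_oneplus_ln[of 1] unfolding sums_def
    by (intro tendsto_diff tendsto_of_real H0 tendsto_const) auto
  have "norm (lcoeff \<delta> (\<lambda>_. 1) k - of_real (0 - H 1)) \<le> 2"
  proof (rule tendsto_le[OF _ tendsto_const tendsto_norm[OF lim]])
    show "eventually (\<lambda>N. norm ((\<Sum>n<N. 1 * complex_of_real (lweight \<delta> k n)) - of_real (H N - H 1)) \<le> 2) sequentially"
      using eventually_ge_at_top[of 1]
    proof eventually_elim
      case (elim N)
      have "(\<Sum>n<N. 1 * complex_of_real (lweight \<delta> k n)) - of_real (H N - H 1) =
         of_real ((\<Sum>n<N. lweight \<delta> k n) - (H N - H 1))" by simp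
      thus ?case using part[OF elim] by (simp only: norm_of_real)
    qed
  qed auto
  thus ?thesis using H1 by simp
qed

section \<open>Logarithmic derivatives\<close>

text \<open>Pairs are grouped by their product \<open>n = a * b\<close>, with
  \<open>b = n div a\<close>; this turns products of series into Dirichlet convolutions.\<close>

lemma infsum_mult_pairs:
  fixes F :: "nat \<Rightarrow> nat \<Rightarrow> 'c :: banach"
  assumes "(\<lambda>(a, b). F a b) summable_on ({0<..} \<times> {0<..})"
  shows "(\<Sum>\<^sub>\<infinity>(a, b)\<in>{0<..} \<times> {0<..}. F a b) = (\<Sum>\<^sub>\<infinity>n\<in>{0<..}. \<Sum>a | a dvd n. F a (n div a))"
proof -
  define T where "T = Sigma {0<..} (\<lambda>n :: nat. {a. a dvd n})"
  have eq: "(\<lambda>(a, b). F a b) summable_on ({0<..} \<times> {0<..}) \<longleftrightarrow> (\<lambda>(n, a). F a (n div a)) summable_on T"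
    by (rule summable_on_reindex_bij_witness[where i = "\<lambda>(n, a). (a, n div a)" and j = "\<lambda>(a, b). (a * b, a)"])
      (auto simp: T_def dvd_div_eq_0_iff intro!: Nat.gr0I)
  have "(\<Sum>\<^sub>\<infinity>(a, b)\<in>{0<..} \<times> {0<..}. F a b) = (\<Sum>\<^sub>\<infinity>(n, a)\<in>T. F a (n div a))"
    by (rule infsum_reindex_bij_witness[where i = "\<lambda>(n, a). (a, n div a)" and j = "\<lambda>(a, b). (a * b, a)"])
      (auto simp: T_def dvd_div_eq_0_iff intro!: Nat.gr0I)
  also have "\<dots> = (\<Sum>\<^sub>\<infinity>n\<in>{0<..}. \<Sum>\<^sub>\<infinity>a\<in>{a. a dvd n}. F a (n div a))"
    using infsum_Sigma_banach[of "\<lambda>(n, a). F a (n div a)" "{0<..}" "\<lambda>n. {a. a dvd n}"] assms eq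
    by (simp add: T_def)
  also have "\<dots> = (\<Sum>\<^sub>\<infinity>n\<in>{0<..}. \<Sum>a | a dvd n. F a (n div a))"
    by (intro infsum_cong infsum_finite) auto
  finally show ?thesis .
qed

lemma
  fixes f :: "'a \<Rightarrow> 'c :: {real_normed_field, banach}" and g :: "'b \<Rightarrow> 'c"
  assumes "(\<lambda>a. norm (f a)) summable_on A" "(\<lambda>b. norm (g b)) summable_on B"
  shows abs_summable_on_product: "(\<lambda>(a, b). f a * g b) summable_on (A \<times> B)"
    and infsum_product_abs: "infsum f A * infsum g B = (\<Sum>\<^sub>\<infinity>(a, b)\<in>A \<times> B. f a * g b)"
proof -
  have "(\<lambda>x. norm ((\<lambda>(a, b). f a * g b) x)) summable_on (A \<times> B)"
    unfolding Infinite_Sum.abs_summable_on_Sigma_iff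
    using assms by (auto simp: norm_mult infsum_cmult_right' infsum_nonneg
      intro!: summable_on_cmult_right summable_on_cmult_left)
  thus *: "(\<lambda>(a, b). f a * g b) summable_on (A \<times> B)" by (rule abs_summable_summable)
  show "infsum f A * infsum g B = (\<Sum>\<^sub>\<infinity>(a, b)\<in>A \<times> B. f a * g b)"
    using infsum_Sigma_banach[OF *] by (simp add: infsum_cmult_right' infsum_cmult_left')
qed

lemma has_sum_sum:
  fixes f :: "'i \<Rightarrow> 'a \<Rightarrow> 'b :: topological_comm_monoid_add"
  assumes "\<And>i. i \<in> I \<Longrightarrow> (f i has_sum s i) A"
  shows "((\<lambda>x. \<Sum>i\<in>I. f i x) has_sum (\<Sum>i\<in>I. s i)) A"
  using assms by (induction I rule: infinite_finite_induct) (auto intro: has_sum_add)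

lemma
  fixes f :: "'i \<Rightarrow> 'a \<Rightarrow> 'b :: {topological_comm_monoid_add, t2_space}"
  assumes "\<And>i. i \<in> I \<Longrightarrow> f i summable_on A"
  shows summable_on_sum: "(\<lambda>x. \<Sum>i\<in>I. f i x) summable_on A"
    and infsum_sum: "(\<Sum>\<^sub>\<infinity>x\<in>A. \<Sum>i\<in>I. f i x) = (\<Sum>i\<in>I. infsum (f i) A)"
  using has_sum_sum[of I f A "\<lambda>i. infsum (f i) A"] assms
  by (auto simp: has_sum_iff)

lemma norm_dchar_mangoldt_le:
  assumes "\<psi> \<in> dchars d" "d > 0"
  shows "norm (\<psi> n * mangoldt n) \<le> 1 + ln (real n)"
proof (cases "n = 0")
  case False
  have "norm (\<psi> n * mangoldt n) \<le> 1 * ln (real n)"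
    unfolding norm_mult norm_mangoldt using norm_dchar_le[OF assms, of n] mangoldt_le[of n] False
    by (intro mult_mono) (auto simp: mangoldt_nonneg)
  thus ?thesis by simp
qed auto

text \<open>The binomial theorem for \<open>(ln a + ln b) ^ k\<close>. Consequently Cauchy products
  of the sequences \<open>lcoeff\<close> correspond to Dirichlet convolutions of arithmetic
  functions.\<close>

lemma lweight_mult:
  assumes "a > 0" "b > 0"
  shows "(\<Sum>i\<le>k. lweight \<delta> i a * lweight \<delta> (k - i) b) = lweight \<delta> k (a * b)"
proof -
  have "lweight \<delta> k (a * b) = (real a * real b) powr (- 1 - \<delta>) * ((ln a + ln b) ^ k / fact k)"
    using assms by (simp add: lweight_def ln_mult)
  also have "(ln (real a) + ln (real b)) ^ k / fact k = (\<Sum>i\<le>k. ln a ^ i / fact i * (ln b ^ (k - i) / fact (k - i)))"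
    unfolding binomial_ring sum_divide_distrib
    by (intro sum.cong refl) (auto simp: binomial_fact field_simps)
  finally show ?thesis by (simp add: lweight_def powr_mult sum_distrib_left mult_ac)
qed

text \<open>Coefficient form of F' = (F'/F) F in the variable \<open>w\<close>, whose sign makes
  F'/F the series of \<open>\<psi> n * mangoldt n\<close>. It rests on \<open>mangoldt\<close>
  having divisor sum \<open>ln n\<close> and on \<open>\<psi>\<close> being completely
  multiplicative.\<close>

lemma lcoeff_log_derivative:
  assumes \<psi>: "\<psi> \<in> dchars d" and d: "d > 1" and \<delta>: "\<delta> > 0"
  shows "of_nat (k + 1) * lcoeff \<delta> \<psi> (k + 1) = (\<Sum>i\<le>k. lcoeff \<delta> (\<lambda>n. \<psi> n * mangoldt n) i * lcoeff \<delta> \<psi> (k - i))"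
proof -
  let ?w = "lweight \<delta>"
  have bd: "norm (\<psi> n) \<le> 1 + ln (real n)" for n using norm_dchar_le[OF \<psi>] d by (intro norm_le_oneplus_ln) auto
  have pos: "lcoeff \<delta> f j = (\<Sum>\<^sub>\<infinity>n\<in>{0<..}. f n * of_real (?w j n))" for f j
    unfolding lcoeff_def by (intro infsum_cong_neutral) auto
  have s1: "(\<lambda>n. norm (\<psi> n * of_real (?w j n))) summable_on {0<..}" for j
    by (rule summable_on_subset_banach[OF lcoeff_abs_summable[OF \<delta> bd]]) auto
  have s2: "(\<lambda>n. norm (\<psi> n * mangoldt n * of_real (?w j n))) summable_on {0<..}" for j
    using norm_dchar_mangoldt_le[OF \<psi>] d
    by (intro summable_on_subset_banach[OF lcoeff_abs_summable[OF \<delta>]]) auto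
  have eq: "(\<Sum>i\<le>k. (\<psi> a * mangoldt a * of_real (?w i a)) * (\<psi> b * of_real (?w (k - i) b))) =
      \<psi> (a * b) * mangoldt a * of_real (?w k (a * b))" if "a > 0" "b > 0" for a b
    unfolding lweight_mult[OF that, symmetric]
    by (simp add: dchar_mult[OF \<psi>] sum_distrib_left sum_distrib_right mult_ac)
  have sm: "(\<lambda>x. \<Sum>i\<le>k. case x of (a, b) \<Rightarrow> (\<psi> a * mangoldt a * of_real (?w i a)) * (\<psi> b * of_real (?w (k - i) b)))
      summable_on ({0<..} \<times> {0<..})"
    by (intro summable_on_sum abs_summable_on_product s1 s2)
  have sm': "(\<lambda>(a, b). \<psi> (a * b) * mangoldt a * of_real (?w k (a * b))) summable_on ({0<..} \<times> {0<..})"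
    by (rule summable_on_cong[THEN iffD1, OF _ sm]) (auto simp: eq)
  have "(\<Sum>i\<le>k. lcoeff \<delta> (\<lambda>n. \<psi> n * mangoldt n) i * lcoeff \<delta> \<psi> (k - i)) =
      (\<Sum>i\<le>k. \<Sum>\<^sub>\<infinity>(a, b)\<in>{0<..} \<times> {0<..}. (\<psi> a * mangoldt a * of_real (?w i a)) * (\<psi> b * of_real (?w (k - i) b)))"
    unfolding pos by (intro sum.cong refl infsum_product_abs s1 s2)
  also have "\<dots> = (\<Sum>\<^sub>\<infinity>x\<in>{0<..} \<times> {0<..}. \<Sum>i\<le>k. case x of (a, b) \<Rightarrow> (\<psi> a * mangoldt a * of_real (?w i a)) * (\<psi> b * of_real (?w (k - i) b)))"
    by (intro infsum_sum [symmetric] abs_summable_on_product s1 s2)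
  also have "\<dots> = (\<Sum>\<^sub>\<infinity>(a, b)\<in>{0<..} \<times> {0<..}. \<psi> (a * b) * mangoldt a * of_real (?w k (a * b)))"
    by (intro infsum_cong) (auto simp: eq)
  also have "\<dots> = (\<Sum>\<^sub>\<infinity>n\<in>{0<..}. \<Sum>a | a dvd n. \<psi> (a * (n div a)) * mangoldt a * of_real (?w k (a * (n div a))))"
    by (intro infsum_mult_pairs sm')
  also have "\<dots> = (\<Sum>\<^sub>\<infinity>n\<in>{0<..}. of_nat (k + 1) * (\<psi> n * of_real (?w (k + 1) n)))"
  proof (intro infsum_cong)
    fix n :: nat assume n: "n \<in> {0<..}"
    have "(\<Sum>a | a dvd n. \<psi> (a * (n div a)) * mangoldt a * of_real (?w k (a * (n div a)))) =
        \<psi> n * of_real (?w k n) * (\<Sum>a | a dvd n. mangoldt a)"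
      unfolding sum_distrib_left by (intro sum.cong refl) auto
    also have "\<dots> = \<psi> n * of_real (ln n * ?w k n)"
      using n by (subst mangoldt_sum) auto
    finally show "(\<Sum>a | a dvd n. \<psi> (a * (n div a)) * mangoldt a * of_real (?w k (a * (n div a)))) =
        of_nat (k + 1) * (\<psi> n * of_real (?w (k + 1) n))"
      by (simp only: ln_times_lweight of_real_mult of_real_of_nat_eq mult_ac)
  qed
  also have "\<dots> = of_nat (k + 1) * lcoeff \<delta> \<psi> (k + 1)"
    unfolding pos by (simp add: infsum_cmult_right')
  finally show ?thesis by simp
qed

text \<open>
  The recurrence says \<open>F' = D F\<close> for formal power series. If the constant term of \<open>F\<close> dominates in the norm
  \<open>\<Sum>|F\<^sub>j| R\<^sup>j\<close>, then \<open>F\<close> is invertible there; this replaces a zero-free disc and Cauchy estimates.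
\<close>

lemma log_derivative_coeff_bound:
  fixes F D :: "nat \<Rightarrow> complex"
  assumes rec: "\<And>k. of_nat (k + 1) * F (k + 1) = (\<Sum>i\<le>k. D i * F (k - i))"
    and R: "R > 0" and F0: "F 0 \<noteq> 0"
    and F: "\<And>k. 2 * (\<Sum>j\<in>{1..k}. norm (F j) * R ^ j) \<le> norm (F 0)"
    and B: "\<And>k. real (k + 1) * norm (F (k + 1)) * R ^ k \<le> B"
  shows "norm (D k) * R ^ k \<le> 2 * B / norm (F 0)"
proof (induction k rule: less_induct)
  case (less k)
  \<comment> \<open>\<open>M\<close> solves \<open>B + M * norm (F 0) / 2 = M * norm (F 0)\<close>,
    which closes the induction.\<close>
  define M where "M = 2 * B / norm (F 0)"
  have "0 \<le> real (0 + 1) * norm (F (0 + 1)) * R ^ 0" by simp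
  hence "B \<ge> 0" using B[of 0] by linarith
  hence M: "M \<ge> 0" "M * norm (F 0) = 2 * B" using F0 by (auto simp: M_def)
  have "(\<Sum>i\<le>k. D i * F (k - i)) = D k * F 0 + (\<Sum>i<k. D i * F (k - i))"
    by (simp add: lessThan_Suc_atMost [symmetric])
  hence "norm (D k * F 0) = norm (of_nat (k + 1) * F (k + 1) - (\<Sum>i<k. D i * F (k - i)))"
    using rec[of k] by simp
  also have "\<dots> \<le> real (k + 1) * norm (F (k + 1)) + (\<Sum>i<k. norm (D i) * norm (F (k - i)))"
    by (intro order.trans[OF norm_triangle_ineq4] add_mono order.trans[OF norm_sum])
      (auto simp: norm_mult simp del: of_nat_Suc of_nat_add)
  finally have "norm (D k) * norm (F 0) * R ^ k \<le>
      (real (k + 1) * norm (F (k + 1)) + (\<Sum>i<k. norm (D i) * norm (F (k - i)))) * R ^ k"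
    using R by (intro mult_right_mono) (auto simp: norm_mult)
  also have "\<dots> = real (k + 1) * norm (F (k + 1)) * R ^ k + (\<Sum>i<k. (norm (D i) * R ^ i) * (norm (F (k - i)) * R ^ (k - i)))"
  proof -
    have "(\<Sum>i<k. norm (D i) * norm (F (k - i))) * R ^ k = (\<Sum>i<k. (norm (D i) * R ^ i) * (norm (F (k - i)) * R ^ (k - i)))"
      unfolding sum_distrib_right
    proof (intro sum.cong refl)
      fix i assume "i \<in> {..<k}"
      hence "R ^ k = R ^ i * R ^ (k - i)" by (simp flip: power_add)
      thus "norm (D i) * norm (F (k - i)) * R ^ k = norm (D i) * R ^ i * (norm (F (k - i)) * R ^ (k - i))"
        by simp
    qed
    thus ?thesis by (simp only: distrib_right)
  qed
  also have "\<dots> \<le> B + (\<Sum>i<k. M * (norm (F (k - i)) * R ^ (k - i)))"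
    using less R by (intro add_mono B sum_mono mult_right_mono) (auto simp: M_def)
  also have "(\<Sum>i<k. M * (norm (F (k - i)) * R ^ (k - i))) = M * (\<Sum>i<k. norm (F (k - i)) * R ^ (k - i))"
    by (simp only: sum_distrib_left)
  also have "(\<Sum>i<k. norm (F (k - i)) * R ^ (k - i)) = (\<Sum>j\<in>{1..k}. norm (F j) * R ^ j)"
    by (rule sum.reindex_bij_witness[of _ "\<lambda>j. k - j" "\<lambda>i. k - i"]) auto
  also have "M * \<dots> \<le> M * (norm (F 0) / 2)" using F[of k] M by (intro mult_left_mono) auto
  also have "B + M * (norm (F 0) / 2) = M * norm (F 0)" using M by simp
  finally have "norm (D k) * R ^ k * norm (F 0) \<le> M * norm (F 0)" by (simp add: mult_ac)
  hence "norm (D k) * R ^ k \<le> M" using F0 by (simp add: mult_le_cancel_right)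
  thus ?case by (simp add: M_def)
qed

text \<open>
  Passing from \<open>F\<close> to \<open>(\<delta> - w) F\<close> removes the pole of the principal \<open>L\<close>-function from its logarithmic derivative.
\<close>

lemma shifted_log_derivative_recurrence:
  fixes F D :: "nat \<Rightarrow> complex"
  assumes rec: "\<And>k. of_nat (k + 1) * F (k + 1) = (\<Sum>i\<le>k. D i * F (k - i))"
    and \<delta>: "\<delta> \<noteq> 0"
  defines "P \<equiv> (\<lambda>k. \<delta> * F k - (if k = 0 then 0 else F (k - 1)))"
  shows "of_nat (k + 1) * P (k + 1) = (\<Sum>i\<le>k. (D i - (1 / \<delta>) ^ (i + 1)) * P (k - i))"
proof -
  have "(\<Sum>i\<le>k. D i * P (k - i)) = \<delta> * (\<Sum>i\<le>k. D i * F (k - i)) - (\<Sum>i\<le>k. D i * (if k - i = 0 then 0 else F (k - i - 1)))"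
    unfolding P_def by (simp add: sum_distrib_left sum_subtractf algebra_simps)
  \<comment> \<open>The summand \<open>i = k\<close> vanishes and the others form the recurrence at
    \<open>k - 1\<close>.\<close>
  also have "(\<Sum>i\<le>k. D i * (if k - i = 0 then 0 else F (k - i - 1))) = of_nat k * F k"
  proof (cases k)
    case (Suc j)
    have "(\<Sum>i\<le>k. D i * (if k - i = 0 then 0 else F (k - i - 1))) = (\<Sum>i\<le>j. D i * F (j - i))"
      unfolding Suc sum.atMost_Suc by (auto simp: Suc_diff_le intro!: sum.cong)
    thus ?thesis using rec[of j] Suc by simp
  qed auto
  finally have 1: "(\<Sum>i\<le>k. D i * P (k - i)) = \<delta> * (of_nat (k + 1) * F (k + 1)) - of_nat k * F k"
    using rec[of k] by simp
  \<comment> \<open>\<open>P\<close> is the sequence of \<open>(\<delta> - w) F\<close>, so its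
    product with the geometric series of \<open>1 / (\<delta> - w)\<close> gives back
    \<open>F\<close>; the partial sums telescope.\<close>
  have tel: "(\<Sum>i<j. (1 / \<delta>) ^ (i + 1) * P (k - i)) = F k - (1 / \<delta>) ^ j * F (k - j)" if "j \<le> k" for j
    using that
  proof (induction j)
    case (Suc j)
    hence "(1 / \<delta>) ^ (j + 1) * P (k - j) = (1 / \<delta>) ^ j * F (k - j) - (1 / \<delta>) ^ (Suc j) * F (k - Suc j)"
      using \<delta> by (auto simp: P_def field_simps)
    thus ?case using Suc by simp
  qed auto
  have "(\<Sum>i\<le>k. (1 / \<delta>) ^ (i + 1) * P (k - i)) = (\<Sum>i<k. (1 / \<delta>) ^ (i + 1) * P (k - i)) + (1 / \<delta>) ^ (k + 1) * P 0"
    by (simp add: lessThan_Suc_atMost [symmetric])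
  also have "\<dots> = F k" using tel[of k] \<delta> by (simp add: P_def field_simps)
  finally have 2: "(\<Sum>i\<le>k. (1 / \<delta>) ^ (i + 1) * P (k - i)) = F k" .
  have "(\<Sum>i\<le>k. (D i - (1 / \<delta>) ^ (i + 1)) * P (k - i)) = \<delta> * (of_nat (k + 1) * F (k + 1)) - of_nat k * F k - F k"
    using 1 2 by (simp add: left_diff_distrib sum_subtractf)
  also have "\<dots> = of_nat (k + 1) * P (k + 1)" by (simp add: P_def algebra_simps)
  finally show ?thesis by simp
qed

lemma sum_power_tail_le:
  fixes R C a :: real
  assumes "0 < R" "R \<le> 1 / 2" "C \<ge> 0" "f 1 \<le> a" "\<And>j. j \<ge> 2 \<Longrightarrow> f j \<le> C" "a \<ge> 0"
  shows "(\<Sum>j\<in>{1..k}. f j * R ^ j) \<le> a * R + 2 * C * R ^ 2"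
proof (cases "k \<ge> 1")
  case True
  \<comment> \<open>The subtracted \<open>R ^ k\<close> makes the claim inductive, as
    \<open>2 * R ^ Suc k \<le> R ^ k\<close>.\<close>
  have geo: "(\<Sum>j\<in>{2..k}. R ^ j) \<le> 2 * R ^ 2 - (if k \<ge> 2 then R ^ k else 0)" for k
  proof (induction k)
    case (Suc k)
    have "2 * R ^ Suc k \<le> R ^ k" using assms by simp
    thus ?case using Suc by (cases "Suc k = 2") (auto simp: not_le numeral_2_eq_2 power2_eq_square le_Suc_eq)
  qed auto
  have "(\<Sum>j\<in>{1..k}. f j * R ^ j) = f 1 * R + (\<Sum>j\<in>{2..k}. f j * R ^ j)"
    using True by (subst sum.atLeast_Suc_atMost) (auto simp: numeral_2_eq_2)
  also have "\<dots> \<le> a * R + (\<Sum>j\<in>{2..k}. C * R ^ j)"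
    using assms by (intro add_mono sum_mono mult_right_mono) auto
  also have "(\<Sum>j\<in>{2..k}. C * R ^ j) = C * (\<Sum>j\<in>{2..k}. R ^ j)" by (simp add: sum_distrib_left)
  also have "\<dots> \<le> C * (2 * R ^ 2)"
    using geo[of k] assms by (intro mult_left_mono) (auto intro: order.trans split: if_splits)
  finally show ?thesis by simp
qed (use assms in auto)

lemma Suc_times_power_le_1:
  fixes R :: real
  assumes "0 \<le> R" "R \<le> 1 / 2"
  shows "real (k + 1) * R ^ k \<le> 1"
proof -
  have "real (k + 1) * R ^ k \<le> 2 ^ k * (1 / 2) ^ k"
  proof (intro mult_mono power_mono)
    have "k + 1 \<le> 2 ^ k" by (induction k) auto
    thus "real (k + 1) \<le> 2 ^ k" by (metis of_nat_le_iff of_nat_numeral of_nat_power)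
  qed (use assms in auto)
  thus ?thesis by (simp flip: power_mult_distrib)
qed

text \<open>The radius \<open>2 * \<delta>\<close> exceeds the distance \<open>\<delta>\<close> to
  the pole of the principal series and so gains a factor \<open>2 ^ k\<close> against the main term
  \<open>(1 / \<delta>) ^ (k + 1)\<close>. The condition \<open>small\<close> makes the constant
  term dominate, with the logarithmic bound for \<open>j = 1\<close> and \<open>3 * d\<close> for
  \<open>j \<ge> 2\<close>.\<close>

lemma nonprincipal_log_derivative_bound:
  assumes \<psi>: "\<psi> \<in> dchars d" "\<psi> \<noteq> principal_dchar d" and d: "d \<ge> 3" and \<delta>: "\<delta> > 0" "\<delta> \<le> 1 / 4"
    and l: "l > 0" "l \<le> norm (lcoeff \<delta> \<psi> 0)"
    and small: "2 * (ln d * (2 + ln d) * (2 * \<delta>) + 6 * d * (2 * \<delta>) ^ 2) \<le> l"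
  shows "norm (lcoeff \<delta> (\<lambda>n. \<psi> n * mangoldt n) k) * (2 * \<delta>) ^ k \<le> 6 * d / l"
proof -
  note osc = oscillating_dchar[OF \<psi>]
  have osc: "oscillating d \<psi>" using osc d by auto
  let ?F = "lcoeff \<delta> \<psi>"
  have bd: "norm (?F k) \<le> 3 * d" for k by (rule oscillating_lcoeff_bound[OF osc \<delta>(1)])
  have "norm (lcoeff \<delta> (\<lambda>n. \<psi> n * mangoldt n) k) * (2 * \<delta>) ^ k \<le> 2 * real (3 * d) / norm (?F 0)"
  proof (rule log_derivative_coeff_bound)
    show "of_nat (k + 1) * ?F (k + 1) = (\<Sum>i\<le>k. lcoeff \<delta> (\<lambda>n. \<psi> n * mangoldt n) i * ?F (k - i))" for k
      using lcoeff_log_derivative[OF \<psi>(1) _ \<delta>(1)] d by auto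
    show "2 * (\<Sum>j\<in>{1..k}. norm (?F j) * (2 * \<delta>) ^ j) \<le> norm (?F 0)" for k
    proof -
      have "(\<Sum>j\<in>{1..k}. norm (?F j) * (2 * \<delta>) ^ j) \<le> (ln d * (2 + ln d)) * (2 * \<delta>) + 2 * real (3 * d) * (2 * \<delta>) ^ 2"
        using \<delta> d bd oscillating_lcoeff_0_1[OF osc \<delta>(1) d, of 1]
        by (intro sum_power_tail_le) (auto simp: add_nonneg_nonneg)
      thus ?thesis using small l by simp
    qed
    show "real (k + 1) * norm (?F (k + 1)) * (2 * \<delta>) ^ k \<le> 3 * d" for k
    proof -
      have "(real (k + 1) * (2 * \<delta>) ^ k) * norm (?F (k + 1)) \<le> 1 * real (3 * d)"
        using \<delta> by (intro mult_mono Suc_times_power_le_1 bd) auto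
      thus ?thesis by (simp add: mult_ac)
    qed
  qed (use \<delta> l in auto)
  also have "\<dots> \<le> 2 * real (3 * d) / l" using l by (intro divide_left_mono mult_pos_pos) auto
  finally show ?thesis by simp
qed

text \<open>\<open>\<kappa>\<close> is the density of the integers prime to \<open>d\<close>, hence
  the residue at the pole. Splitting the principal character into its mean \<open>\<kappa>\<close>
  and an oscillating rest separates the pole from a part that is bounded as in the nonprincipal
  case; the constant term of \<open>P\<close> is then close to \<open>\<kappa>\<close>.\<close>

lemma principal_log_derivative_bound:
  fixes d :: nat and \<delta> :: real
  defines "\<kappa> \<equiv> totient d / d"
  assumes d: "d \<ge> 3" and \<delta>: "\<delta> > 0" "\<delta> \<le> 1 / 4"
    and small: "\<delta> * (4 + ln d) \<le> \<kappa> / 2"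
      "2 * ((5 * d * \<delta> + 4 + ln d) * (2 * \<delta>) + 20 * d * (2 * \<delta>) ^ 2) \<le> \<kappa> / 2"
  shows "norm (lcoeff \<delta> (\<lambda>n. principal_dchar d n * mangoldt n) k - of_real ((1 / \<delta>) ^ (k + 1))) * (2 * \<delta>) ^ k
           \<le> 40 * d / \<kappa>"
proof -
  define g where "g = (\<lambda>n. principal_dchar d n - of_real \<kappa>)"
  have \<kappa>: "0 < \<kappa>" "\<kappa> \<le> 1" using d totient_le[of d] by (auto simp: \<kappa>_def)
  have osc: "oscillating d g"
    unfolding oscillating_def
  proof (intro conjI allI)
    fix n show "norm (g n) \<le> 1"
    proof (cases "coprime n d")
      case True
      hence "g n = of_real (1 - \<kappa>)" by (simp add: g_def principal_dchar_def)
      thus ?thesis using \<kappa> by (simp only: norm_of_real)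
    next
      case False
      hence "g n = of_real (- \<kappa>)" by (simp add: g_def principal_dchar_def)
      thus ?thesis using \<kappa> by (simp only: norm_of_real)
    qed
    show "g (n + d) = g n"
      using dchar_cong[OF principal_in_dchars, of "n + d" n d] by (simp add: g_def cong_def)
    have "(\<Sum>n<d. principal_dchar d n) = of_nat (totient d)"
      using d by (intro sum_principal_dchar) auto
    thus "(\<Sum>n<d. g n) = 0" using d by (simp add: g_def sum_subtractf \<kappa>_def)
  qed (use d in auto)
  let ?F = "lcoeff \<delta> (principal_dchar d)" and ?D = "lcoeff \<delta> (\<lambda>n. principal_dchar d n * mangoldt n)"
  define P where "P = (\<lambda>k. of_real \<delta> * ?F k - (if k = 0 then 0 else ?F (k - 1)))"
  define e where "e = (\<lambda>k. ?F k - of_real (\<kappa> * (1 / \<delta>) ^ (k + 1)))"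
  have F: "?F k = lcoeff \<delta> g k + of_real \<kappa> * lcoeff \<delta> (\<lambda>_. 1) k" for k
  proof -
    have 1: "norm (g n) \<le> 1 + ln (real n)" for n
      using osc by (intro norm_le_oneplus_ln) (auto simp: oscillating_def)
    have 2: "norm (1 :: complex) \<le> 1 + ln (real n)" for n by (rule norm_le_oneplus_ln) auto
    have "(\<lambda>n. g n * of_real (lweight \<delta> k n) + of_real \<kappa> * (1 * of_real (lweight \<delta> k n))) sums
        (lcoeff \<delta> g k + of_real \<kappa> * lcoeff \<delta> (\<lambda>_. 1) k)"
      by (intro sums_add sums_mult lcoeff_sums \<delta> 1 2)
    moreover have "(\<lambda>n. principal_dchar d n * of_real (lweight \<delta> k n)) sums ?F k"
      using norm_dchar_le[OF principal_in_dchars, of d] d by (intro lcoeff_sums \<delta> norm_le_oneplus_ln) auto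
    moreover have "g n * of_real (lweight \<delta> k n) + of_real \<kappa> * (1 * of_real (lweight \<delta> k n))
       = principal_dchar d n * of_real (lweight \<delta> k n)" for n
      by (simp add: g_def algebra_simps)
    ultimately show ?thesis by (simp add: sums_unique2)
  qed
  have e: "norm (e k) \<le> norm (lcoeff \<delta> g k) + 2" for k
  proof -
    have "e k = lcoeff \<delta> g k + of_real \<kappa> * (lcoeff \<delta> (\<lambda>_. 1) k - of_real ((1 / \<delta>) ^ (k + 1)))"
      by (simp add: e_def F algebra_simps)
    also have "norm \<dots> \<le> norm (lcoeff \<delta> g k) + 1 * 2"
      using \<kappa> lcoeff_one[OF \<delta>(1), of k]
      by (intro order.trans[OF norm_triangle_ineq] add_mono order.refl, unfold norm_mult, intro mult_mono) auto
    finally show ?thesis by simp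
  qed
  have ed: "norm (e k) \<le> 5 * d" for k
    using e[of k] oscillating_lcoeff_bound[OF osc \<delta>(1), of k] d by simp
  have e0: "norm (e 0) \<le> 4 + ln d"
    using e[of 0] oscillating_lcoeff_0_1[OF osc \<delta>(1) d, of 0] by simp
  have P0: "P 0 = of_real \<kappa> + of_real \<delta> * e 0"
    using \<delta> by (simp add: P_def e_def field_simps)
  \<comment> \<open>The polar terms cancel, since \<open>\<delta> * (1 / \<delta>) ^ (k + 2) = (1 /
    \<delta>) ^ (k + 1)\<close>.\<close>
  have PS: "P (Suc k) = of_real \<delta> * e (Suc k) - e k" for k
    using \<delta> by (simp add: P_def e_def field_simps)
  have "\<delta> * norm (e 0) \<le> \<delta> * (4 + ln d)" using \<delta> by (intro mult_left_mono e0) auto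
  also note small(1)
  finally have "norm (of_real \<delta> * e 0) \<le> \<kappa> / 2"
    using \<delta> by (simp add: norm_mult)
  hence nP0: "norm (P 0) \<ge> \<kappa> / 2"
    using norm_diff_ineq[of "of_real \<kappa>" "of_real \<delta> * e 0"] \<kappa> unfolding P0 by (simp del: of_real_mult)
  have nP: "norm (P (Suc k)) \<le> 10 * d" for k
  proof -
    have "norm (P (Suc k)) \<le> 1 * real (5 * d) + real (5 * d)" unfolding PS
      using \<delta> by (intro order.trans[OF norm_triangle_ineq4] add_mono ed, unfold norm_mult, intro mult_mono ed) auto
    thus ?thesis by simp
  qed
  have nP1: "norm (P 1) \<le> 5 * d * \<delta> + 4 + ln d"
  proof -
    have "norm (P (Suc 0)) \<le> \<delta> * real (5 * d) + (4 + ln d)" unfolding PS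
      using \<delta> by (intro order.trans[OF norm_triangle_ineq4] add_mono e0, unfold norm_mult, intro mult_mono ed) auto
    thus ?thesis by (simp add: mult_ac)
  qed
  have "norm (?D k - (1 / of_real \<delta>) ^ (k + 1)) * (2 * \<delta>) ^ k \<le> 2 * real (10 * d) / norm (P 0)"
  proof (rule log_derivative_coeff_bound)
    show "of_nat (k + 1) * P (k + 1) = (\<Sum>i\<le>k. (?D i - (1 / of_real \<delta>) ^ (i + 1)) * P (k - i))" for k
      unfolding P_def
      by (rule shifted_log_derivative_recurrence, rule lcoeff_log_derivative[OF principal_in_dchars _ \<delta>(1)])
        (use d \<delta> in auto)
    show "2 * (\<Sum>j\<in>{1..k}. norm (P j) * (2 * \<delta>) ^ j) \<le> norm (P 0)" for k
    proof -
      have "norm (P j) \<le> 10 * d" if "j \<ge> 2" for j using nP[of "j - 1"] that by simp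
      hence "(\<Sum>j\<in>{1..k}. norm (P j) * (2 * \<delta>) ^ j) \<le> (5 * d * \<delta> + 4 + ln d) * (2 * \<delta>) + 2 * real (10 * d) * (2 * \<delta>) ^ 2"
        using \<delta> d nP1 by (intro sum_power_tail_le) (auto simp: add_nonneg_nonneg)
      thus ?thesis using small(2) nP0 by simp
    qed
    show "real (k + 1) * norm (P (k + 1)) * (2 * \<delta>) ^ k \<le> 10 * d" for k
    proof -
      have "(real (k + 1) * (2 * \<delta>) ^ k) * norm (P (k + 1)) \<le> 1 * real (10 * d)"
        using \<delta> nP[of k] by (intro mult_mono Suc_times_power_le_1) auto
      thus ?thesis by (simp add: mult_ac)
    qed
  qed (use \<delta> nP0 \<kappa> in auto)
  also have "\<dots> \<le> 2 * real (10 * d) / (\<kappa> / 2)" using nP0 \<kappa> by (intro divide_left_mono mult_pos_pos) auto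
  finally show ?thesis by simp
qed

section \<open>Characters whose square is not principal\<close>

text \<open>A sieve: \<open>S N\<close> consists of the positive integers without prime factors
  below \<open>N\<close>. For prime \<open>N\<close> the factor \<open>1 - f N\<close> removes from
  it the multiples of \<open>N\<close>, which are the image of \<open>S N\<close> under
  multiplication by \<open>N\<close>.\<close>

lemma euler_product_step:
  fixes f :: "nat \<Rightarrow> complex"
  assumes f1: "f 1 = 1" and mult: "\<And>m n. f (m * n) = f m * f n"
    and summ: "(\<lambda>n. norm (f n)) summable_on {0<..}"
  defines "S \<equiv> (\<lambda>N. {n. n > 0 \<and> (\<forall>p. prime p \<and> p < N \<longrightarrow> \<not> p dvd n)})"
  shows "infsum f {0<..} * (\<Prod>p | prime p \<and> p < N. 1 - f p) = infsum f (S N)"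
proof (induction N)
  case 0
  thus ?case by (simp add: S_def greaterThan_def)
next
  case (Suc N)
  show ?case
  proof (cases "prime N")
    case False
    hence *: "prime p \<and> p < Suc N \<longleftrightarrow> prime p \<and> p < N" for p using less_Suc_eq by auto
    show ?thesis using Suc unfolding S_def * .
  next
    case True
    have N: "N > 0" using True prime_gt_0_nat by auto
    have sS: "f summable_on A" if "A \<subseteq> {0<..}" for A
      by (rule abs_summable_summable, rule summable_on_subset_banach[OF summ that])
    have "{p. prime p \<and> p < Suc N} = insert N {p. prime p \<and> p < N}" using True by (auto simp: less_Suc_eq)
    hence eq: "(\<Prod>p | prime p \<and> p < Suc N. 1 - f p) = (1 - f N) * (\<Prod>p | prime p \<and> p < N. 1 - f p)" by simp
    have "infsum f {0<..} * (\<Prod>p | prime p \<and> p < Suc N. 1 - f p) = infsum f (S N) - f N * infsum f (S N)"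
      unfolding Suc [symmetric] eq by (simp only: algebra_simps mult_1 mult_1_right)
    also have "f N * infsum f (S N) = (\<Sum>\<^sub>\<infinity>n\<in>S N. f (N * n))"
      by (simp add: mult infsum_cmult_right')
    also have "\<dots> = infsum f ((\<lambda>n. N * n) ` S N)"
      using N by (subst infsum_reindex) (auto simp: inj_on_def o_def)
    also have "infsum f (S N) - infsum f ((\<lambda>n. N * n) ` S N) = infsum f (S N - (\<lambda>n. N * n) ` S N)"
    proof (rule infsum_Diff [symmetric])
      show "(\<lambda>n. N * n) ` S N \<subseteq> S N"
      proof safe
        fix n assume n: "n \<in> S N"
        have "\<not> p dvd N * n" if "prime p" "p < N" for p
          using n that True primes_dvd_imp_eq[OF that(1) True] by (auto simp: S_def prime_dvd_mult_iff)
        thus "N * n \<in> S N" using n N by (auto simp: S_def)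
      qed
    qed (rule sS, use N in \<open>auto simp: S_def\<close>)+
    also have "S N - (\<lambda>n. N * n) ` S N = S (Suc N)"
    proof (intro equalityI subsetI)
      fix n assume n: "n \<in> S N - (\<lambda>n. N * n) ` S N"
      have "\<not> N dvd n"
      proof
        assume "N dvd n"
        then obtain k where k: "n = N * k" by auto
        hence "k \<in> S N" using n by (auto simp: S_def)
        thus False using n k by auto
      qed
      thus "n \<in> S (Suc N)" using n by (auto simp: S_def less_Suc_eq)
    next
      fix n assume "n \<in> S (Suc N)"
      thus "n \<in> S N - (\<lambda>n. N * n) ` S N" using True by (auto simp: S_def)
    qed
    finally show ?thesis .
  qed
qed

text \<open>Every element of the sieved set other than 1 has a prime factor that is at least
  \<open>N\<close>, so all but the term at 1 is bounded by a tail of a convergent series. The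
  product with limit 1 serves later as it stands; no infinite product has to be formed.\<close>

lemma euler_product_limit:
  fixes f :: "nat \<Rightarrow> complex"
  assumes f1: "f 1 = 1" and mult: "\<And>m n. f (m * n) = f m * f n"
    and summ: "(\<lambda>n. norm (f n)) summable_on UNIV"
  shows "(\<lambda>N. infsum f {0<..} * (\<Prod>p | prime p \<and> p < N. 1 - f p)) \<longlonglongrightarrow> 1"
proof -
  have summ': "(\<lambda>n. norm (f n)) summable_on {0<..}" by (rule summable_on_subset_banach[OF summ]) auto
  define S where "S = (\<lambda>N. {n :: nat. n > 0 \<and> (\<forall>p. prime p \<and> p < N \<longrightarrow> \<not> p dvd n)})"
  have s: "summable (\<lambda>n. norm (f n))" using summ by (rule summable_on_imp_summable)
  have bound: "norm (infsum f {0<..} * (\<Prod>p | prime p \<and> p < N. 1 - f p) - 1) \<le> (\<Sum>n. norm (f (n + N)))"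
    if N: "N \<ge> 2" for N
  proof -
    have eq: "infsum f {0<..} * (\<Prod>p | prime p \<and> p < N. 1 - f p) = infsum f (S N)"
      unfolding S_def by (rule euler_product_step[OF f1 mult summ'])
    have sA: "f summable_on A" for A
      by (rule abs_summable_summable, rule summable_on_subset_banach[OF summ]) auto
    have snA: "(\<lambda>n. norm (f n)) summable_on A" for A
      by (rule summable_on_subset_banach[OF summ]) auto
    have "1 \<in> S N" using N by (auto simp: S_def)
    hence "infsum f (S N) = infsum f (S N - {1}) + f 1"
      using infsum_Diff[of f "S N" "{1}"] sA by simp
    hence "norm (infsum f (S N) - 1) = norm (infsum f (S N - {1}))" using f1 by simp
    also have "\<dots> \<le> (\<Sum>\<^sub>\<infinity>n\<in>S N - {1}. norm (f n))" by (intro norm_infsum_bound snA)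
    also have "\<dots> \<le> (\<Sum>\<^sub>\<infinity>n\<in>{N..}. norm (f n))"
    proof (intro infsum_mono_neutral snA)
      fix n assume n: "n \<in> (S N - {1}) - {N..}"
      hence "n \<noteq> 1" "n > 0" "n < N" by (auto simp: S_def)
      then obtain p where "prime p" "p dvd n" using prime_factor_nat by blast
      moreover hence "p < N" using \<open>n < N\<close> \<open>n > 0\<close> dvd_imp_le[of p n] by auto
      ultimately show "norm (f n) \<le> 0" using n by (auto simp: S_def)
    qed auto
    also have "\<dots> = (\<Sum>\<^sub>\<infinity>n. norm (f (n + N)))"
    proof -
      have "(\<lambda>n. n + N) ` UNIV = {N..}"
        by (auto simp: image_iff) (metis le_add_diff_inverse2)
      thus ?thesis using infsum_reindex[of "\<lambda>n. n + N" UNIV "\<lambda>n. norm (f n)"] by (simp add: o_def)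
    qed
    also have "\<dots> = (\<Sum>n. norm (f (n + N)))"
    proof -
      have "(\<lambda>n. norm (f (n + N))) summable_on UNIV"
        by (subst summable_on_UNIV_nonneg_real_iff) (use summable_ignore_initial_segment[OF s] in auto)
      thus ?thesis by (metis has_sum_imp_sums has_sum_infsum sums_unique)
    qed
    finally show ?thesis using eq by simp
  qed
  have "(\<lambda>N. \<Sum>n. norm (f (n + N))) \<longlonglongrightarrow> 0" by (rule suminf_exist_split2[OF s])
  hence "(\<lambda>N. infsum f {0<..} * (\<Prod>p | prime p \<and> p < N. 1 - f p) - 1) \<longlonglongrightarrow> 0"
    by (rule Lim_null_comparison[rotated]) (use bound in \<open>auto intro: eventually_sequentiallyI[of 2]\<close>)
  thus ?thesis by (simp add: LIM_zero_iff)
qed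

text \<open>Real part of the Mercator series. The summand \<open>k = 0\<close> is a division by
  zero, that is, 0.\<close>

lemma ln_norm_one_minus_sums:
  assumes "norm w < 1"
  shows "(\<lambda>k. Re (w ^ k) / k) sums - ln (norm (1 - w))"
proof -
  have "(\<lambda>n. (-1) ^ Suc n / of_nat n * (- w) ^ n) sums Ln (1 + - w)"
    using assms by (intro Ln_series) auto
  hence "(\<lambda>n. Re ((-1) ^ Suc n / of_nat n * (- w) ^ n)) sums Re (Ln (1 + - w))" by (rule sums_Re)
  hence S: "(\<lambda>n. - Re ((-1) ^ Suc n / of_nat n * (- w) ^ n)) sums - Re (Ln (1 + - w))" by (rule sums_minus)
  have eq: "- Re ((-1) ^ Suc n / of_nat n * (- w) ^ n) = Re (w ^ n) / n" for n
  proof -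
    have "(-1) ^ n * (- w) ^ n = ((-1) * (- w)) ^ n" by (rule power_mult_distrib [symmetric])
    hence "(-1) ^ n * (- w) ^ n = w ^ n" by (simp only: mult_minus_left mult_1 minus_minus)
    hence "(-1) ^ Suc n / of_nat n * (- w) ^ n = - (w ^ n / of_nat n)"
      by (simp only: power_Suc mult_minus_left mult_1 minus_divide_left [symmetric] times_divide_eq_left)
    thus ?thesis by (metis Re_divide_of_nat minus_minus uminus_complex.sel(1))
  qed
  have "1 - w \<noteq> 0" using assms by auto
  hence "Re (Ln (1 + - w)) = ln (norm (1 - w))" by simp
  with S show ?thesis unfolding eq by simp
qed

text \<open>The classical 3 + 4 cos t + cos 2t = 2 (1 + cos t)^2, applied to each term of the
  logarithmic series with cos t = \<open>Re (z ^ k)\<close>.\<close>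

lemma three_four_one:
  fixes x :: real and z :: complex
  assumes x: "0 \<le> x" "x < 1" and z: "norm z = 1"
  shows "norm (1 - complex_of_real x) ^ 3 * norm (1 - of_real x * z) ^ 4 * norm (1 - of_real x * z ^ 2) \<le> 1"
proof -
  let ?a = "complex_of_real x" and ?b = "complex_of_real x * z" and ?c = "complex_of_real x * z ^ 2"
  have n: "norm ?a < 1" "norm ?b < 1" "norm ?c < 1" using x z by (auto simp: norm_mult norm_power)
  hence pos: "norm (1 - ?a) > 0" "norm (1 - ?b) > 0" "norm (1 - ?c) > 0" by auto
  have "(\<lambda>k. 3 * (Re (?a ^ k) / k) + 4 * (Re (?b ^ k) / k) + Re (?c ^ k) / k) sums
      (3 * - ln (norm (1 - ?a)) + 4 * - ln (norm (1 - ?b)) + - ln (norm (1 - ?c)))"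
    by (intro sums_add sums_mult ln_norm_one_minus_sums n)
  moreover have "3 * (Re (?a ^ k) / k) + 4 * (Re (?b ^ k) / k) + Re (?c ^ k) / k \<ge> 0" for k
  proof -
    define u where "u = z ^ k"
    have u: "norm u = 1" using z by (simp add: u_def norm_power)
    have "(z ^ 2) ^ k = u ^ 2" by (simp add: u_def mult.commute flip: power_mult)
    hence 1: "Re (?a ^ k) = x ^ k" "Re (?b ^ k) = x ^ k * Re u" "Re (?c ^ k) = x ^ k * Re (u ^ 2)"
      by (simp_all add: u_def power_mult_distrib flip: of_real_power)
    have "Re (u ^ 2) = 2 * Re u ^ 2 - 1"
      using u by (simp add: Re_power2 cmod_def algebra_simps)
    hence "3 + 4 * Re u + Re (u ^ 2) = 2 * (1 + Re u) ^ 2" by (simp add: power2_eq_square algebra_simps)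
    hence "0 \<le> x ^ k / k * (3 + 4 * Re u + Re (u ^ 2))" using x by simp
    thus ?thesis unfolding 1 by (simp add: algebra_simps add_divide_distrib)
  qed
  ultimately have "0 \<le> 3 * - ln (norm (1 - ?a)) + 4 * - ln (norm (1 - ?b)) + - ln (norm (1 - ?c))"
    by (metis (no_types, lifting) sums_le sums_zero)
  hence "ln (norm (1 - ?a) ^ 3 * norm (1 - ?b) ^ 4 * norm (1 - ?c)) \<le> 0"
    using pos by (simp add: ln_mult ln_realpow)
  thus ?thesis using pos by (simp add: ln_le_zero_iff)
qed

lemma sum_lweight_0_le:
  assumes \<delta>: "\<delta> > 0"
  shows "(\<Sum>n<N. lweight \<delta> 0 n) \<le> 1 / \<delta> + 2"
proof -
  have "(\<lambda>n. 1 * of_real (lweight \<delta> 0 n)) sums lcoeff \<delta> (\<lambda>_. 1) 0"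
    by (intro lcoeff_sums \<delta> norm_le_oneplus_ln) auto
  hence s: "lweight \<delta> 0 sums Re (lcoeff \<delta> (\<lambda>_. 1) 0)" using sums_Re by fastforce
  have "(\<Sum>n<N. lweight \<delta> 0 n) \<le> Re (lcoeff \<delta> (\<lambda>_. 1) 0)"
    using s sum_le_suminf[of "lweight \<delta> 0" "{..<N}"] by (auto simp: sums_iff lweight_nonneg)
  also have "\<dots> \<le> 1 / \<delta> + 2"
    using complex_Re_le_cmod[of "lcoeff \<delta> (\<lambda>_. 1) 0 - of_real ((1 / \<delta>) ^ (0 + 1))"] lcoeff_one[OF \<delta>, of 0] by simp
  finally show ?thesis .
qed

text \<open>Multiplying \<open>three_four_one\<close> over the primes shows that the cube of the
  principal L-value, the fourth power of that of \<open>\<psi>\<close> and the L-value of the square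
  have a product of norm at least 1. The square being nonprincipal, its value is at most
  \<open>2 + ln d\<close>; the pole accounts for \<open>(1 / \<delta> + 2) ^ 3\<close>.\<close>

lemma complex_dchar_lower_bound:
  assumes \<psi>: "\<psi> \<in> dchars d" "(\<lambda>n. \<psi> n ^ 2) \<noteq> principal_dchar d" and d: "d \<ge> 3" and \<delta>: "\<delta> > 0"
  shows "norm (lcoeff \<delta> \<psi> 0) ^ 4 \<ge> 1 / ((1 / \<delta> + 2) ^ 3 * (2 + ln d))"
proof -
  have d0: "d > 0" "d > 1" using d by auto
  define \<xi> where "\<xi> = (\<lambda>n. \<psi> n * \<psi> n)"
  have \<xi>: "\<xi> \<in> dchars d" unfolding \<xi>_def by (intro mult_in_dchars \<psi>)
  have \<xi>': "\<xi> \<noteq> principal_dchar d" using \<psi>(2) by (simp add: \<xi>_def power2_eq_square)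
  let ?L = "\<lambda>\<psi>. lcoeff \<delta> \<psi> 0"
  define E :: "(nat \<Rightarrow> complex) \<Rightarrow> nat \<Rightarrow> complex" where "E = (\<lambda>\<psi> N. \<Prod>p | prime p \<and> p < N. 1 - \<psi> p * of_real (lweight \<delta> 0 p))"
  have lim: "(\<lambda>N. ?L \<psi> * E \<psi> N) \<longlonglongrightarrow> 1" if \<psi>: "\<psi> \<in> dchars d" for \<psi>
  proof -
    let ?f = "\<lambda>n. \<psi> n * of_real (lweight \<delta> 0 n)"
    have "infsum ?f {0<..} = ?L \<psi>" unfolding lcoeff_def by (intro infsum_cong_neutral) auto
    moreover have "(\<lambda>N. infsum ?f {0<..} * (\<Prod>p | prime p \<and> p < N. 1 - ?f p)) \<longlonglongrightarrow> 1"
    proof (rule euler_product_limit)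
      show "?f 1 = 1" using dchar_1[OF \<psi>] by (simp add: lweight_def)
      show "?f (m * n) = ?f m * ?f n" for m n
        by (simp add: lweight_def dchar_mult[OF \<psi>] powr_mult)
      show "(\<lambda>n. norm (?f n)) summable_on UNIV"
        using norm_dchar_le[OF \<psi> d0(1)] by (intro lcoeff_abs_summable \<delta> norm_le_oneplus_ln)
    qed
    ultimately show ?thesis by (simp add: E_def)
  qed
  let ?\<pi> = "principal_dchar d"
  have E: "norm (E ?\<pi> N) ^ 3 * norm (E \<psi> N) ^ 4 * norm (E \<xi> N) \<le> 1" for N
  proof -
    have "norm (E ?\<pi> N) ^ 3 * norm (E \<psi> N) ^ 4 * norm (E \<xi> N) =
       (\<Prod>p | prime p \<and> p < N. norm (1 - ?\<pi> p * of_real (lweight \<delta> 0 p)) ^ 3 *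
          norm (1 - \<psi> p * of_real (lweight \<delta> 0 p)) ^ 4 * norm (1 - \<xi> p * of_real (lweight \<delta> 0 p)))"
      unfolding E_def by (simp add: prod_norm [symmetric] prod_power_distrib prod.distrib)
    also have "\<dots> \<le> 1"
    proof (intro prod_le_1 conjI)
      fix p assume "p \<in> {p. prime p \<and> p < N}"
      hence p: "p > 1" using prime_gt_1_nat by auto
      show "norm (1 - ?\<pi> p * of_real (lweight \<delta> 0 p)) ^ 3 *
          norm (1 - \<psi> p * of_real (lweight \<delta> 0 p)) ^ 4 * norm (1 - \<xi> p * of_real (lweight \<delta> 0 p)) \<le> 1"
      proof (cases "coprime p d")
        case True
        have "lweight \<delta> 0 p < 1" using p \<delta> by (auto simp: lweight_def powr_less_one)
        from three_four_one[OF lweight_nonneg this norm_dchar[OF \<psi>(1) True d0(1)]] True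
        show ?thesis by (simp add: principal_dchar_def \<xi>_def power2_eq_square mult_ac)
      next
        case False
        thus ?thesis using dchar_eq_0_iff[OF \<psi>(1), of p] by (simp add: principal_dchar_def \<xi>_def)
      qed
    qed auto
    finally show ?thesis .
  qed
  have "(\<lambda>N. norm (?L ?\<pi> * E ?\<pi> N) ^ 3 * norm (?L \<psi> * E \<psi> N) ^ 4 * norm (?L \<xi> * E \<xi> N)) \<longlonglongrightarrow>
      norm (1::complex) ^ 3 * norm (1::complex) ^ 4 * norm (1::complex)"
    by (intro tendsto_mult tendsto_power tendsto_norm lim principal_in_dchars \<psi> \<xi>)
  hence limit: "(\<lambda>N. norm (?L ?\<pi> * E ?\<pi> N) ^ 3 * norm (?L \<psi> * E \<psi> N) ^ 4 * norm (?L \<xi> * E \<xi> N)) \<longlonglongrightarrow> 1"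
    by simp
  \<comment> \<open>Each \<open>?L\<close> times its \<open>E\<close> tends to 1, while the
    \<open>E\<close> part of the product is at most 1; so the \<open>?L\<close> part is at least
    1.\<close>
  have "norm (?L ?\<pi> * E ?\<pi> N) ^ 3 * norm (?L \<psi> * E \<psi> N) ^ 4 * norm (?L \<xi> * E \<xi> N)
      \<le> norm (?L ?\<pi>) ^ 3 * norm (?L \<psi>) ^ 4 * norm (?L \<xi>)" for N
  proof -
    have "norm (?L ?\<pi> * E ?\<pi> N) ^ 3 * norm (?L \<psi> * E \<psi> N) ^ 4 * norm (?L \<xi> * E \<xi> N) =
       (norm (?L ?\<pi>) ^ 3 * norm (?L \<psi>) ^ 4 * norm (?L \<xi>)) * (norm (E ?\<pi> N) ^ 3 * norm (E \<psi> N) ^ 4 * norm (E \<xi> N))"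
      by (simp add: norm_mult power_mult_distrib mult_ac)
    also have "\<dots> \<le> (norm (?L ?\<pi>) ^ 3 * norm (?L \<psi>) ^ 4 * norm (?L \<xi>)) * 1"
      by (intro mult_left_mono E) auto
    finally show ?thesis by simp
  qed
  hence "1 \<le> norm (?L ?\<pi>) ^ 3 * norm (?L \<psi>) ^ 4 * norm (?L \<xi>)"
    by (intro tendsto_upperbound[OF limit]) auto
  also have "\<dots> \<le> (1 / \<delta> + 2) ^ 3 * norm (?L \<psi>) ^ 4 * (2 + ln d)"
  proof (intro mult_mono power_mono)
    show "norm (?L \<xi>) \<le> 2 + ln d"
      using oscillating_lcoeff_0_1[OF oscillating_dchar[OF \<xi> \<xi>' d0(1)] \<delta> d, of 0] by simp
    show "norm (?L ?\<pi>) \<le> 1 / \<delta> + 2"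
    proof (rule norm_lcoeff_le[OF \<delta>])
      show "norm (?\<pi> n) \<le> 1 + ln (real n)" for n by (intro norm_le_oneplus_ln norm_dchar_le[OF principal_in_dchars d0(1)])
      fix N
      have "norm (\<Sum>n<N. ?\<pi> n * of_real (lweight \<delta> 0 n)) \<le> (\<Sum>n<N. lweight \<delta> 0 n)"
        by (intro sum_norm_le) (auto simp: principal_dchar_def lweight_nonneg)
      also have "\<dots> \<le> 1 / \<delta> + 2" by (rule sum_lweight_0_le[OF \<delta>])
      finally show "norm (\<Sum>n<N. ?\<pi> n * of_real (lweight \<delta> 0 n)) \<le> 1 / \<delta> + 2" .
    qed
  qed (use \<delta> in auto)
  finally have "1 \<le> (1 / \<delta> + 2) ^ 3 * norm (?L \<psi>) ^ 4 * (2 + ln d)" .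
  moreover have "(1 / \<delta> + 2) ^ 3 * (2 + ln d) > 0"
    using \<delta> d by (intro mult_pos_pos zero_less_power add_pos_nonneg) auto
  ultimately show ?thesis by (subst pos_divide_le_eq) (simp_all add: mult_ac)
qed

section \<open>Real characters\<close>

lemma prime_power_factorE:
  fixes n :: nat
  assumes "n > 1"
  obtains p k m where "prime p" "n = p ^ k * m" "\<not> p dvd m" "0 < m" "m < n"
proof -
  obtain p where p: "prime p" "p dvd n" using assms prime_factor_nat[of n] by auto
  have "n \<noteq> 0" "\<not> is_unit p" using p assms not_prime_unit by auto
  from multiplicity_decompose'[OF this] obtain m where m: "n = p ^ multiplicity p n * m" "\<not> p dvd m"
    by blast
  have "multiplicity p n > 0" using p assms by (simp add: prime_multiplicity_gt_zero_iff)
  hence "p ^ 1 \<le> p ^ multiplicity p n"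
    using p by (intro power_increasing) (auto simp: Suc_le_eq prime_gt_0_nat)
  hence "p ^ multiplicity p n > 1" using prime_gt_1_nat[OF p(1)] by simp
  moreover have m0: "m > 0" using m assms by (metis gr0I mult_0_right not_less_zero)
  ultimately have "m < n" using m(1) by (metis mult.commute mult.right_neutral nat_mult_less_cancel1)
  thus ?thesis using that p(1) m m0 by blast
qed

text \<open>In \<open>z = exp (- v)\<close> this is a power series, differentiable term by term; the
  chain rule supplies the sign and the factor \<open>exp (- v)\<close> that restores the exponent
  lowered by \<open>diffs\<close>.\<close>

lemma exp_series_derivative:
  fixes c :: "nat \<Rightarrow> real"
  assumes s: "\<And>v. v > 0 \<Longrightarrow> summable (\<lambda>n. c n * exp (- real n * v))" and v: "v > 0"
  shows "((\<lambda>v. \<Sum>n. c n * exp (- real n * v)) has_real_derivative - (\<Sum>n. c n * real n * exp (- real n * v))) (at v)"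
proof -
  have e: "exp (- real n * v) = exp (- v) ^ n" for n v by (simp add: exp_of_nat_mult [symmetric])
  have K: "summable (\<lambda>n. c n * exp (- (v / 2)) ^ n)" using s[of "v / 2"] v unfolding e by simp
  from K have D: "DERIV (\<lambda>x. \<Sum>n. c n * x ^ n) (exp (- v)) :> (\<Sum>n. diffs c n * exp (- v) ^ n)"
    by (rule termdiffs_strong) (use v in auto)
  have deriv: "((\<lambda>v. \<Sum>n. c n * exp (- v) ^ n) has_real_derivative (\<Sum>n. diffs c n * exp (- v) ^ n) * (- exp (- v))) (at v)"
    by (rule DERIV_chain2[where f = "\<lambda>x. \<Sum>n. c n * x ^ n" and g = "\<lambda>v. exp (- v)", OF D]) (auto intro!: derivative_eq_intros)
  have sd: "summable (\<lambda>n. diffs c n * exp (- v) ^ n)"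
  proof (rule termdiff_converges[where K = "exp (- (v / 2))"])
    fix x :: real assume "norm x < exp (- (v / 2))"
    thus "summable (\<lambda>n. c n * x ^ n)" using powser_inside[OF K] by simp
  qed (use v in auto)
  have "(\<Sum>n. diffs c n * exp (- v) ^ n) * exp (- v) = (\<Sum>n. c n * real n * exp (- v) ^ n)"
  proof -
    have "(\<lambda>n. diffs c n * exp (- v) ^ n * exp (- v)) sums ((\<Sum>n. diffs c n * exp (- v) ^ n) * exp (- v))"
      using sd by (intro sums_mult2 summable_sums)
    hence "(\<lambda>n. c (Suc n) * real (Suc n) * exp (- v) ^ Suc n) sums ((\<Sum>n. diffs c n * exp (- v) ^ n) * exp (- v))"
      by (simp add: diffs_def mult_ac del: of_nat_Suc)
    hence "(\<lambda>n. c n * real n * exp (- v) ^ n) sums ((\<Sum>n. diffs c n * exp (- v) ^ n) * exp (- v))"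
      by (subst (asm) sums_Suc_iff) simp
    thus ?thesis by (simp add: sums_iff)
  qed
  with deriv show ?thesis unfolding e by simp
qed

lemma summable_power_exp:
  assumes v: "v > 0"
  shows "summable (\<lambda>n. real n ^ k * exp (- real n * v))"
proof (rule summable_comparison_test)
  have "summable (\<lambda>n. exp (- (v / 2)) ^ n)" using v by (intro summable_geometric) auto
  thus "summable (\<lambda>n. fact k * (1 / (v / 2)) ^ k * exp (- (v / 2)) ^ n)" by (rule summable_mult)
  have "real n ^ k * exp (- real n * v) \<le> fact k * (1 / (v / 2)) ^ k * exp (- (v / 2)) ^ n" for n
    using log_kernel_le_exp[of "real n" "v / 2" v k] v
    by (simp add: log_kernel_def field_simps exp_of_nat_mult [symmetric])
  thus "\<exists>N. \<forall>n\<ge>N. norm (real n ^ k * exp (- real n * v)) \<le> fact k * (1 / (v / 2)) ^ k * exp (- (v / 2)) ^ n"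
    by simp
qed

locale real_dchar =
  fixes d :: nat and \<eta> :: "nat \<Rightarrow> real"
  assumes d3: "d \<ge> 3"
    and dchar: "(\<lambda>n. complex_of_real (\<eta> n)) \<in> dchars d"
    and nonprincipal: "(\<lambda>n. complex_of_real (\<eta> n)) \<noteq> principal_dchar d"
    and eta_values: "\<eta> n \<in> {-1, 0, 1}"
begin

lemma osc: "oscillating d (\<lambda>n. complex_of_real (\<eta> n))"
  using d3 by (intro oscillating_dchar dchar nonprincipal) auto

lemma mult: "\<eta> (m * n) = \<eta> m * \<eta> n"
  using dchar_mult[OF dchar, of m n] by (simp flip: of_real_mult)

lemma eta_1 [simp]: "\<eta> (Suc 0) = 1"
  using dchar_1[OF dchar] by simp

lemma eta_0 [simp]: "\<eta> 0 = 0"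
  using dchar_eq_0_iff[OF dchar, of 0] d3 by simp

lemma eta_power: "\<eta> (m ^ k) = \<eta> m ^ k"
  by (induction k) (auto simp: mult)

lemma abs_eta_le: "\<bar>\<eta> n\<bar> \<le> 1"
  using eta_values[of n] by auto

text \<open>The Dirichlet coefficients of \<zeta>(s) L(s, \<eta>). At \<open>n = 0\<close> the index
  set is infinite and the value is 0.\<close>

definition conv_one :: "nat \<Rightarrow> real" where
  "conv_one n = (\<Sum>a | a dvd n. \<eta> a)"

text \<open>These sums are the values of \<open>conv_one\<close> at prime powers. Where
  \<open>\<eta> p = -1\<close> they alternate between 1 and 0, which is why squares are singled
  out.\<close>

lemma geometric_eta:
  "0 \<le> (\<Sum>i\<le>k. \<eta> p ^ i)" "even k \<Longrightarrow> 1 \<le> (\<Sum>i\<le>k. \<eta> p ^ i)"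
proof -
  have 1: "(\<Sum>i\<le>k. (-1 :: real) ^ i) = (if even k then 1 else 0)" by (induction k) auto
  have 2: "(\<Sum>i\<le>k. (0 :: real) ^ i) = 1" by (induction k) auto
  show "0 \<le> (\<Sum>i\<le>k. \<eta> p ^ i)" "even k \<Longrightarrow> 1 \<le> (\<Sum>i\<le>k. \<eta> p ^ i)"
    using eta_values[of p] 1 2 by auto
qed

lemma conv_one_prime_power_mult:
  assumes p: "prime p" "\<not> p dvd m" and m: "m > 0"
  shows "conv_one (p ^ k * m) = (\<Sum>i\<le>k. \<eta> p ^ i) * conv_one m"
proof -
  have "(\<Sum>i\<le>k. \<eta> p ^ i) * conv_one m = (\<Sum>(i, b)\<in>{..k} \<times> {b. b dvd m}. \<eta> (p ^ i * b))"
    unfolding conv_one_def sum_product sum.cartesian_product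
    by (intro sum.cong) (auto simp: mult eta_power)
  also have "\<dots> = (\<Sum>a\<in>(\<lambda>(i, b). p ^ i * b) ` ({..k} \<times> {b. b dvd m}). \<eta> a)"
  proof (subst sum.reindex)
    show "inj_on (\<lambda>(i, b). p ^ i * b) ({..k} \<times> {b. b dvd m})"
    proof (rule inj_onI, safe)
      fix i b j c assume *: "p ^ i * b = p ^ j * c" "b dvd m" "c dvd m"
      have nd: "\<not> p dvd b" "\<not> p dvd c" using * p by (auto dest: dvd_trans)
      have "multiplicity p (p ^ i * b) = i" "multiplicity p (p ^ j * c) = j"
        using nd p prime_gt_0_nat[OF p(1)] by (auto intro!: multiplicity_decomposeI[OF refl])
      thus "i = j" using * by simp
      thus "b = c" using *(1) prime_gt_0_nat[OF p(1)] by simp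
    qed
  qed (auto simp: case_prod_unfold)
  also have "(\<lambda>(i, b). p ^ i * b) ` ({..k} \<times> {b. b dvd m}) = {a. a dvd p ^ k * m}"
  proof (intro equalityI subsetI)
    fix a assume "a \<in> {a. a dvd p ^ k * m}"
    then obtain x b where "a = x * b" "x dvd p ^ k" "b dvd m"
      using division_decomp[of a "p ^ k" m] by auto
    moreover from this obtain i where "i \<le> k" "x = p ^ i" using divides_primepow_nat[OF p(1)] by auto
    ultimately show "a \<in> (\<lambda>(i, b). p ^ i * b) ` ({..k} \<times> {b. b dvd m})" by auto
  qed (auto intro!: mult_dvd_mono le_imp_power_dvd)
  finally show ?thesis by (simp add: conv_one_def)
qed

lemma conv_one_1 [simp]: "conv_one (Suc 0) = 1"
  by (simp add: conv_one_def)

lemma conv_one_nonneg: "n > 0 \<Longrightarrow> conv_one n \<ge> 0"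
proof (induction n rule: less_induct)
  case (less n)
  show ?case
  proof (cases "n = 1")
    case False
    hence "n > 1" using less.prems by simp
    then obtain p k m where n: "prime p" "n = p ^ k * m" "\<not> p dvd m" "0 < m" "m < n"
      by (rule prime_power_factorE)
    show ?thesis
      unfolding n(2) conv_one_prime_power_mult[OF n(1,3,4)]
      by (intro mult_nonneg_nonneg geometric_eta(1) less.IH n)
  qed auto
qed

lemma conv_one_square: "x > 0 \<Longrightarrow> conv_one (x ^ 2) \<ge> 1"
proof (induction x rule: less_induct)
  case (less n)
  show ?case
  proof (cases "n = 1")
    case False
    hence "n > 1" using less.prems by simp
    then obtain p k m where n: "prime p" "n = p ^ k * m" "\<not> p dvd m" "0 < m" "m < n"
      by (rule prime_power_factorE)
    have "n ^ 2 = p ^ (2 * k) * m ^ 2"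
      by (simp add: n(2) power_mult_distrib mult.commute flip: power_mult)
    moreover have "\<not> p dvd m ^ 2" using n by (simp add: prime_dvd_power_iff)
    ultimately have "conv_one (n ^ 2) = (\<Sum>i\<le>2 * k. \<eta> p ^ i) * conv_one (m ^ 2)"
      using conv_one_prime_power_mult[OF n(1), of "m ^ 2"] n(4) by simp
    moreover have "1 * 1 \<le> (\<Sum>i\<le>2 * k. \<eta> p ^ i) * conv_one (m ^ 2)"
      using less.IH[OF n(5,4)] geometric_eta(2)[of "2 * k" p] by (intro mult_mono) auto
    ultimately show ?thesis by simp
  qed auto
qed

text \<open>
  \<open>S 0\<close> is the series \<open>\<Sum>\<eta>(n) e\<^sup>-\<^sup>n\<^sup>v\<close> and \<open>- H\<close> is an antiderivative of it, with \<open>H(0+) = L(1, \<eta>)\<close>. The quotient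
  \<open>S 0 = P 0 / E 0\<close> below is regular at \<open>v = 0\<close>, so it controls the derivatives for small \<open>v\<close>, while partial summation
  does so for large \<open>v\<close>.
\<close>

definition S :: "nat \<Rightarrow> real \<Rightarrow> real" where
  "S k v = (\<Sum>n. \<eta> n * real n ^ k * exp (- real n * v))"

definition H :: "real \<Rightarrow> real" where
  "H v = (\<Sum>n. \<eta> n / real n * exp (- real n * v))"

lemma S_summable: "v > 0 \<Longrightarrow> summable (\<lambda>n. \<eta> n * real n ^ k * exp (- real n * v))"
  by (rule summable_comparison_test[OF _ summable_power_exp[of v k]])
     (use abs_eta_le in \<open>auto simp: abs_mult mult.assoc intro!: exI[of _ 0] mult_left_le_one_le\<close>)

lemma H_summable: "v > 0 \<Longrightarrow> summable (\<lambda>n. \<eta> n / real n * exp (- real n * v))"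
proof (rule summable_comparison_test[OF _ summable_power_exp[of v 0]])
  have "\<bar>\<eta> n / real n\<bar> \<le> 1" for n
    using abs_eta_le[of n] by (cases "n = 0") (auto simp: field_simps)
  hence "\<bar>\<eta> n / real n\<bar> * exp (- real n * v) \<le> 1 * exp (- real n * v)" for n
    by (intro mult_right_mono) auto
  thus "\<exists>N. \<forall>n\<ge>N. norm (\<eta> n / real n * exp (- real n * v)) \<le> real n ^ 0 * exp (- real n * v)"
    unfolding real_norm_def abs_mult abs_exp_cancel by simp
qed

lemma S_derivative: "v > 0 \<Longrightarrow> (S k has_real_derivative - S (Suc k) v) (at v)"
  using exp_series_derivative[OF S_summable, of v k] unfolding S_def [abs_def]
  by (simp add: mult_ac)

lemma H_derivative: "v > 0 \<Longrightarrow> (H has_real_derivative - S 0 v) (at v)"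
proof -
  assume "v > 0"
  have "\<eta> n / real n * real n = \<eta> n" for n by (cases "n = 0") auto
  thus ?thesis using exp_series_derivative[OF H_summable \<open>v > 0\<close>] unfolding H_def [abs_def] S_def by simp
qed

text \<open>Up to \<open>fact k\<close> the weights are the gamma kernel again, now in
  \<open>n\<close> itself rather than \<open>ln n\<close>, so the same variation bound applies. For
  \<open>k > 0\<close> the estimate degenerates as \<open>v\<close> tends to 0.\<close>

lemma abs_S_le:
  assumes v: "v > 0"
  shows "\<bar>S k v\<bar> \<le> 3 * real d * fact k / v ^ k"
proof -
  obtain V where V: "\<And>x. x \<ge> 0 \<Longrightarrow> 0 \<le> V x \<and> V x \<le> 2 * (1 / v) ^ k"
    "\<And>x y. 0 \<le> x \<Longrightarrow> x \<le> y \<Longrightarrow> \<bar>log_kernel v k y - log_kernel v k x\<bar> \<le> V y - V x"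
    using log_kernel_variation[OF v, of k] by blast
  have part: "\<bar>\<Sum>n<N. \<eta> n * log_kernel v k n\<bar> \<le> d * (3 * (1 / v) ^ k)" for N
  proof -
    have "(\<Sum>n\<in>{0..<N}. \<bar>log_kernel v k n - log_kernel v k (Suc n)\<bar>) \<le> (\<Sum>n\<in>{0..<N}. V (Suc n) - V n)"
      by (intro sum_mono order.trans[OF _ V(2)]) (auto simp: abs_minus_commute)
    also have "\<dots> = V N - V 0" by (subst sum_Suc_diff') auto
    finally have var: "(\<Sum>n\<in>{0..<N}. \<bar>log_kernel v k n - log_kernel v k (Suc n)\<bar>) \<le> 2 * (1 / v) ^ k"
      using V(1)[of 0] V(1)[of N] by auto
    have "\<bar>\<Sum>n<N. \<eta> n * log_kernel v k n\<bar> = norm (complex_of_real (\<Sum>n\<in>{0..<N}. \<eta> n * log_kernel v k n))"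
      by (simp only: norm_of_real lessThan_atLeast0 real_norm_def)
    also have "\<dots> = norm (\<Sum>n\<in>{0..<N}. of_real (\<eta> n) * complex_of_real (log_kernel v k n))" by simp
    also have "\<dots> \<le> d * ((\<Sum>n\<in>{0..<N}. \<bar>log_kernel v k n - log_kernel v k (Suc n)\<bar>) + \<bar>log_kernel v k N\<bar>)"
      by (intro abel_summation_bound[where w = "\<lambda>n. log_kernel v k (real n)"] oscillating_partial_sum osc) auto
    also have "\<bar>log_kernel v k N\<bar> \<le> (1 / v) ^ k"
      using log_kernel_le[of "real N" v k] log_kernel_nonneg[of "real N" v k] v by simp
    also note var
    finally show ?thesis by (simp add: mult_left_mono)
  qed
  have eq: "\<eta> n * real n ^ k * exp (- real n * v) = fact k * (\<eta> n * log_kernel v k n)" for n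
    by (simp add: log_kernel_def mult_ac)
  have "(\<lambda>n. \<eta> n * real n ^ k * exp (- real n * v)) sums S k v"
    unfolding S_def by (intro summable_sums S_summable v)
  hence "(\<lambda>N. fact k * (\<Sum>n<N. \<eta> n * log_kernel v k n)) \<longlonglongrightarrow> S k v"
    unfolding sums_def eq sum_distrib_left .
  hence lim: "(\<lambda>N. \<bar>fact k * (\<Sum>n<N. \<eta> n * log_kernel v k n)\<bar>) \<longlonglongrightarrow> \<bar>S k v\<bar>" by (rule tendsto_rabs)
  have "\<bar>S k v\<bar> \<le> fact k * (d * (3 * (1 / v) ^ k))"
    by (rule tendsto_upperbound[OF lim always_eventually]) (auto simp: abs_mult intro!: mult_left_mono part)
  thus ?thesis by (simp add: power_one_over field_simps)
qed

text \<open>For \<open>v > 0\<close> and \<open>z = exp (- v)\<close>, \<open>E 0\<close> is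
  \<open>(1 - z ^ d) / (1 - z)\<close>, and \<open>P 0\<close> below is
  \<open>(\<Sum>n<d. \<eta> n * z ^ n) / (1 - z)\<close> after partial summation, as
  \<open>\<eta>\<close> has mean 0. Cancelling \<open>1 - z\<close> removes the zero of the
  denominator at \<open>v = 0\<close>. Differentiation raises the index and changes the
  sign.\<close>

definition E :: "nat \<Rightarrow> real \<Rightarrow> real" where
  "E k v = (\<Sum>i<d. real i ^ k * exp (- real i * v))"

definition P :: "nat \<Rightarrow> real \<Rightarrow> real" where
  "P k v = (\<Sum>i<d. (\<Sum>j<Suc i. \<eta> j) * real i ^ k * exp (- real i * v))"

lemma E_derivative: "(E k has_real_derivative - E (Suc k) v) (at v)"
  unfolding E_def [abs_def] sum_negf [symmetric]
  by (intro DERIV_sum) (auto intro!: derivative_eq_intros)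

lemma P_derivative: "(P k has_real_derivative - P (Suc k) v) (at v)"
  unfolding P_def [abs_def] sum_negf [symmetric]
  by (intro DERIV_sum) (auto intro!: derivative_eq_intros)

lemma E_pos: "E 0 v > 0"
  unfolding E_def using d3 by (intro sum_pos2[where i = 0]) auto

lemma E_le: "0 \<le> E k v" "E k v \<le> real d ^ k * E 0 v"
  unfolding E_def sum_distrib_left
  by (intro sum_nonneg sum_mono mult_mono power_mono; simp)+

text \<open>Like \<open>E_le\<close>, this is relative to \<open>E 0 v\<close>, the common factor by
  which the product-rule identities are divided in the end.\<close>

lemma P_le: "\<bar>P k v\<bar> \<le> real d ^ (k + 1) * E 0 v"
proof -
  have "\<bar>P k v\<bar> \<le> (\<Sum>i<d. real d * (real i ^ k * exp (- real i * v)))"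
    unfolding P_def
  proof (intro order.trans[OF sum_abs] sum_mono)
    fix i
    have "\<bar>\<Sum>j<Suc i. \<eta> j\<bar> = norm (\<Sum>j\<in>{0..<Suc i}. complex_of_real (\<eta> j))"
      by (simp only: norm_of_real lessThan_atLeast0 real_norm_def flip: of_real_sum)
    also have "\<dots> \<le> d" by (intro oscillating_partial_sum osc)
    finally show "\<bar>(\<Sum>j<Suc i. \<eta> j) * real i ^ k * exp (- real i * v)\<bar> \<le> real d * (real i ^ k * exp (- real i * v))"
      unfolding abs_mult mult.assoc by (intro mult_mono) auto
  qed
  also have "\<dots> = real d * E k v" by (simp add: E_def sum_distrib_left)
  also have "\<dots> \<le> real d * (real d ^ k * E 0 v)" by (intro mult_left_mono E_le) auto
  finally show ?thesis by (simp add: mult_ac)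
qed

lemma S_times_E: "v > 0 \<Longrightarrow> S 0 v * E 0 v = P 0 v"
proof -
  assume v: "v > 0"
  define z where "z = exp (- v)"
  have z: "0 < z" "z < 1" using v by (auto simp: z_def)
  have e: "exp (- real n * v) = z ^ n" for n by (simp add: z_def exp_of_nat_mult [symmetric])
  have per: "\<eta> (n + d) = \<eta> n" for n
    using dchar_cong[OF dchar, of "n + d" n] by (simp add: cong_def)
  have s: "summable (\<lambda>n. \<eta> n * z ^ n)" using S_summable[OF v, of 0] unfolding e by simp
  have "S 0 v = (\<Sum>n. \<eta> n * z ^ n)" unfolding S_def e by simp
  also have "\<dots> = (\<Sum>n. \<eta> (n + d) * z ^ (n + d)) + (\<Sum>n<d. \<eta> n * z ^ n)"
    by (rule suminf_split_initial_segment[OF s])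
  also have "(\<Sum>n. \<eta> (n + d) * z ^ (n + d)) = (\<Sum>n. z ^ d * (\<eta> n * z ^ n))"
    by (simp add: per power_add mult_ac)
  also have "\<dots> = z ^ d * (\<Sum>n. \<eta> n * z ^ n)" by (rule suminf_mult[OF s])
  also have "(\<Sum>n. \<eta> n * z ^ n) = S 0 v" unfolding S_def e by simp
  finally have "S 0 v - z ^ d * S 0 v = (\<Sum>n<d. \<eta> n * z ^ n)" by linarith
  moreover have "S 0 v * (1 - z ^ d) = S 0 v - z ^ d * S 0 v" by (simp add: algebra_simps)
  ultimately have 1: "S 0 v * (1 - z ^ d) = (\<Sum>n<d. \<eta> n * z ^ n)" by simp
  have 2: "1 - z ^ d = (1 - z) * E 0 v"
    unfolding E_def e using one_diff_power_eq[of z d] by simp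
  \<comment> \<open>Partial summation; at \<open>n = d\<close> the boundary term vanishes because
    the sum over a period is 0.\<close>
  have "(1 - z) * (\<Sum>i<n. (\<Sum>j<Suc i. \<eta> j) * z ^ i) = (\<Sum>i<n. \<eta> i * z ^ i) - (\<Sum>j<n. \<eta> j) * z ^ n" for n
  proof (induction n)
    case (Suc n)
    have "(1 - z) * (\<Sum>i<Suc n. (\<Sum>j<Suc i. \<eta> j) * z ^ i) =
        (1 - z) * (\<Sum>i<n. (\<Sum>j<Suc i. \<eta> j) * z ^ i) + (1 - z) * (((\<Sum>j<n. \<eta> j) + \<eta> n) * z ^ n)"
      by (simp only: sum.lessThan_Suc distrib_left)
    also note Suc.IH
    finally have eq: "(1 - z) * (\<Sum>i<Suc n. (\<Sum>j<Suc i. \<eta> j) * z ^ i) =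
        (\<Sum>i<n. \<eta> i * z ^ i) - (\<Sum>j<n. \<eta> j) * z ^ n + (1 - z) * (((\<Sum>j<n. \<eta> j) + \<eta> n) * z ^ n)" .
    show ?case unfolding eq by (simp add: algebra_simps)
  qed auto
  from this[of d] have "(1 - z) * P 0 v = (\<Sum>i<d. \<eta> i * z ^ i) - (\<Sum>j<d. \<eta> j) * z ^ d"
    unfolding P_def e by simp
  moreover have "(\<Sum>j<d. \<eta> j) = 0"
    using osc unfolding oscillating_def by (simp flip: of_real_sum)
  ultimately have "(1 - z) * (S 0 v * E 0 v) = (1 - z) * P 0 v" using 1 2 by (simp add: mult_ac)
  thus ?thesis using z by simp
qed

lemma S_times_E_derivative:
  assumes v: "v > 0"
  shows "S 1 v * E 0 v + S 0 v * E 1 v = P 1 v"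
proof -
  have "((\<lambda>v. S 0 v * E 0 v) has_real_derivative - S (Suc 0) v * E 0 v + - E (Suc 0) v * S 0 v) (at v)"
    by (intro DERIV_mult S_derivative E_derivative v)
  hence "(P 0 has_real_derivative - S (Suc 0) v * E 0 v + - E (Suc 0) v * S 0 v) (at v)"
    by (rule has_field_derivative_transform_within_open[of _ _ _ "{0<..}"]) (use v S_times_E in auto)
  from DERIV_unique[OF this P_derivative] show ?thesis by (simp add: algebra_simps)
qed

lemma S_times_E_derivative2:
  assumes v: "v > 0"
  shows "S 2 v * E 0 v + 2 * (S 1 v * E 1 v) + S 0 v * E 2 v = P 2 v"
proof -
  have "((\<lambda>v. S 1 v * E 0 v + S 0 v * E 1 v) has_real_derivative
      (- S (Suc 1) v * E 0 v + - E (Suc 0) v * S 1 v) + (- S (Suc 0) v * E 1 v + - E (Suc 1) v * S 0 v)) (at v)"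
    by (intro DERIV_mult DERIV_add S_derivative E_derivative v)
  hence "(P 1 has_real_derivative
      (- S (Suc 1) v * E 0 v + - E (Suc 0) v * S 1 v) + (- S (Suc 0) v * E 1 v + - E (Suc 1) v * S 0 v)) (at v)"
    by (rule has_field_derivative_transform_within_open[of _ _ _ "{0<..}"]) (use v S_times_E_derivative in auto)
  from DERIV_unique[OF this P_derivative] show ?thesis by (simp add: algebra_simps numeral_2_eq_2)
qed

text \<open>Solving the differentiated product identity for \<open>S 1\<close> and dividing by
  \<open>E 0 v\<close> gives a bound that stays finite as \<open>v\<close> tends to 0; 1 comes from
  \<open>P 1\<close> and 3 from \<open>S 0\<close>.\<close>

lemma abs_S_1_le:
  assumes v: "v > 0" shows "\<bar>S 1 v\<bar> \<le> 4 * real d ^ 2"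
proof -
  have "S 1 v * E 0 v = P 1 v - S 0 v * E 1 v" using S_times_E_derivative[OF v] by simp
  hence "\<bar>S 1 v\<bar> * E 0 v = \<bar>P 1 v - S 0 v * E 1 v\<bar>" using E_pos[of v] by (metis abs_mult abs_of_pos)
  also have "\<dots> \<le> \<bar>P 1 v\<bar> + \<bar>S 0 v\<bar> * E 1 v"
    using abs_mult[of "S 0 v" "E 1 v"] E_le(1)[of 1 v] by linarith
  also have "\<dots> \<le> real d ^ 2 * E 0 v + 3 * real d * (real d * E 0 v)"
    using P_le[of 1 v] abs_S_le[OF v, of 0] E_le[of 1 v] d3
    by (intro add_mono mult_mono) (auto simp: numeral_2_eq_2)
  also have "\<dots> = 4 * real d ^ 2 * E 0 v" by (simp add: power2_eq_square)
  finally show ?thesis using E_pos[of v] by simp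
qed

lemma abs_S_2_le:
  assumes v: "v > 0" shows "\<bar>S 2 v\<bar> \<le> 12 * real d ^ 3"
proof -
  have "\<bar>S 2 v\<bar> * E 0 v = \<bar>P 2 v - 2 * (S 1 v * E 1 v) - S 0 v * E 2 v\<bar>"
  proof -
    have "S 2 v * E 0 v = P 2 v - 2 * (S 1 v * E 1 v) - S 0 v * E 2 v"
      using S_times_E_derivative2[OF v] by simp
    thus ?thesis using E_pos[of v] by (metis abs_mult abs_of_pos)
  qed
  also have "\<dots> \<le> \<bar>P 2 v\<bar> + 2 * (\<bar>S 1 v\<bar> * E 1 v) + \<bar>S 0 v\<bar> * E 2 v"
    using E_le(1)[of 1 v] E_le(1)[of 2 v] abs_mult[of "S 0 v" "E 2 v"] abs_mult[of "S 1 v" "E 1 v"] by linarith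
  also have "\<dots> \<le> real d ^ 3 * E 0 v + 2 * (4 * real d ^ 2 * (real d * E 0 v)) + 3 * real d * (real d ^ 2 * E 0 v)"
    using P_le[of 2 v] abs_S_le[OF v, of 0] abs_S_1_le[OF v] E_le[of 1 v] E_le[of 2 v]
    by (intro add_mono mult_left_mono mult_mono) auto
  also have "\<dots> = 12 * real d ^ 3 * E 0 v" by (simp add: power2_eq_square power3_eq_cube)
  finally show ?thesis using E_pos[of v] by simp
qed

text \<open>One formula for two regimes, \<open>12 * d ^ 3\<close> up to \<open>v = 1 / d\<close>
  and \<open>6 * d / v ^ 2\<close> beyond. Written with \<open>1 + d * v\<close> it can be summed by
  telescoping over the intervals of the midpoint rule.\<close>

lemma abs_S_2_le':
  fixes v :: real
  assumes v: "v > 0" shows "\<bar>S 2 v\<bar> \<le> 48 * real d ^ 3 / (1 + d * v) ^ 2"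
proof (cases "d * v \<le> 1")
  case True
  have "(1 + d * v) ^ 2 \<le> (2::real) ^ 2" using True v by (intro power_mono) auto
  hence "\<bar>S 2 v\<bar> * (1 + d * v) ^ 2 \<le> 12 * real d ^ 3 * 4"
    using abs_S_2_le[OF v] by (intro mult_mono) auto
  moreover have "(1 + d * v) ^ 2 > 0" using v by (intro zero_less_power add_pos_nonneg) auto
  ultimately show ?thesis by (simp add: pos_le_divide_eq)
next
  case False
  have "1 < real d * v" using False by simp
  hence "(1 + d * v) ^ 2 \<le> (2 * (d * v)) ^ 2" by (intro power_mono) linarith+
  hence "\<bar>S 2 v\<bar> * (1 + d * v) ^ 2 \<le> (3 * real d * fact 2 / v ^ 2) * (2 * (d * v)) ^ 2"
    using abs_S_le[OF v, of 2] by (intro mult_mono) auto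
  also have "\<dots> = 24 * real d ^ 3" using v by (simp add: fact_numeral power2_eq_square power3_eq_cube)
  also have "\<dots> \<le> 48 * real d ^ 3" by simp
  finally have "\<bar>S 2 v\<bar> * (1 + d * v) ^ 2 \<le> 48 * real d ^ 3" .
  moreover have "(1 + d * v) ^ 2 > 0" using v by (intro zero_less_power add_pos_nonneg) auto
  ultimately show ?thesis by (simp add: pos_le_divide_eq)
qed

section \<open>The midpoint rule\<close>

lemma taylor_H:
  assumes x: "0 < x" "x \<noteq> c" and c: "0 < c"
    and B: "\<And>v. min x c < v \<Longrightarrow> v < max x c \<Longrightarrow> \<bar>S 2 v\<bar> \<le> B"
  shows "\<bar>H x - (H c - S 0 c * (x - c) + S 1 c * (x - c) ^ 2 / 2)\<bar> \<le> B * \<bar>x - c\<bar> ^ 3 / 6"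
proof -
  define diff where "diff = (\<lambda>m :: nat. if m = 0 then H else if m = 1 then (\<lambda>v. - S 0 v) else if m = 2 then S 1 else (\<lambda>v. - S 2 v))"
  have D: "DERIV (diff m) t :> diff (Suc m) t" if "m < 3" "t > 0" for m t
  proof -
    have "m = 0 \<or> m = 1 \<or> m = 2" using that by auto
    thus ?thesis using H_derivative[OF that(2)] S_derivative[OF that(2), of 1] DERIV_minus[OF S_derivative[OF that(2), of 0]]
      by (auto simp: diff_def numeral_2_eq_2)
  qed
  have "\<exists>t. (if x < c then x < t \<and> t < c else c < t \<and> t < x) \<and>
      H x = (\<Sum>m<3. (diff m c / fact m) * (x - c) ^ m) + (diff 3 t / fact 3) * (x - c) ^ 3"
  proof (rule Taylor)
    show "\<forall>m t. m < 3 \<and> min x c \<le> t \<and> t \<le> max x c \<longrightarrow> DERIV (diff m) t :> diff (Suc m) t"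
      using D x c by auto
    show "diff 0 = H" by (simp add: diff_def)
  qed (use x in auto)
  then obtain t where t: "if x < c then x < t \<and> t < c else c < t \<and> t < x"
    "H x = (\<Sum>m<3. (diff m c / fact m) * (x - c) ^ m) + (diff 3 t / fact 3) * (x - c) ^ 3" by blast
  have "H x = H c - S 0 c * (x - c) + S 1 c * (x - c) ^ 2 / 2 - S 2 t * (x - c) ^ 3 / 6"
    unfolding t(2) by (simp add: diff_def eval_nat_numeral)
  hence "\<bar>H x - (H c - S 0 c * (x - c) + S 1 c * (x - c) ^ 2 / 2)\<bar> = \<bar>S 2 t\<bar> * \<bar>x - c\<bar> ^ 3 / 6"
    by (simp add: abs_mult power_abs)
  also have "\<dots> \<le> B * \<bar>x - c\<bar> ^ 3 / 6"
    using t(1) x by (intro divide_right_mono mult_right_mono B) (auto split: if_splits)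
  finally show ?thesis .
qed

text \<open>Expansion of \<open>H\<close> at \<open>c\<close> to second order, taken at both ends.
  On a symmetric interval the \<open>S 1\<close> term cancels, which is the gain of the midpoint
  rule; the asymmetric form is for the first interval, whose left end is moved off 0.\<close>

lemma H_midpoint:
  assumes x: "0 < x" "x < c" "c < y" and B: "\<And>v. x < v \<Longrightarrow> v < y \<Longrightarrow> \<bar>S 2 v\<bar> \<le> B"
  shows "\<bar>H x - H y - S 0 c * (y - x) - S 1 c * ((c - x) ^ 2 - (y - c) ^ 2) / 2\<bar> \<le> B * ((c - x) ^ 3 + (y - c) ^ 3) / 6"
proof -
  have 1: "\<bar>H x - (H c - S 0 c * (x - c) + S 1 c * (x - c) ^ 2 / 2)\<bar> \<le> B * \<bar>x - c\<bar> ^ 3 / 6"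
    using x by (intro taylor_H B) auto
  have 2: "\<bar>H y - (H c - S 0 c * (y - c) + S 1 c * (y - c) ^ 2 / 2)\<bar> \<le> B * \<bar>y - c\<bar> ^ 3 / 6"
    using x by (intro taylor_H B) auto
  have "H x - H y - S 0 c * (y - x) - S 1 c * ((c - x) ^ 2 - (y - c) ^ 2) / 2 =
      (H x - (H c - S 0 c * (x - c) + S 1 c * (x - c) ^ 2 / 2)) - (H y - (H c - S 0 c * (y - c) + S 1 c * (y - c) ^ 2 / 2))"
    by (simp add: power2_eq_square field_simps)
  moreover have "B * ((c - x) ^ 3 + (y - c) ^ 3) / 6 = B * \<bar>x - c\<bar> ^ 3 / 6 + B * \<bar>y - c\<bar> ^ 3 / 6"
    using x by (simp add: algebra_simps add_divide_distrib)
  ultimately show ?thesis using 1 2 by linarith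
qed

lemma midpoint_step:
  assumes t: "t > 0" and j: "j > 0"
  shows "\<bar>H (2 * real j * t) - H (2 * real (Suc j) * t) - 2 * t * S 0 ((2 * real j + 1) * t)\<bar>
    \<le> 16 * (real d * t) ^ 3 / (1 + real j * (2 * real d * t)) ^ 2"
proof -
  have "\<bar>H (2 * real j * t) - H (2 * real (Suc j) * t) - S 0 ((2 * real j + 1) * t) * (2 * real (Suc j) * t - 2 * real j * t)
      - S 1 ((2 * real j + 1) * t) * (((2 * real j + 1) * t - 2 * real j * t) ^ 2 - (2 * real (Suc j) * t - (2 * real j + 1) * t) ^ 2) / 2\<bar>
    \<le> (48 * real d ^ 3 / (1 + real j * (2 * real d * t)) ^ 2) * (((2 * real j + 1) * t - 2 * real j * t) ^ 3 + (2 * real (Suc j) * t - (2 * real j + 1) * t) ^ 3) / 6"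
  proof (rule H_midpoint)
    fix v assume v: "2 * real j * t < v"
    have v0: "v > 0" using v t j by (smt (verit) mult_nonneg_nonneg of_nat_0_le_iff)
    have "real d * (2 * real j * t) \<le> real d * v" using v by (intro mult_left_mono) auto
    hence "1 + real j * (2 * real d * t) \<le> 1 + real d * v" by (simp add: mult_ac)
    hence "(1 + real j * (2 * real d * t)) ^ 2 \<le> (1 + real d * v) ^ 2" using t by (intro power_mono) auto
    hence "48 * real d ^ 3 / (1 + real d * v) ^ 2 \<le> 48 * real d ^ 3 / (1 + real j * (2 * real d * t)) ^ 2"
      using t v0 by (intro divide_left_mono) (auto intro!: mult_pos_pos zero_less_power add_pos_nonneg)
    thus "\<bar>S 2 v\<bar> \<le> 48 * real d ^ 3 / (1 + real j * (2 * real d * t)) ^ 2"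
      using abs_S_2_le'[OF v0] by linarith
  qed (use t j in \<open>auto simp: algebra_simps\<close>)
  moreover have "(2 * real j + 1) * t - 2 * real j * t = t" "2 * real (Suc j) * t - (2 * real j + 1) * t = t"
    "2 * real (Suc j) * t - 2 * real j * t = 2 * t" by (simp_all add: algebra_simps)
  moreover have "a - b - c * (2 * t) - e * (t ^ 2 - t ^ 2) / 2 = a - b - 2 * t * c" for a b c e :: real by simp
  moreover have "48 * real d ^ 3 / q * (t ^ 3 + t ^ 3) / 6 = 16 * (real d * t) ^ 3 / q" for q
    by (simp add: power_mult_distrib)
  ultimately show ?thesis by (simp only:)
qed

text \<open>
  The left end \<open>\<tau>\<close> of the first interval stands for \<open>0\<close>, where \<open>H\<close> is not absolutely convergent.
\<close>

lemma midpoint_first: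
  assumes t: "t > 0" and \<tau>: "0 < \<tau>" "\<tau> < t"
  shows "\<bar>H \<tau> - H (2 * t) - 2 * t * S 0 t\<bar> \<le> \<tau> * (3 * real d + 4 * real d ^ 2 * t) + 4 * (real d * t) ^ 3"
proof -
  have "\<bar>H \<tau> - H (2 * t) - S 0 t * (2 * t - \<tau>) - S 1 t * ((t - \<tau>) ^ 2 - (2 * t - t) ^ 2) / 2\<bar>
     \<le> 12 * real d ^ 3 * ((t - \<tau>) ^ 3 + (2 * t - t) ^ 3) / 6"
    using t \<tau> by (intro H_midpoint abs_S_2_le) auto
  also have "\<dots> \<le> 12 * real d ^ 3 * (t ^ 3 + t ^ 3) / 6"
    using t \<tau> by (intro divide_right_mono mult_left_mono add_mono power_mono) auto
  finally have 1: "\<bar>H \<tau> - H (2 * t) - S 0 t * (2 * t - \<tau>) - S 1 t * ((t - \<tau>) ^ 2 - (2 * t - t) ^ 2) / 2\<bar> \<le> 4 * (real d * t) ^ 3"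
    by (simp add: power_mult_distrib mult_ac)
  have 2: "\<bar>S 0 t * \<tau>\<bar> \<le> 3 * real d * \<tau>"
    using abs_S_le[OF t, of 0] \<tau> by (simp add: abs_mult mult_right_mono)
  have 3: "\<bar>S 1 t * ((t - \<tau>) ^ 2 - (2 * t - t) ^ 2) / 2\<bar> \<le> 4 * real d ^ 2 * (\<tau> * t)"
  proof -
    have "\<bar>(t - \<tau>) ^ 2 - (2 * t - t) ^ 2\<bar> = \<tau> * (2 * t - \<tau>)"
      using t \<tau> by (subst abs_of_nonpos) (auto simp: power2_eq_square algebra_simps)
    also have "\<dots> \<le> \<tau> * (2 * t)" using \<tau> by (intro mult_left_mono) auto
    finally have "\<bar>S 1 t\<bar> * \<bar>(t - \<tau>) ^ 2 - (2 * t - t) ^ 2\<bar> \<le> 4 * real d ^ 2 * (\<tau> * (2 * t))"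
      by (intro mult_mono abs_S_1_le t) auto
    thus ?thesis by (simp add: abs_mult)
  qed
  have 4: "H \<tau> - H (2 * t) - 2 * t * S 0 t = (H \<tau> - H (2 * t) - S 0 t * (2 * t - \<tau>) - S 1 t * ((t - \<tau>) ^ 2 - (2 * t - t) ^ 2) / 2)
     - S 0 t * \<tau> + S 1 t * ((t - \<tau>) ^ 2 - (2 * t - t) ^ 2) / 2" by (simp add: algebra_simps)
  have 5: "\<tau> * (3 * real d + 4 * real d ^ 2 * t) = 3 * real d * \<tau> + 4 * real d ^ 2 * (\<tau> * t)"
    by (simp add: algebra_simps)
  have "\<bar>z\<bar> \<le> e + b" if "\<bar>a\<bar> \<le> b" "\<bar>x\<bar> \<le> c" "\<bar>y\<bar> \<le> c'" "z = a - x + y" "e = c + c'"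
    for a b c c' e x y z :: real using that by linarith
  from this[OF 1 2 3 4 5] show ?thesis .
qed

lemma midpoint_sum:
  assumes t: "t > 0" and \<tau>: "0 < \<tau>" "\<tau> < t" and J: "J \<ge> 1"
  shows "\<bar>H \<tau> - H (2 * real J * t) - 2 * t * (\<Sum>j<J. S 0 ((2 * real j + 1) * t))\<bar>
    \<le> \<tau> * (3 * real d + 4 * real d ^ 2 * t) + 4 * (real d * t) ^ 3 + 8 * (real d * t) ^ 2"
proof -
  define h where "h = 2 * real d * t"
  have h: "h > 0" using t d3 by (simp add: h_def)
  \<comment> \<open>The last term is the telescoped majorant of the sum of
    \<open>1 / (1 + j * h) ^ 2\<close>: each summand is at most \<open>1 / h\<close> times a
    difference of consecutive values of \<open>1 / (1 + j * h)\<close>, and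
    \<open>16 * (d * t) ^ 3 / h = 8 * (d * t) ^ 2\<close>.\<close>
  have "\<bar>H \<tau> - H (2 * real J * t) - 2 * t * (\<Sum>j<J. S 0 ((2 * real j + 1) * t))\<bar>
    \<le> \<tau> * (3 * real d + 4 * real d ^ 2 * t) + 4 * (real d * t) ^ 3 + 8 * (real d * t) ^ 2 * (1 - 1 / (1 + real (J - 1) * h))"
    using J
  proof (induction J rule: dec_induct)
    case base
    thus ?case using midpoint_first[OF t \<tau>] by simp
  next
    case (step J)
    have pos: "1 + real (J - 1) * h > 0" "1 + real J * h > 0" using h by (auto intro!: add_pos_nonneg)
    have Jeq: "1 + real J * h = 1 + real (J - 1) * h + h" using step by (cases J) (auto simp: algebra_simps)
    have "1 / (1 + real J * h) ^ 2 \<le> 1 / ((1 + real J * h) * (1 + real (J - 1) * h))"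
      using pos h unfolding power2_eq_square Jeq by (intro divide_left_mono mult_left_mono mult_pos_pos) auto
    also have "\<dots> = (1 / h) * (1 / (1 + real (J - 1) * h) - 1 / (1 + real J * h))"
      using pos h Jeq by (simp add: field_simps)
    finally have "16 * (real d * t) ^ 3 * (1 / (1 + real J * h) ^ 2) \<le>
        16 * (real d * t) ^ 3 * ((1 / h) * (1 / (1 + real (J - 1) * h) - 1 / (1 + real J * h)))"
      using t by (intro mult_left_mono) auto
    also have "16 * (real d * t) ^ 3 * ((1 / h) * (1 / (1 + real (J - 1) * h) - 1 / (1 + real J * h))) =
        8 * (real d * t) ^ 2 * (1 / (1 + real (J - 1) * h) - 1 / (1 + real J * h))"
      using t d3 by (simp add: h_def power2_eq_square power3_eq_cube)
    finally have "16 * (real d * t) ^ 3 / (1 + real J * h) ^ 2 \<le>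
        8 * (real d * t) ^ 2 * (1 - 1 / (1 + real (Suc J - 1) * h)) - 8 * (real d * t) ^ 2 * (1 - 1 / (1 + real (J - 1) * h))"
      by (simp add: algebra_simps)
    moreover have "\<bar>H (2 * real J * t) - H (2 * real (Suc J) * t) - 2 * t * S 0 ((2 * real J + 1) * t)\<bar>
        \<le> 16 * (real d * t) ^ 3 / (1 + real J * h) ^ 2"
      using midpoint_step[OF t, of J] step by (simp add: h_def)
    moreover have "2 * t * (\<Sum>j<Suc J. S 0 ((2 * real j + 1) * t)) =
        2 * t * (\<Sum>j<J. S 0 ((2 * real j + 1) * t)) + 2 * t * S 0 ((2 * real J + 1) * t)" by (simp add: algebra_simps)
    ultimately show ?case using step.IH by linarith
  qed
  also have "8 * (real d * t) ^ 2 * (1 - 1 / (1 + real (J - 1) * h)) \<le> 8 * (real d * t) ^ 2 * 1"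
    using h by (intro mult_left_mono) (auto intro!: add_nonneg_nonneg)
  finally show ?thesis by simp
qed

text \<open>
  \<open>Q t - Q (2 t)\<close> is both a sum with nonnegative terms and, by rearrangement, the sum of \<open>S 0\<close> over the odd multiples of \<open>t\<close>,
  i.e. a midpoint rule for the integral of \<open>S 0\<close>.
\<close>

definition Q :: "real \<Rightarrow> real" where
  "Q t = (\<Sum>\<^sub>\<infinity>n\<in>{0<..}. conv_one n * exp (- real n * t))"

lemma abs_conv_one_le: "\<bar>conv_one n\<bar> \<le> real n"
proof (cases "n = 0")
  case False
  have "\<bar>conv_one n\<bar> \<le> (\<Sum>a | a dvd n. 1)"
    unfolding conv_one_def by (intro order.trans[OF sum_abs] sum_mono abs_eta_le)
  also have "\<dots> = real (card {a. a dvd n})" by simp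
  also have "card {a. a dvd n} \<le> card {1..n}"
    using False by (intro card_mono) (auto simp: dvd_imp_le Suc_le_eq intro!: Nat.gr0I)
  finally show ?thesis by simp
qed (simp add: conv_one_def)

lemma conv_one_exp_summable:
  assumes t: "t > 0"
  shows "(\<lambda>n. conv_one n * exp (- real n * t)) summable_on {0<..}"
proof -
  have "(\<lambda>n. real n ^ 1 * exp (- real n * t)) summable_on UNIV"
    by (rule summable_nonneg_imp_summable_on[OF summable_power_exp[OF t]]) auto
  hence "(\<lambda>n. real n ^ 1 * exp (- real n * t)) summable_on {0<..}"
    by (rule summable_on_subset_banach) auto
  hence "(\<lambda>n. norm (conv_one n * exp (- real n * t))) summable_on {0<..}"
    by (rule Infinite_Sum.abs_summable_on_comparison_test')
       (auto simp: abs_mult intro!: mult_right_mono abs_conv_one_le)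
  thus ?thesis by (rule abs_summable_summable)
qed

text \<open>For positive integers \<open>a + b \<le> 2 * a * b\<close>, so a product of two
  geometric series dominates.\<close>

lemma double_exp_summable:
  assumes t: "t > 0"
  shows "(\<lambda>(a, b). \<eta> a * exp (- real a * (real b * t))) summable_on ({0<..} \<times> {0<..})"
proof -
  have "(\<lambda>n. real n ^ 0 * exp (- real n * (t / 2))) summable_on UNIV"
    by (rule summable_nonneg_imp_summable_on[OF summable_power_exp]) (use t in auto)
  hence "(\<lambda>n. real n ^ 0 * exp (- real n * (t / 2))) summable_on {0<..}"
    by (rule summable_on_subset_banach) auto
  hence s: "(\<lambda>n. norm (exp (- real n * (t / 2)))) summable_on {0<..}" by simp
  have "(\<lambda>(a, b). exp (- real a * (t / 2)) * exp (- real b * (t / 2))) summable_on ({0<..} \<times> {0<..})"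
    by (rule abs_summable_on_product[OF s s])
  hence "(\<lambda>x. norm ((\<lambda>(a, b). \<eta> a * exp (- real a * (real b * t))) x)) summable_on ({0<..} \<times> {0<..})"
  proof (rule Infinite_Sum.abs_summable_on_comparison_test', safe)
    fix a b :: nat assume ab: "a > 0" "b > 0"
    have "real a \<le> real a * real b" "real b \<le> real a * real b"
      using ab mult_left_mono[of 1 "real b" "real a"] mult_right_mono[of 1 "real a" "real b"] by simp_all
    hence "real a + real b \<le> 2 * (real a * real b)" by linarith
    hence "(real a + real b) * (t / 2) \<le> 2 * (real a * real b) * (t / 2)" using t by (intro mult_right_mono) auto
    hence "exp (- real a * (real b * t)) \<le> exp (- real a * (t / 2)) * exp (- real b * (t / 2))"
      by (simp add: algebra_simps flip: exp_add)
    moreover have "\<bar>\<eta> a\<bar> * exp (- real a * (real b * t)) \<le> 1 * exp (- real a * (real b * t))"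
      by (intro mult_right_mono abs_eta_le) auto
    ultimately show "norm (\<eta> a * exp (- real a * (real b * t))) \<le> exp (- real a * (t / 2)) * exp (- real b * (t / 2))"
      unfolding real_norm_def abs_mult abs_exp_cancel by linarith
  qed
  thus ?thesis by (rule abs_summable_summable)
qed

text \<open>A Lambert series evaluated in two ways: the terms
  \<open>\<eta> a * exp (- a * b * t)\<close> grouped by \<open>a * b\<close> give
  \<open>Q t\<close>, and summed over \<open>a\<close> first give
  \<open>S 0 (b * t)\<close>.\<close>

lemma S_sums_Q:
  assumes t: "t > 0"
  shows "(\<lambda>b. S 0 (real (Suc b) * t)) sums Q t"
proof -
  have "(\<Sum>\<^sub>\<infinity>(a, b)\<in>{0<..} \<times> {0<..}. \<eta> a * exp (- real a * (real b * t))) =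
      (\<Sum>\<^sub>\<infinity>n\<in>{0<..}. \<Sum>a | a dvd n. \<eta> a * exp (- real a * (real (n div a) * t)))"
    by (rule infsum_mult_pairs[OF double_exp_summable[OF t]])
  also have "\<dots> = Q t" unfolding Q_def
  proof (intro infsum_cong)
    fix n :: nat assume "n \<in> {0<..}"
    show "(\<Sum>a | a dvd n. \<eta> a * exp (- real a * (real (n div a) * t))) = conv_one n * exp (- real n * t)"
      unfolding conv_one_def sum_distrib_right
    proof (intro sum.cong refl)
      fix a assume "a \<in> {a. a dvd n}"
      hence "real a * real (n div a) = real n" by (simp flip: of_nat_mult)
      hence "- real a * (real (n div a) * t) = - real n * t" by (simp add: mult.assoc [symmetric])
      thus "\<eta> a * exp (- real a * (real (n div a) * t)) = \<eta> a * exp (- real n * t)" by (simp only:)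
    qed
  qed
  finally have "((\<lambda>(a, b). \<eta> a * exp (- real a * (real b * t))) has_sum Q t) ({0<..} \<times> {0<..})"
    using has_sum_infsum[OF double_exp_summable[OF t]] by simp
  hence *: "((\<lambda>(b, a). \<eta> a * exp (- real a * (real b * t))) has_sum Q t) ({0<..} \<times> {0<..})"
    by (subst (asm) has_sum_swap) simp
  have "((\<lambda>b. S 0 (real b * t)) has_sum Q t) {0<..}"
  proof (rule has_sum_SigmaD[OF *])
    fix b :: nat assume b: "b \<in> {0<..}"
    hence bt: "real b * t > 0" using t by simp
    have "summable (\<lambda>a. norm (\<eta> a * real a ^ 0 * exp (- real a * (real b * t))))"
      by (rule summable_comparison_test'[OF summable_power_exp[OF bt, of 0], of 0])
        (auto simp: abs_mult intro!: mult_left_le_one_le abs_eta_le)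
    moreover have "(\<lambda>a. \<eta> a * real a ^ 0 * exp (- real a * (real b * t))) sums S 0 (real b * t)"
      unfolding S_def by (intro summable_sums S_summable bt)
    ultimately have "((\<lambda>a. \<eta> a * real a ^ 0 * exp (- real a * (real b * t))) has_sum S 0 (real b * t)) UNIV"
      by (rule norm_summable_imp_has_sum)
    also have "?this \<longleftrightarrow> ((\<lambda>a. (\<lambda>(b, a). \<eta> a * exp (- real a * (real b * t))) (b, a)) has_sum S 0 (real b * t)) {0<..}"
      by (intro has_sum_cong_neutral) auto
    finally show "((\<lambda>a. (\<lambda>(b, a). \<eta> a * exp (- real a * (real b * t))) (b, a)) has_sum S 0 (real b * t)) {0<..}" .
  qed
  moreover have "bij_betw Suc UNIV {0<..}" by (auto simp: bij_betw_def image_iff gr0_conv_Suc)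
  ultimately have "((\<lambda>b. S 0 (real (Suc b) * t)) has_sum Q t) UNIV"
    using has_sum_reindex_bij_betw[of Suc UNIV "{0<..}" "\<lambda>b. S 0 (real b * t)"] by simp
  thus ?thesis by (rule has_sum_imp_sums)
qed

text \<open>The terms at even multiples of \<open>t\<close> form the series of
  \<open>Q (2 * t)\<close>; cutting the two series at \<open>2 * J\<close> and \<open>J\<close>
  makes the partial sums match exactly.\<close>

lemma odd_sum_limit:
  assumes t: "t > 0"
  shows "(\<lambda>J. \<Sum>j<J. S 0 ((2 * real j + 1) * t)) \<longlonglongrightarrow> Q t - Q (2 * t)"
proof -
  have 1: "(\<lambda>J. \<Sum>b<2 * J. S 0 (real (Suc b) * t)) \<longlonglongrightarrow> Q t"
    using S_sums_Q[OF t] unfolding sums_def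
    by (rule filterlim_compose) (rule filterlim_subseq, auto simp: strict_mono_def)
  have 2: "(\<lambda>J. \<Sum>b<J. S 0 (real (Suc b) * (2 * t))) \<longlonglongrightarrow> Q (2 * t)"
    using S_sums_Q[of "2 * t"] t unfolding sums_def by simp
  have "(\<Sum>b<2 * J. S 0 (real (Suc b) * t)) - (\<Sum>b<J. S 0 (real (Suc b) * (2 * t))) =
      (\<Sum>j<J. S 0 ((2 * real j + 1) * t))" for J
  proof (induction J)
    case (Suc J)
    have "2 * Suc J = Suc (Suc (2 * J))" by simp
    hence "(\<Sum>b<2 * Suc J. S 0 (real (Suc b) * t)) =
      (\<Sum>b<2 * J. S 0 (real (Suc b) * t)) + S 0 (real (Suc (2 * J)) * t) + S 0 (real (Suc (Suc (2 * J))) * t)"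
      by (simp only: sum.lessThan_Suc)
    moreover have "real (Suc (2 * J)) * t = (2 * real J + 1) * t" "real (Suc (Suc (2 * J))) * t = real (Suc J) * (2 * t)"
      by (simp_all add: algebra_simps)
    ultimately show ?case using Suc by (simp only: sum.lessThan_Suc)
  qed auto
  with tendsto_diff[OF 1 2] show ?thesis by simp
qed

lemma sum_squares_ge: "real M ^ 3 / 3 \<le> (\<Sum>m\<in>{1..M}. real m ^ 2)"
proof (induction M)
  case (Suc M)
  have "real (Suc M) ^ 3 / 3 \<le> real M ^ 3 / 3 + real (Suc M) ^ 2"
    by (simp add: power2_eq_square power3_eq_cube algebra_simps add_divide_distrib)
  thus ?case using Suc by simp
qed auto

lemma exp_diff_ge:
  assumes u: "0 \<le> u" "u \<le> (1 :: real)"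
  shows "u / 6 \<le> exp (- u) - exp (- 2 * u)"
proof -
  have "exp u \<ge> 1 + u" by (rule exp_ge_add_one_self)
  hence "exp (- u) \<le> 1 / (1 + u)" using u by (simp add: exp_minus field_simps)
  also have "\<dots> \<le> 1 - u / 2"
  proof -
    have "1 \<le> (1 - u / 2) * (1 + u)" using mult_left_mono[OF u(2) u(1)] by (simp add: algebra_simps)
    thus ?thesis using u by (subst pos_divide_le_eq) auto
  qed
  finally have 1: "u / 2 \<le> 1 - exp (- u)" by simp
  have "exp u \<le> 3" using exp_le u by (meson exp_le_cancel_iff order.trans)
  hence 2: "1 / 3 \<le> exp (- u)" by (simp add: exp_minus field_simps)
  have "(1 / 3) * (u / 2) \<le> exp (- u) * (1 - exp (- u))" using 1 2 u by (intro mult_mono) auto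
  also have "\<dots> = exp (- u) - exp (- 2 * u)" by (simp add: algebra_simps flip: exp_add)
  finally show ?thesis by simp
qed

text \<open>Only the squares \<open>m ^ 2\<close> with \<open>m \<le> M\<close> are kept, where
  \<open>conv_one\<close> is at least 1; the choice \<open>t = 1 / M ^ 2\<close> ensures
  \<open>m ^ 2 * t \<le> 1\<close>, the range of \<open>exp_diff_ge\<close>.\<close>

lemma Q_diff_ge:
  assumes M: "M \<ge> 1"
  shows "real M / 18 \<le> Q (1 / real M ^ 2) - Q (2 * (1 / real M ^ 2))"
proof -
  define t where "t = 1 / real M ^ 2"
  have t: "t > 0" using M by (simp add: t_def)
  let ?f = "\<lambda>n. conv_one n * (exp (- real n * t) - exp (- real n * (2 * t)))"
  have t2: "2 * t > 0" using t by simp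
  have "((\<lambda>n. conv_one n * exp (- real n * t) + - (conv_one n * exp (- real n * (2 * t)))) has_sum (Q t + - Q (2 * t))) {0<..}"
    unfolding Q_def
    by (rule has_sum_add[OF has_sum_infsum[OF conv_one_exp_summable[OF t]]
          has_sum_uminusI[OF has_sum_infsum[OF conv_one_exp_summable[OF t2]]]])
  hence "(?f has_sum (Q t - Q (2 * t))) {0<..}" by (simp add: right_diff_distrib)
  hence eq: "Q t - Q (2 * t) = (\<Sum>\<^sub>\<infinity>n\<in>{0<..}. ?f n)" and sm: "?f summable_on {0<..}"
    by (auto simp: has_sum_iff)
  have "real M / 18 = (real M ^ 3 / 3) * t / 6" using M by (simp add: t_def power2_eq_square power3_eq_cube)
  also have "\<dots> \<le> (\<Sum>m\<in>{1..M}. real m ^ 2) * t / 6"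
    using t by (intro divide_right_mono mult_right_mono sum_squares_ge) auto
  also have "\<dots> = (\<Sum>m\<in>{1..M}. (real m ^ 2 * t) / 6)" by (simp add: sum_distrib_right sum_divide_distrib)
  also have "\<dots> \<le> (\<Sum>m\<in>{1..M}. ?f (m ^ 2))"
  proof (intro sum_mono)
    fix m assume m: "m \<in> {1..M}"
    have "real m ^ 2 \<le> real M ^ 2" using m by (intro power_mono) auto
    hence "real m ^ 2 * t \<le> 1" using M by (simp add: t_def)
    hence 1: "real m ^ 2 * t / 6 \<le> exp (- (real m ^ 2 * t)) - exp (- 2 * (real m ^ 2 * t))"
      using t by (intro exp_diff_ge) auto
    also have "\<dots> \<le> conv_one (m ^ 2) * (exp (- (real m ^ 2 * t)) - exp (- 2 * (real m ^ 2 * t)))"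
      using conv_one_square[of m] m t order.trans[OF _ 1, of 0]
      by (subst mult_le_cancel_right1) auto
    finally show "real m ^ 2 * t / 6 \<le> ?f (m ^ 2)" by (simp add: mult_ac)
  qed
  also have "\<dots> = sum ?f ((\<lambda>m. m ^ 2) ` {1..M})"
    by (subst sum.reindex) (auto simp: inj_on_def)
  also have "\<dots> \<le> (\<Sum>\<^sub>\<infinity>n\<in>{0<..}. ?f n)"
  proof (intro finite_sum_le_infsum sm)
    fix n assume "n \<in> {0<..} - (\<lambda>m. m ^ 2) ` {1..M}"
    hence n: "n > 0" by auto
    have "real n * t \<le> real n * (2 * t)" using t by simp
    thus "0 \<le> ?f n" using t n by (intro mult_nonneg_nonneg conv_one_nonneg) auto
  qed auto
  finally show ?thesis using eq by (simp add: t_def)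
qed

lemma H_tendsto_0: "t > 0 \<Longrightarrow> (\<lambda>J. H (2 * real J * t)) \<longlonglongrightarrow> 0"
proof -
  assume t: "t > 0"
  define K where "K = (\<Sum>n. 1 / real n ^ 2)"
  have sK: "summable (\<lambda>n. 1 / real n ^ 2)" using inverse_power_summable[of 2, where ?'a = real] by (simp add: inverse_eq_divide)
  have "\<bar>H v\<bar> \<le> K / v" if v: "v > 0" for v
  proof -
    have "\<bar>H v\<bar> \<le> (\<Sum>n. 1 / real n ^ 2 * (1 / v))"
      unfolding H_def real_norm_def [symmetric]
    proof (rule norm_suminf_le[OF _ summable_mult2[OF sK]])
      fix n
      show "norm (\<eta> n / real n * exp (- real n * v)) \<le> 1 / real n ^ 2 * (1 / v)"
      proof (cases "n = 0")
        case False
        have "real n * v \<le> exp (real n * v)" using exp_ge_add_one_self[of "real n * v"] by linarith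
        hence "exp (- real n * v) \<le> 1 / (real n * v)" using v False by (simp add: exp_minus field_simps)
        moreover have "\<bar>\<eta> n / real n\<bar> \<le> 1 / real n" using abs_eta_le[of n] by (simp add: divide_right_mono)
        ultimately have "\<bar>\<eta> n / real n\<bar> * exp (- real n * v) \<le> (1 / real n) * (1 / (real n * v))"
          by (intro mult_mono) auto
        thus ?thesis by (simp add: abs_mult power2_eq_square)
      qed auto
    qed
    also have "\<dots> = K / v" unfolding K_def by (subst suminf_mult2[OF sK, symmetric]) simp
    finally show ?thesis .
  qed
  hence bound: "norm (H (2 * real J * t)) \<le> K / (2 * real J * t)" if "J \<ge> 1" for J using t that by simp
  show ?thesis
  proof (rule Lim_null_comparison)
    show "\<forall>\<^sub>F J in sequentially. norm (H (2 * real J * t)) \<le> K / (2 * real J * t)"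
      by (rule eventually_sequentiallyI[of 1]) (rule bound)
    show "(\<lambda>J. K / (2 * real J * t)) \<longlonglongrightarrow> 0" using t by real_asymp
  qed
qed

text \<open>The limit of \<open>midpoint_sum\<close> as \<open>J\<close> tends to infinity, where
  \<open>H (2 * J * t)\<close> tends to 0.\<close>

lemma H_near_0:
  assumes t: "t > 0" and \<tau>: "0 < \<tau>" "\<tau> < t"
  shows "\<bar>H \<tau> - 2 * t * (Q t - Q (2 * t))\<bar>
    \<le> \<tau> * (3 * real d + 4 * real d ^ 2 * t) + 4 * (real d * t) ^ 3 + 8 * (real d * t) ^ 2"
proof (rule tendsto_upperbound)
  show "(\<lambda>J. \<bar>H \<tau> - H (2 * real J * t) - 2 * t * (\<Sum>j<J. S 0 ((2 * real j + 1) * t))\<bar>) \<longlonglongrightarrow>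
      \<bar>H \<tau> - 2 * t * (Q t - Q (2 * t))\<bar>"
    using tendsto_rabs[OF tendsto_diff[OF tendsto_diff[OF tendsto_const H_tendsto_0[OF t]] tendsto_mult[OF tendsto_const odd_sum_limit[OF t]]]]
    by simp
qed (use midpoint_sum[OF t \<tau>] in \<open>auto intro: eventually_sequentiallyI[of 1]\<close>)

definition L :: "real \<Rightarrow> complex" where
  "L \<delta> = lcoeff \<delta> (\<lambda>n. complex_of_real (\<eta> n)) 0"

text \<open>Both quantities are compared term by term with the series of
  \<open>\<eta> n / n\<close>: \<open>w1\<close> is the change to
  \<open>n powr (- 1 - \<delta>)\<close> and \<open>w2\<close> the change to the exponential cutoff.
  Both weights are eventually decreasing, so \<open>oscillating_antimono_bound\<close> applies to
  all partial sums, and the L-value at 1 itself never has to be formed.\<close>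

lemma H_vs_lcoeff:
  assumes \<delta>: "\<delta> > 0" and \<tau>: "\<tau> > 0"
  shows "\<bar>H \<tau> - Re (L \<delta>)\<bar> \<le> 2 * real d * \<tau> + \<delta> * (ln d * (2 + ln d))"
proof -
  have lnd: "ln (real d) \<ge> 0" using d3 by auto
  define w1 where "w1 = (\<lambda>n::nat. 1 / real n - real n powr (- 1 - \<delta>))"
  define w2 where "w2 = (\<lambda>n::nat. (1 - exp (- real n * \<tau>)) / real n)"
  have w1_eq: "w1 n = exp (- ln n) - exp (- (1 + \<delta>) * ln n)" if "n > 0" for n
    using that by (simp add: w1_def powr_def exp_minus inverse_eq_divide algebra_simps)
  have w1_nonneg: "w1 n \<ge> 0" for n
  proof (cases "n = 0")
    case False
    have "real n powr (- 1 - \<delta>) \<le> real n powr (- 1)" using False \<delta> by (intro powr_mono) auto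
    thus ?thesis using False by (simp add: w1_def powr_minus_divide)
  qed (simp add: w1_def)
  have w1_le: "w1 n \<le> \<delta> * ln d * (1 / real n)" if "n \<le> d" for n
  proof (cases "n = 0")
    case False
    have "1 - \<delta> * ln n \<le> exp (- \<delta> * ln n)" using exp_ge_add_one_self[of "- \<delta> * ln n"] by simp
    hence "(1 - exp (- \<delta> * ln n)) * (1 / real n) \<le> \<delta> * ln n * (1 / real n)"
      by (intro mult_right_mono) auto
    also have "\<dots> \<le> \<delta> * ln d * (1 / real n)"
      using that False \<delta> by (intro mult_right_mono mult_left_mono) auto
    also have "(1 - exp (- \<delta> * ln n)) * (1 / real n) = w1 n"
      using False by (simp add: w1_def powr_diff powr_minus_divide powr_def[of _ \<delta>] exp_minus field_simps)
    finally show ?thesis .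
  qed (simp add: w1_def)
  \<comment> \<open>In \<open>u = ln n\<close> the derivative is nonpositive once
    \<open>1 + \<delta> \<le> exp (\<delta> * u)\<close>, which holds for \<open>u \<ge> 1\<close>,
    hence for \<open>n \<ge> 3\<close>.\<close>
  have w1_mono: "w1 (Suc n) \<le> w1 n" if n: "n \<ge> 3" for n
  proof -
    have "exp 1 \<le> real n" using exp_le n by linarith
    hence ln1: "1 \<le> ln (real n)" using n by (subst ln_ge_iff) auto
    have "(\<lambda>u. exp (- u) - exp (- (1 + \<delta>) * u)) (ln (Suc n)) \<le> (\<lambda>u. exp (- u) - exp (- (1 + \<delta>) * u)) (ln n)"
    proof (rule DERIV_nonpos_imp_nonincreasing[where f = "\<lambda>u. exp (- u) - exp (- (1 + \<delta>) * u)"])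
      fix u assume u: "ln (real n) \<le> u"
      have "1 + \<delta> \<le> exp (\<delta> * 1)" using exp_ge_add_one_self[of \<delta>] by simp
      also have "\<dots> \<le> exp (\<delta> * u)" using u ln1 \<delta> by simp
      finally have "(1 + \<delta>) * exp (- (1 + \<delta>) * u) \<le> exp (\<delta> * u) * exp (- (1 + \<delta>) * u)"
        by (intro mult_right_mono) auto
      also have "\<dots> = exp (- u)" by (simp add: algebra_simps flip: exp_add)
      finally have "- exp (- u) + (1 + \<delta>) * exp (- (1 + \<delta>) * u) \<le> 0" by simp
      moreover have "((\<lambda>u. exp (- u) - exp (- (1 + \<delta>) * u)) has_real_derivative - exp (- u) + (1 + \<delta>) * exp (- (1 + \<delta>) * u)) (at u)"
        by (auto intro!: derivative_eq_intros simp: algebra_simps)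
      ultimately show "\<exists>y. ((\<lambda>u. exp (- u) - exp (- (1 + \<delta>) * u)) has_real_derivative y) (at u) \<and> y \<le> 0" by blast
    qed (use n in auto)
    thus ?thesis using w1_eq[of n] w1_eq[of "Suc n"] n by simp
  qed
  have w2_nonneg: "w2 n \<ge> 0" for n using \<tau> by (simp add: w2_def)
  have w2_le: "w2 n \<le> \<tau>" for n
  proof (cases "n = 0")
    case False
    have "1 - exp (- real n * \<tau>) \<le> real n * \<tau>" using exp_ge_add_one_self[of "- real n * \<tau>"] by simp
    thus ?thesis using False by (simp add: w2_def divide_le_eq mult.commute)
  qed (use \<tau> in \<open>simp add: w2_def\<close>)
  have w2_mono: "w2 (Suc n) \<le> w2 n" if n: "n \<ge> 1" for n
  proof -
    define z where "z = exp (- \<tau>)"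
    have z: "0 \<le> z" "z \<le> 1" using \<tau> by (auto simp: z_def)
    have e: "exp (- real n * \<tau>) = z ^ n" for n by (simp add: z_def exp_of_nat_mult [symmetric])
    \<comment> \<open>For \<open>n \<ge> 1\<close> this rearranges to the statement that
      \<open>(1 - z ^ n) / n\<close> does not increase.\<close>
    have A: "(real n + 1) * z ^ n - real n * z ^ Suc n \<le> 1" for n
    proof (induction n)
      case (Suc n)
      have "(real (Suc n) + 1) * z ^ Suc n - real (Suc n) * z ^ Suc (Suc n) =
          z * ((real n + 1) * z ^ n - real n * z ^ Suc n) + z ^ Suc n * (1 - z)" by (simp add: algebra_simps)
      also have "\<dots> \<le> z * 1 + 1 * (1 - z)"
        using Suc z by (intro add_mono mult_left_mono mult_right_mono power_le_one) auto
      finally show ?case by simp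
    qed auto
    have "real n * (1 - z ^ Suc n) \<le> (real n + 1) * (1 - z ^ n)" using A[of n] by (simp add: algebra_simps)
    thus ?thesis using n unfolding w2_def e by (simp add: divide_simps mult.commute add.commute)
  qed
  have b1: "\<bar>\<Sum>n<N. \<eta> n * w1 n\<bar> \<le> \<delta> * (ln d * (2 + ln d))" for N
  proof -
    have "\<bar>\<Sum>n<N. \<eta> n * w1 n\<bar> = norm (\<Sum>n<N. complex_of_real (\<eta> n) * of_real (w1 n))"
      by (simp flip: of_real_mult of_real_sum)
    also have "\<dots> \<le> (\<Sum>n<d. \<bar>w1 n\<bar>) + d * w1 d"
      using d3 by (intro oscillating_antimono_bound osc conjI w1_nonneg w1_mono) auto
    also have "(\<Sum>n<d. \<bar>w1 n\<bar>) \<le> (\<Sum>n<d. \<delta> * ln d * (1 / real n))"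
      using w1_nonneg w1_le by (intro sum_mono) auto
    also have "\<dots> = \<delta> * ln d * (\<Sum>n<d. 1 / real n)" by (simp only: sum_distrib_left)
    also have "\<dots> \<le> \<delta> * ln d * (1 + ln d)" using \<delta> lnd d3 by (intro mult_left_mono sum_inverse_le) auto
    also have "d * w1 d \<le> d * (\<delta> * ln d * (1 / real d))" by (intro mult_left_mono w1_le) auto
    also have "\<dots> = \<delta> * ln d" using d3 by simp
    finally show ?thesis by (simp add: algebra_simps)
  qed
  have b2: "\<bar>\<Sum>n<N. \<eta> n * w2 n\<bar> \<le> 2 * real d * \<tau>" for N
  proof -
    have "\<bar>\<Sum>n<N. \<eta> n * w2 n\<bar> = norm (\<Sum>n<N. complex_of_real (\<eta> n) * of_real (w2 n))"
      by (simp flip: of_real_mult of_real_sum)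
    also have "\<dots> \<le> (\<Sum>n<d. \<bar>w2 n\<bar>) + d * w2 d"
      using d3 by (intro oscillating_antimono_bound osc conjI w2_nonneg w2_mono) auto
    also have "\<dots> \<le> (\<Sum>n<d. \<tau>) + d * \<tau>"
      using w2_nonneg w2_le by (intro add_mono sum_mono mult_left_mono) auto
    finally show ?thesis by (simp add: mult_ac)
  qed
  have "(\<lambda>n. complex_of_real (\<eta> n) * of_real (lweight \<delta> 0 n)) sums L \<delta>"
    unfolding L_def using abs_eta_le by (intro lcoeff_sums \<delta> norm_le_oneplus_ln) auto
  from sums_Re[OF this] have s1: "(\<lambda>n. \<eta> n * lweight \<delta> 0 n) sums Re (L \<delta>)"
    by simp
  have s2: "(\<lambda>n. \<eta> n / real n * exp (- real n * \<tau>)) sums H \<tau>"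
    unfolding H_def by (intro summable_sums H_summable \<tau>)
  have eq: "\<eta> n / real n * exp (- real n * \<tau>) - \<eta> n * lweight \<delta> 0 n = \<eta> n * w1 n - \<eta> n * w2 n" for n
    by (cases "n = 0") (simp_all add: w1_def w2_def lweight_def field_simps)
  have lim: "(\<lambda>N. \<bar>\<Sum>n<N. \<eta> n * w1 n - \<eta> n * w2 n\<bar>) \<longlonglongrightarrow> \<bar>H \<tau> - Re (L \<delta>)\<bar>"
    using tendsto_rabs[OF sums_diff[OF s2 s1, unfolded eq sums_def]] .
  show ?thesis
  proof (rule tendsto_upperbound[OF lim always_eventually])
    show "\<forall>N. \<bar>\<Sum>n<N. \<eta> n * w1 n - \<eta> n * w2 n\<bar> \<le> 2 * real d * \<tau> + \<delta> * (ln d * (2 + ln d))"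
    proof
      fix N
      show "\<bar>\<Sum>n<N. \<eta> n * w1 n - \<eta> n * w2 n\<bar> \<le> 2 * real d * \<tau> + \<delta> * (ln d * (2 + ln d))"
        using b1[of N] b2[of N] unfolding sum_subtractf by linarith
    qed
  qed auto
qed

text \<open>With \<open>t = 1 / M ^ 2\<close> the main term \<open>2 * t * (M / 18)\<close> is
  \<open>1 / (9 * M)\<close>, and the midpoint errors merge to \<open>12 * (d * t) ^ 2\<close> since
  \<open>d * t \<le> 1\<close>. Both have the same order when \<open>M\<close> is of order d^(2/3).
  The terms containing \<open>\<tau>\<close> disappear as \<open>\<tau>\<close> tends to 0.\<close>

lemma lower_bound:
  assumes \<delta>: "\<delta> > 0" and M: "M \<ge> 1" "d \<le> M ^ 2"
  shows "norm (L \<delta>) \<ge>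
    1 / (9 * real M) - 12 * real d ^ 2 / real M ^ 4 - \<delta> * (ln d * (2 + ln d))"
proof -
  define t where "t = 1 / real M ^ 2"
  have t: "t > 0" using M by (simp add: t_def)
  have dt: "real d * t \<le> 1" using M by (simp add: t_def flip: of_nat_power)
  have dt3: "(real d * t) ^ 3 \<le> (real d * t) ^ 2" using dt t by (intro power_decreasing) auto
  define D where "D = \<delta> * (ln d * (2 + ln d))"
  define C where "C = 5 * real d + 4 * real d ^ 2 * t"
  define v where "v = Re (L \<delta>) + 12 * (real d * t) ^ 2 + D - 1 / (9 * real M)"
  have C: "C > 0" using d3 t by (simp add: C_def add_pos_nonneg)
  have "1 / (9 * real M) = 2 * t * (real M / 18)" using M by (simp add: t_def power2_eq_square)
  also have "\<dots> \<le> 2 * t * (Q t - Q (2 * t))"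
    using Q_diff_ge[OF M(1)] t unfolding t_def by (intro mult_left_mono) auto
  finally have X: "1 / (9 * real M) \<le> 2 * t * (Q t - Q (2 * t))" .
  have key: "- (\<tau> * C) \<le> v" if \<tau>: "0 < \<tau>" "\<tau> < t" for \<tau>
  proof -
    have "\<tau> * C = \<tau> * (3 * real d + 4 * real d ^ 2 * t) + 2 * real d * \<tau>" by (simp add: C_def algebra_simps)
    thus ?thesis
      using H_near_0[OF t \<tau>] H_vs_lcoeff[OF \<delta> \<tau>(1)] X dt3 unfolding v_def D_def [symmetric]
      by linarith
  qed
  have "v \<ge> 0"
  proof (rule ccontr)
    assume "\<not> v \<ge> 0"
    define \<tau> where "\<tau> = min (t / 2) (- v / (2 * C))"
    have "- v / (2 * C) > 0" using C \<open>\<not> v \<ge> 0\<close> by (intro divide_pos_pos) auto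
    hence \<tau>: "0 < \<tau>" "\<tau> < t" using t by (auto simp: \<tau>_def min_def)
    have "\<tau> * C \<le> - v / (2 * C) * C" using C by (intro mult_right_mono) (auto simp: \<tau>_def)
    also have "\<dots> = - v / 2" using C by simp
    finally show False using key[OF \<tau>] \<open>\<not> v \<ge> 0\<close> by simp
  qed
  moreover have "Re (L \<delta>) \<le> norm (L \<delta>)" by (rule complex_Re_le_cmod)
  moreover have "12 * (real d * t) ^ 2 = 12 * real d ^ 2 / real M ^ 4"
    by (simp add: t_def power_divide flip: power_mult)
  ultimately show ?thesis unfolding v_def D_def by linarith
qed

end

lemma real_dchar_lower_bound:
  assumes \<psi>: "\<psi> \<in> dchars d" "\<psi> \<noteq> principal_dchar d" "(\<lambda>n. \<psi> n ^ 2) = principal_dchar d"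
    and d: "d \<ge> 3" and \<delta>: "\<delta> > 0" and M: "M \<ge> 1" "d \<le> M ^ 2"
  shows "norm (lcoeff \<delta> \<psi> 0) \<ge> 1 / (9 * real M) - 12 * real d ^ 2 / real M ^ 4 - \<delta> * (ln d * (2 + ln d))"
proof -
  have vals: "\<psi> n \<in> {-1, 0, 1}" for n
    using fun_cong[OF \<psi>(3), of n] by (auto simp: principal_dchar_def power2_eq_1_iff split: if_splits)
  define \<eta> where "\<eta> = (\<lambda>n. Re (\<psi> n))"
  have eq: "(\<lambda>n. complex_of_real (\<eta> n)) = \<psi>"
  proof
    fix n show "complex_of_real (\<eta> n) = \<psi> n" using vals[of n] by (auto simp: \<eta>_def)
  qed
  interpret real_dchar d \<eta>
  proof
    fix n show "\<eta> n \<in> {-1, 0, 1}" using vals[of n] by (auto simp: \<eta>_def)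
  qed (use d \<psi> eq in auto)
  show ?thesis using lower_bound[OF \<delta> M] by (simp add: L_def eq)
qed

section \<open>Small primes congruent to 1\<close>

lemma sum_dchars_log_derivative:
  assumes d: "d > 1" and \<delta>: "\<delta> > 0"
  shows "(\<lambda>n. real (totient d) * (if [n = 1] (mod d) then mangoldt n * lweight \<delta> k n else 0)) sums
     Re (\<Sum>\<psi>\<in>dchars d. lcoeff \<delta> (\<lambda>n. \<psi> n * mangoldt n) k)"
proof -
  have "(\<lambda>n. \<Sum>\<psi>\<in>dchars d. \<psi> n * mangoldt n * of_real (lweight \<delta> k n)) sums
      (\<Sum>\<psi>\<in>dchars d. lcoeff \<delta> (\<lambda>n. \<psi> n * mangoldt n) k)"
    using d by (intro sums_sum lcoeff_sums \<delta> norm_dchar_mangoldt_le) auto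
  hence *: "(\<lambda>n. Re (\<Sum>\<psi>\<in>dchars d. \<psi> n * mangoldt n * of_real (lweight \<delta> k n))) sums
      Re (\<Sum>\<psi>\<in>dchars d. lcoeff \<delta> (\<lambda>n. \<psi> n * mangoldt n) k)" by (rule sums_Re)
  have eq: "Re (\<Sum>\<psi>\<in>dchars d. \<psi> n * mangoldt n * of_real (lweight \<delta> k n)) =
      real (totient d) * (if [n = 1] (mod d) then mangoldt n * lweight \<delta> k n else 0)" for n
  proof -
    have "(\<Sum>\<psi>\<in>dchars d. \<psi> n) = (if [n = 1] (mod d) then of_nat (totient d) else 0)"
    proof (cases "[n = 1] (mod d)")
      case True
      have "(\<Sum>\<psi>\<in>dchars d. \<psi> n) = (\<Sum>\<psi>\<in>dchars d. 1)"
      proof (intro sum.cong refl)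
        fix \<psi> assume \<psi>: "\<psi> \<in> dchars d"
        show "\<psi> n = 1" using dchar_cong[OF \<psi> True] dchar_1[OF \<psi>] by simp
      qed
      thus ?thesis using card_dchars[OF d] True by simp
    qed (use sum_dchars_eq_0[OF d] in auto)
    hence "(\<Sum>\<psi>\<in>dchars d. \<psi> n * mangoldt n * of_real (lweight \<delta> k n)) =
        (if [n = 1] (mod d) then of_nat (totient d) else 0) * mangoldt n * of_real (lweight \<delta> k n)"
      by (simp only: sum_distrib_right [symmetric])
    also have "\<dots> = of_real (real (totient d) * (if [n = 1] (mod d) then mangoldt n * lweight \<delta> k n else 0))"
      by simp
    finally show ?thesis by (simp only: Re_complex_of_real)
  qed
  show ?thesis using * unfolding eq .
qed

text \<open>Take \<open>a = p ^ (j div 2)\<close> for \<open>n = p ^ j\<close>. Each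
  \<open>a\<close> thus accounts for at most two proper prime powers, both at least
  \<open>a ^ 2\<close>.\<close>

lemma proper_primepow_cases:
  fixes n :: nat
  assumes "primepow n" "\<not> prime n"
  obtains a where "primepow a" "a < n" "n = a ^ 2 \<or> n = a ^ 2 * aprimedivisor a"
proof -
  obtain p j where p: "prime p" "j > 0" "n = p ^ j" using assms by (auto simp: primepow_def)
  have p1: "p > 1" using p prime_gt_1_nat by blast
  have j: "j \<noteq> 1" using assms p by auto
  define i where "i = j div 2"
  have i: "i > 0" "i < j" using j p by (auto simp: i_def)
  have a: "primepow (p ^ i)" using p i by auto
  have "p ^ i < n" using p1 i p by (simp add: power_strict_increasing)
  moreover have "n = (p ^ i) ^ 2 \<or> n = (p ^ i) ^ 2 * aprimedivisor (p ^ i)"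
  proof (cases "even j")
    case True
    hence "j = i * 2" by (auto simp: i_def)
    thus ?thesis using p by (simp add: power_mult)
  next
    case False
    hence "j = i * 2 + 1" by (auto simp: i_def elim!: oddE)
    thus ?thesis using p i by (simp add: power_mult aprimedivisor_prime_power)
  qed
  ultimately show ?thesis using that a by blast
qed

text \<open>The weight at \<open>m \<ge> a ^ 2\<close> is at most
  \<open>4 ^ k * m powr (- 3 / 4)\<close>, hence \<open>4 ^ k * a powr (- 3 / 2)\<close>; a factor
  \<open>a powr (1 / 4)\<close> pays for the logarithm and leaves the convergent exponent -5/4. For
  small \<open>\<delta>\<close> the \<open>4 ^ k\<close> is harmless against
  \<open>(1 / \<delta>) ^ (k + 1)\<close>.\<close>

lemma proper_primepow_sum_le:
  assumes \<delta>: "\<delta> > 0"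
  shows "(\<Sum>n | n < N \<and> primepow n \<and> \<not> prime n. mangoldt n * lweight \<delta> k n)
    \<le> 8 * 4 ^ k * (\<Sum>a. real a powr (- 5 / 4))"
proof -
  let ?f = "\<lambda>n. mangoldt n * lweight \<delta> k n"
  define I where "I = {a. a < N \<and> primepow a}"
  define g where "g = (\<lambda>a::nat. a ^ 2 * aprimedivisor a)"
  have fin: "finite I" by (simp add: I_def)
  have f0: "?f n \<ge> 0" for n by (intro mult_nonneg_nonneg mangoldt_nonneg lweight_nonneg)
  have summ: "summable (\<lambda>a. real a powr (- 5 / 4))" by (subst summable_real_powr_iff) simp
  have f: "?f m \<le> 4 ^ (k + 1) * real a powr (- 5 / 4)"
    if a: "primepow a" and m: "m \<ge> a ^ 2" "mangoldt m = (mangoldt a :: real)" for a m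
  proof -
    have a1: "a \<ge> 1" using primepow_gt_Suc_0[OF a] by simp
    have "lweight \<delta> k m \<le> (1 / (1 + \<delta> - 3 / 4)) ^ k * real m powr - (3 / 4)"
      using \<delta> by (intro lweight_le_powr) auto
    also have "\<dots> \<le> 4 ^ k * real (a ^ 2) powr - (3 / 4)"
      using \<delta> m a1 by (intro mult_mono power_mono powr_mono2') (auto simp: field_simps simp flip: of_nat_power)
    also have "real (a ^ 2) powr - (3 / 4) = real a powr (- 3 / 2)"
      using a1 by (simp add: powr_powr flip: powr_numeral)
    finally have 1: "lweight \<delta> k m \<le> 4 ^ k * real a powr (- 3 / 2)" .
    have "mangoldt m \<le> ln (real a)" using m mangoldt_le[of a] a1 by simp
    also have "\<dots> \<le> real a powr (1 / 4) / (1 / 4)" using a1 by (intro ln_powr_bound) auto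
    finally have "?f m \<le> (real a powr (1 / 4) / (1 / 4)) * (4 ^ k * real a powr (- 3 / 2))"
      using 1 by (intro mult_mono lweight_nonneg) auto
    also have "\<dots> = 4 ^ (k + 1) * (real a powr (1 / 4) * real a powr (- 3 / 2))" by simp
    also have "real a powr (1 / 4) * real a powr (- 3 / 2) = real a powr (- 5 / 4)"
      by (simp flip: powr_add)
    finally show ?thesis .
  qed
  have "(\<Sum>n | n < N \<and> primepow n \<and> \<not> prime n. ?f n) \<le> (\<Sum>n\<in>(\<lambda>a. a ^ 2) ` I \<union> g ` I. ?f n)"
  proof (intro sum_mono2 f0)
    show "{n. n < N \<and> primepow n \<and> \<not> prime n} \<subseteq> (\<lambda>a. a ^ 2) ` I \<union> g ` I"
    proof
      fix n assume n: "n \<in> {n. n < N \<and> primepow n \<and> \<not> prime n}"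
      then obtain a where "primepow a" "a < n" "n = a ^ 2 \<or> n = a ^ 2 * aprimedivisor a"
        using proper_primepow_cases[of n] by blast
      thus "n \<in> (\<lambda>a. a ^ 2) ` I \<union> g ` I" using n by (auto simp: I_def g_def)
    qed
  qed (use fin in auto)
  also have "\<dots> \<le> (\<Sum>n\<in>(\<lambda>a. a ^ 2) ` I. ?f n) + (\<Sum>n\<in>g ` I. ?f n)"
    using sum.union_inter[of "(\<lambda>a. a ^ 2) ` I" "g ` I" ?f] fin sum_nonneg[of "(\<lambda>a. a ^ 2) ` I \<inter> g ` I" ?f] f0 by simp
  also have "\<dots> \<le> (\<Sum>a\<in>I. ?f (a ^ 2)) + (\<Sum>a\<in>I. ?f (g a))"
    using fin f0 sum_image_le[of I ?f "\<lambda>a. a ^ 2"] sum_image_le[of I ?f g] by (simp add: o_def)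
  also have "\<dots> \<le> (\<Sum>a\<in>I. 4 ^ (k + 1) * real a powr (- 5 / 4)) + (\<Sum>a\<in>I. 4 ^ (k + 1) * real a powr (- 5 / 4))"
  proof (intro add_mono sum_mono f)
    fix a assume a: "a \<in> I"
    then obtain p i where p: "prime p" "i > 0" "a = p ^ i" by (auto simp: primepow_def I_def)
    show "primepow a" "primepow a" using a by (auto simp: I_def)
    show "mangoldt (a ^ 2) = (mangoldt a :: real)" using p by (simp flip: power_mult)
    have "g a = p ^ (i * 2 + 1)" using p by (simp add: g_def aprimedivisor_prime_power power_mult)
    thus "mangoldt (g a) = (mangoldt a :: real)" using p by (simp del: power_Suc add: mangoldt_primepow')
    show "a ^ 2 \<le> g a" using p prime_gt_0_nat[of p] by (simp add: g_def aprimedivisor_prime_power)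
  qed auto
  also have "\<dots> = 8 * 4 ^ k * (\<Sum>a\<in>I. real a powr (- 5 / 4))" by (simp add: sum_distrib_left mult.assoc)
  also have "\<dots> \<le> 8 * 4 ^ k * (\<Sum>a. real a powr (- 5 / 4))"
    using fin summ by (intro mult_left_mono sum_le_suminf) auto
  finally show ?thesis .
qed

text \<open>The exponent \<open>\<delta>\<close> is split: a half bounds the power of the logarithm,
  a quarter gives the decay in \<open>x\<close>, and the last quarter keeps the sum convergent, with
  total at most \<open>4 / \<delta> + 2\<close>.\<close>

lemma lweight_tail_le:
  assumes \<delta>: "\<delta> > 0" and x: "x \<ge> 1"
  shows "(\<Sum>n | n < N \<and> real n > x. ln (real n) * lweight \<delta> k n)
    \<le> real (k + 1) * (2 / \<delta>) ^ (k + 1) * x powr - (\<delta> / 4) * (4 / \<delta> + 2)"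
proof -
  have "(\<Sum>n | n < N \<and> real n > x. ln (real n) * lweight \<delta> k n) \<le>
      (\<Sum>n | n < N \<and> real n > x. real (k + 1) * (2 / \<delta>) ^ (k + 1) * x powr - (\<delta> / 4) * lweight (\<delta> / 4) 0 n)"
  proof (intro sum_mono)
    fix n assume "n \<in> {n. n < N \<and> real n > x}"
    hence n: "real n > x" "n > 0" using x by auto
    have "lweight \<delta> (k + 1) n \<le> (1 / (1 + \<delta> - (1 + \<delta> / 2))) ^ (k + 1) * real n powr - (1 + \<delta> / 2)"
      using \<delta> by (intro lweight_le_powr) auto
    also have "1 / (1 + \<delta> - (1 + \<delta> / 2)) = 2 / \<delta>" by simp
    also have "real n powr - (1 + \<delta> / 2) = real n powr - (\<delta> / 4) * lweight (\<delta> / 4) 0 n"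
      using n by (simp add: lweight_def algebra_simps flip: powr_add)
    also have "(2 / \<delta>) ^ (k + 1) * (real n powr - (\<delta> / 4) * lweight (\<delta> / 4) 0 n) \<le>
        (2 / \<delta>) ^ (k + 1) * (x powr - (\<delta> / 4) * lweight (\<delta> / 4) 0 n)"
      using n x \<delta> by (intro mult_left_mono mult_right_mono powr_mono2' lweight_nonneg) auto
    finally have "real (k + 1) * lweight \<delta> (k + 1) n \<le>
        real (k + 1) * ((2 / \<delta>) ^ (k + 1) * (x powr - (\<delta> / 4) * lweight (\<delta> / 4) 0 n))"
      by (rule mult_left_mono) simp
    thus "ln (real n) * lweight \<delta> k n \<le> real (k + 1) * (2 / \<delta>) ^ (k + 1) * x powr - (\<delta> / 4) * lweight (\<delta> / 4) 0 n"
      unfolding ln_times_lweight by (simp only: mult.assoc)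
  qed
  also have "\<dots> = real (k + 1) * (2 / \<delta>) ^ (k + 1) * x powr - (\<delta> / 4) * (\<Sum>n | n < N \<and> real n > x. lweight (\<delta> / 4) 0 n)"
    by (simp only: sum_distrib_left)
  also have "\<dots> \<le> real (k + 1) * (2 / \<delta>) ^ (k + 1) * x powr - (\<delta> / 4) * (4 / \<delta> + 2)"
  proof (intro mult_left_mono)
    have "(\<Sum>n | n < N \<and> real n > x. lweight (\<delta> / 4) 0 n) \<le> (\<Sum>n<N. lweight (\<delta> / 4) 0 n)"
      by (intro sum_mono2 lweight_nonneg) auto
    also have "\<dots> \<le> 1 / (\<delta> / 4) + 2" using \<delta> by (intro sum_lweight_0_le) auto
    finally show "(\<Sum>n | n < N \<and> real n > x. lweight (\<delta> / 4) 0 n) \<le> 4 / \<delta> + 2" by simp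
  qed (use \<delta> in auto)
  finally show ?thesis .
qed

text \<open>By orthogonality the sum over characters is \<open>totient d\<close> times a nonnegative
  sum over prime powers congruent to 1. Without a prime up to \<open>x\<close>, only proper prime
  powers and the tail beyond \<open>x\<close> can contribute, and by \<open>ineq\<close> they are
  too small for the main term of the principal character.\<close>

lemma prime_cong_1_exists_criterion:
  fixes B x \<delta> :: real
  assumes d: "d > 1" and \<delta>: "\<delta> > 0" and x: "x \<ge> 1"
    and B: "\<And>\<psi>. \<psi> \<in> dchars d \<Longrightarrow>
      norm (lcoeff \<delta> (\<lambda>n. \<psi> n * mangoldt n) k - (if \<psi> = principal_dchar d then of_real ((1 / \<delta>) ^ (k + 1)) else 0)) * (2 * \<delta>) ^ k \<le> B"
    and ineq: "real d * B / (2 * \<delta>) ^ k + real d * (8 * 4 ^ k * (\<Sum>a. real a powr (- 5 / 4))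
       + real (k + 1) * (2 / \<delta>) ^ (k + 1) * x powr - (\<delta> / 4) * (4 / \<delta> + 2)) < (1 / \<delta>) ^ (k + 1)"
  shows "\<exists>p. prime p \<and> [p = 1] (mod d) \<and> real p \<le> x"
proof (rule ccontr)
  assume none: "\<nexists>p. prime p \<and> [p = 1] (mod d) \<and> real p \<le> x"
  let ?D = "\<lambda>\<psi>. lcoeff \<delta> (\<lambda>n. \<psi> n * mangoldt n) k"
  let ?m = "\<lambda>\<psi>. if \<psi> = principal_dchar d then complex_of_real ((1 / \<delta>) ^ (k + 1)) else 0"
  define U where "U = 8 * 4 ^ k * (\<Sum>a. real a powr (- 5 / 4)) + real (k + 1) * (2 / \<delta>) ^ (k + 1) * x powr - (\<delta> / 4) * (4 / \<delta> + 2)"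
  have fin: "finite (dchars d)" using d by (intro finite_dchars) auto
  have card: "card (dchars d) \<le> d" using card_dchars[OF d] totient_le[of d] by simp
  have "0 \<le> B" using order.trans[OF _ B[OF principal_in_dchars], of 0] \<delta> by simp
  have "norm ((\<Sum>\<psi>\<in>dchars d. ?D \<psi>) - of_real ((1 / \<delta>) ^ (k + 1))) = norm (\<Sum>\<psi>\<in>dchars d. ?D \<psi> - ?m \<psi>)"
    using fin principal_in_dchars[of d] by (simp add: sum_subtractf)
  also have "\<dots> \<le> (\<Sum>\<psi>\<in>dchars d. B / (2 * \<delta>) ^ k)"
    using B \<delta> by (intro sum_norm_le) (simp add: pos_le_divide_eq)
  also have "\<dots> \<le> real d * (B / (2 * \<delta>) ^ k)"
    using card \<open>0 \<le> B\<close> \<delta> by (simp add: mult_right_mono divide_right_mono)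
  finally have lower: "(1 / \<delta>) ^ (k + 1) - real d * B / (2 * \<delta>) ^ k \<le> Re (\<Sum>\<psi>\<in>dchars d. ?D \<psi>)"
    using abs_Re_le_cmod[of "(\<Sum>\<psi>\<in>dchars d. ?D \<psi>) - of_real ((1 / \<delta>) ^ (k + 1))"] by simp
  have part: "(\<Sum>n<N. real (totient d) * (if [n = 1] (mod d) then mangoldt n * lweight \<delta> k n else 0)) \<le> real d * U" for N
  proof -
    let ?f = "\<lambda>n. mangoldt n * lweight \<delta> k n"
    have "(\<Sum>n<N. if [n = 1] (mod d) then ?f n else 0) \<le>
        (\<Sum>n<N. (if primepow n \<and> \<not> prime n then ?f n else 0) + (if real n > x then ln n * lweight \<delta> k n else 0))"
    proof (intro sum_mono)
      fix n
      have f0: "?f n \<ge> 0" by (intro mult_nonneg_nonneg mangoldt_nonneg lweight_nonneg)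
      show "(if [n = 1] (mod d) then ?f n else 0) \<le>
          (if primepow n \<and> \<not> prime n then ?f n else 0) + (if real n > x then ln n * lweight \<delta> k n else 0)"
      proof (cases "real n > x")
        case True
        hence "?f n \<le> ln n * lweight \<delta> k n"
          using x by (intro mult_right_mono mangoldt_le lweight_nonneg) auto
        thus ?thesis using True f0 by auto
      next
        case False
        thus ?thesis using none f0 by (auto simp: mangoldt_def)
      qed
    qed
    also have "\<dots> = (\<Sum>n | n < N \<and> primepow n \<and> \<not> prime n. ?f n) + (\<Sum>n | n < N \<and> real n > x. ln n * lweight \<delta> k n)"
      by (simp add: sum.distrib sum.If_cases Int_def)
    also have "\<dots> \<le> U" unfolding U_def
      by (intro add_mono proper_primepow_sum_le lweight_tail_le \<delta> x)
    finally have S: "(\<Sum>n<N. if [n = 1] (mod d) then ?f n else 0) \<le> U" .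
    have "U \<ge> 0" unfolding U_def using \<delta> by (intro add_nonneg_nonneg mult_nonneg_nonneg suminf_nonneg) (auto simp: summable_real_powr_iff)
    hence "real (totient d) * (\<Sum>n<N. if [n = 1] (mod d) then ?f n else 0) \<le> real d * U"
      using S totient_le[of d] by (intro order.trans[OF mult_left_mono mult_right_mono]) auto
    thus ?thesis by (simp only: sum_distrib_left)
  qed
  have "Re (\<Sum>\<psi>\<in>dchars d. ?D \<psi>) \<le> real d * U"
    by (rule LIMSEQ_le_const2[OF sum_dchars_log_derivative[OF d \<delta>, unfolded sums_def]]) (use part in blast)
  thus False using lower ineq unfolding U_def by linarith
qed

text \<open>The extreme case is \<open>{2..w + 1}\<close>, where the product telescopes to
  \<open>1 / (w + 1)\<close>; in general the largest of \<open>w\<close> such numbers is at least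
  \<open>w + 1\<close>.\<close>

lemma prod_one_minus_inverse_ge:
  fixes A :: "nat set"
  assumes "finite A" "\<And>a. a \<in> A \<Longrightarrow> a \<ge> 2"
  shows "(\<Prod>a\<in>A. 1 - 1 / real a) \<ge> 1 / (real (card A) + 1)"
  using assms
proof (induction A rule: finite_linorder_max_induct)
  case (insert b A)
  have "A \<subseteq> {2..<b}" using insert by auto
  hence "card A \<le> card {2..<b}" by (intro card_mono) auto
  moreover have "b \<ge> 2" using insert by auto
  ultimately have b: "real b \<ge> real (card A) + 2" by simp
  hence "1 / real b \<le> 1 / (real (card A) + 2)" by (intro divide_left_mono mult_pos_pos) auto
  hence "1 - 1 / real b \<ge> (real (card A) + 1) / (real (card A) + 2)" by (simp add: field_simps)
  moreover have "b \<notin> A" using insert by auto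
  moreover have "(\<Prod>a\<in>A. 1 - 1 / real a) \<ge> 1 / (real (card A) + 1)" using insert by auto
  ultimately have "(1 - 1 / real b) * (\<Prod>a\<in>A. 1 - 1 / real a) \<ge> ((real (card A) + 1) / (real (card A) + 2)) * (1 / (real (card A) + 1))"
    using b by (intro mult_mono) auto
  also have "(1 - 1 / real b) * (\<Prod>a\<in>A. 1 - 1 / real a) = (\<Prod>a\<in>insert b A. 1 - 1 / real a)"
    using insert.hyps(1) \<open>b \<notin> A\<close> by simp
  finally have "(\<Prod>a\<in>insert b A. 1 - 1 / real a) \<ge> ((real (card A) + 1) / (real (card A) + 2)) * (1 / (real (card A) + 1))" .
  thus ?case using insert.hyps(1) \<open>b \<notin> A\<close> by (simp add: add.commute)
qed auto

text \<open>The number of prime factors of \<open>d\<close> is at most its binary logarithm, so the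
  product of \<open>1 - 1 / p\<close> over them is at least of order 1 / ln d.\<close>

lemma totient_lower_bound:
  assumes d: "d > 0"
  shows "real (totient d) \<ge> real d * (1 / (2 + 2 * ln (real d)))"
proof -
  define w where "w = card (prime_factors d)"
  have "2 ^ w = (\<Prod>p\<in>prime_factors d. 2 :: nat)" by (simp add: w_def)
  also have "\<dots> \<le> (\<Prod>p\<in>prime_factors d. p ^ multiplicity p d)"
  proof (intro prod_mono conjI)
    fix p assume "p \<in> prime_factors d"
    hence p: "prime p" "p dvd d" by auto
    hence "multiplicity p d \<ge> 1" using d by (simp add: Suc_le_eq prime_multiplicity_gt_zero_iff)
    hence "p ^ 1 \<le> p ^ multiplicity p d" using prime_gt_0_nat[OF p(1)] by (intro power_increasing) auto
    thus "2 \<le> p ^ multiplicity p d" using prime_ge_2_nat[OF p(1)] by simp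
  qed auto
  also have "\<dots> = d" using d by (subst prime_factorization_nat [symmetric]) auto
  finally have "2 ^ w \<le> d" .
  hence "real (2 ^ w) \<le> real d" by (simp only: of_nat_le_iff)
  hence "ln (real (2 ^ w)) \<le> ln (real d)" using d by (subst ln_le_cancel_iff) auto
  hence "real w * ln 2 \<le> ln (real d)" by (simp add: ln_realpow)
  moreover have "real w * (2 / 3) \<le> real w * ln 2" using ln2_ge_two_thirds by (intro mult_left_mono) auto
  moreover have "ln (real d) \<ge> 0" using d by simp
  ultimately have w: "real w + 1 \<le> 2 + 2 * ln (real d)" by linarith
  have "real d * (1 / (2 + 2 * ln (real d))) \<le> real d * (1 / (real w + 1))"
    using w by (intro mult_left_mono divide_left_mono mult_pos_pos) auto
  also have "\<dots> \<le> real d * (\<Prod>p\<in>prime_factors d. 1 - 1 / real p)"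
    unfolding w_def by (intro mult_left_mono prod_one_minus_inverse_ge) (auto intro: prime_ge_2_nat)
  also have "\<dots> = real (totient d)" by (rule totient_formula2 [symmetric])
  finally show ?thesis .
qed

section \<open>Choice of the parameters\<close>

lemma prime_cong_1_exists_exp:
  "\<forall>\<^sub>F d in sequentially. \<exists>p. prime p \<and> [p = 1] (mod d) \<and> real p \<le> exp (real d powr (19 / 20))"
proof -
  define K where "K = (\<Sum>a. real a powr (- 5 / 4))"
  have "(\<Sum>a\<in>{1}. real a powr (- 5 / 4)) \<le> K"
    unfolding K_def by (intro sum_le_suminf) (auto simp: summable_real_powr_iff)
  hence K: "K > 0" by simp
  let ?\<delta> = "\<lambda>d. real d powr (- 9 / 10)" and ?l = "\<lambda>d. real d powr (- 7 / 10)"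
    and ?m = "\<lambda>d. 10 * real d powr (2 / 3)" and ?k = "\<lambda>d. 1 / (2 + 2 * ln (real d))"
  have E1: "\<forall>\<^sub>F d in sequentially. 2 * (ln (real d) * (2 + ln (real d)) * (2 * ?\<delta> d) + 6 * real d * (2 * ?\<delta> d) ^ 2) \<le> ?l d"
    by real_asymp
  have E2: "\<forall>\<^sub>F d in sequentially. (?l d) ^ 4 * ((1 / ?\<delta> d + 2) ^ 3 * (2 + ln (real d))) \<le> 1"
    by real_asymp
  \<comment> \<open>The factor 10 in \<open>?m\<close> lets the main term win, as 1 / 90 exceeds 12
    / 10^4. The added 1 allows for rounding up to an integer.\<close>
  have E3: "\<forall>\<^sub>F d in sequentially. 1 / (9 * (?m d + 1)) - 12 * real d ^ 2 / (?m d) ^ 4 - ?\<delta> d * (ln (real d) * (2 + ln (real d))) \<ge> ?l d"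
    by real_asymp
  have E4: "\<forall>\<^sub>F d in sequentially. ?\<delta> d * (4 + ln (real d)) \<le> ?k d / 2"
    by real_asymp
  have E5: "\<forall>\<^sub>F d in sequentially. 2 * ((5 * real d * ?\<delta> d + 4 + ln (real d)) * (2 * ?\<delta> d) + 20 * real d * (2 * ?\<delta> d) ^ 2) \<le> ?k d / 2"
    by real_asymp
  have E6: "\<forall>\<^sub>F d in sequentially. 6 * real d / ?l d \<le> real d ^ 2"
    by real_asymp
  have E6': "\<forall>\<^sub>F d in sequentially. 40 * real d / ?k d \<le> real d ^ 2"
    by real_asymp
  have E7: "\<forall>\<^sub>F d in sequentially. ?\<delta> d \<le> 1 / 4"
    by real_asymp
  \<comment> \<open>The inequality of \<open>prime_cong_1_exists_criterion\<close> times
    \<open>\<delta> ^ (k + 1)\<close>, with \<open>k\<close> eliminated by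
    \<open>2 ^ k \<ge> d ^ 4\<close>, \<open>k \<ge> 4\<close>,
    \<open>k + 1 \<le> 6 * ln d + 2\<close> and
    \<open>2 ^ (k + 1) \<le> exp (6 * ln d + 2)\<close>.\<close>
  have E8: "\<forall>\<^sub>F d in sequentially. ?\<delta> d / real d + real d * (8 * K * ((4 * ?\<delta> d) ^ 4 * ?\<delta> d)
      + (6 * ln (real d) + 2) * exp (6 * ln (real d) + 2) * exp (- (real d powr (19 / 20) * (?\<delta> d / 4))) * (4 / ?\<delta> d + 2)) < 1"
    using K by real_asymp
  have E9: "\<forall>\<^sub>F d in sequentially. real d \<le> (?m d) ^ 2"
    by real_asymp
  have E10: "\<forall>\<^sub>F d :: nat in sequentially. d \<ge> 3" by (rule eventually_ge_at_top)
  show ?thesis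
    using E1 E2 E3 E4 E5 E6 E6' E7 E8 E9 E10
  proof eventually_elim
    case (elim d)
    define \<delta> where "\<delta> = real d powr (- 9 / 10)"
    define l where "l = real d powr (- 7 / 10)"
    define \<kappa> where "\<kappa> = real (totient d) / real d"
    \<comment> \<open>As \<open>ln 2 \<ge> 2 / 3\<close>, this gives
      \<open>2 ^ k \<ge> d ^ 4\<close>, which beats at most \<open>d\<close> characters with an
      error bound \<open>d ^ 2\<close> each.\<close>
    define k where "k = nat \<lceil>6 * ln (real d)\<rceil>"
    define x where "x = exp (real d powr (19 / 20))"
    note E = elim(1-9)[folded \<delta>_def l_def]
    have d: "d \<ge> 3" "d > 1" "d > 0" using elim by auto
    have \<delta>: "\<delta> > 0" "\<delta> \<le> 1 / 4" using E(8) d by (auto simp: \<delta>_def)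
    have l: "l > 0" using d by (auto simp: l_def)
    have lnd: "ln (real d) \<ge> 1"
    proof -
      have "exp 1 \<le> real d" using exp_le d by linarith
      thus ?thesis using d by (subst ln_ge_iff) auto
    qed
    have \<kappa>: "\<kappa> \<ge> 1 / (2 + 2 * ln (real d))" "\<kappa> > 0"
      using totient_lower_bound[of d] d by (auto simp: \<kappa>_def field_simps)
    have k: "real k \<ge> 6 * ln (real d)" "real k \<le> 6 * ln (real d) + 1"
      using lnd by (auto simp: k_def)
    hence k4: "k \<ge> 4" using lnd by linarith
    have x: "x \<ge> 1" by (simp add: x_def)
    have low: "norm (lcoeff \<delta> \<psi> 0) \<ge> l" if \<psi>: "\<psi> \<in> dchars d" "\<psi> \<noteq> principal_dchar d" for \<psi>
    proof (cases "(\<lambda>n. \<psi> n ^ 2) = principal_dchar d")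
      case True
      define m where "m = 10 * real d powr (2 / 3)"
      define M where "M = nat \<lceil>m\<rceil>"
      have m: "m > 0" using d by (simp add: m_def)
      have M: "real M \<ge> m" "real M \<le> m + 1" using m by (auto simp: M_def)
      have "real d \<le> m ^ 2" using elim(10) by (simp add: m_def)
      also have "\<dots> \<le> real M ^ 2" using M m by (intro power_mono) auto
      finally have M2: "d \<le> M ^ 2" by (simp flip: of_nat_power)
      have M1: "M \<ge> 1" using M m by (simp add: Suc_le_eq)
      have "l \<le> 1 / (9 * (m + 1)) - 12 * real d ^ 2 / m ^ 4 - \<delta> * (ln d * (2 + ln d))"
        using E(3) by (simp add: m_def)
      also have "\<dots> \<le> 1 / (9 * real M) - 12 * real d ^ 2 / real M ^ 4 - \<delta> * (ln d * (2 + ln d))"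
        using M m M1 by (intro diff_mono order.refl divide_left_mono mult_left_mono power_mono mult_pos_pos zero_less_power) auto
      also have "\<dots> \<le> norm (lcoeff \<delta> \<psi> 0)"
        by (rule real_dchar_lower_bound[OF \<psi> True d(1) \<delta>(1) M1 M2])
      finally show ?thesis .
    next
      case False
      define Z where "Z = (1 / \<delta> + 2) ^ 3 * (2 + ln (real d))"
      have Z: "Z > 0" unfolding Z_def using \<delta> lnd by (intro mult_pos_pos zero_less_power add_pos_pos) auto
      have "l ^ 4 * Z \<le> 1" using E(2) by (simp add: Z_def)
      hence "l ^ 4 \<le> 1 / Z" using Z by (simp add: pos_le_divide_eq)
      also have "\<dots> \<le> norm (lcoeff \<delta> \<psi> 0) ^ 4"
        unfolding Z_def by (rule complex_dchar_lower_bound[OF \<psi>(1) False d(1) \<delta>(1)])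
      finally show ?thesis by (rule power_le_imp_le_base[of _ 3, simplified]) (auto simp: numeral_eq_Suc)
    qed

    show "\<exists>p. prime p \<and> [p = 1] (mod d) \<and> real p \<le> exp (real d powr (19 / 20))"
      unfolding x_def [symmetric]
    proof (rule prime_cong_1_exists_criterion[OF d(2) \<delta>(1) x])
      fix \<psi> assume \<psi>: "\<psi> \<in> dchars d"
      show "norm (lcoeff \<delta> (\<lambda>n. \<psi> n * mangoldt n) k - (if \<psi> = principal_dchar d then of_real ((1 / \<delta>) ^ (k + 1)) else 0)) * (2 * \<delta>) ^ k \<le> real d ^ 2"
      proof (cases "\<psi> = principal_dchar d")
        case True
        have "norm (lcoeff \<delta> (\<lambda>n. principal_dchar d n * mangoldt n) k - of_real ((1 / \<delta>) ^ (k + 1))) * (2 * \<delta>) ^ k \<le> 40 * d / \<kappa>"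
          unfolding \<kappa>_def
        proof (rule principal_log_derivative_bound[OF d(1) \<delta>])
          show "\<delta> * (4 + ln (real d)) \<le> real (totient d) / real d / 2"
            by (rule order.trans[OF E(4)]) (rule divide_right_mono[OF \<kappa>(1)[unfolded \<kappa>_def]], simp)
          show "2 * ((5 * d * \<delta> + 4 + ln d) * (2 * \<delta>) + 20 * d * (2 * \<delta>) ^ 2) \<le> real (totient d) / real d / 2"
            unfolding of_nat_mult of_nat_numeral
            by (rule order.trans[OF E(5)]) (rule divide_right_mono[OF \<kappa>(1)[unfolded \<kappa>_def]], simp)
        qed
        also have "\<dots> \<le> 40 * d / (1 / (2 + 2 * ln (real d)))"
          using \<kappa> lnd by (intro divide_left_mono mult_pos_pos) auto
        also have "\<dots> \<le> real d ^ 2" using E(7) by simp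
        finally show ?thesis using True by simp
      next
        case False
        have "norm (lcoeff \<delta> (\<lambda>n. \<psi> n * mangoldt n) k) * (2 * \<delta>) ^ k \<le> 6 * real d / l"
          using nonprincipal_log_derivative_bound[OF \<psi> False d(1) \<delta> l low[OF \<psi> False], of k] E(1) by simp
        also have "\<dots> \<le> real d ^ 2" using E(6) by simp
        finally show ?thesis using False by simp
      qed
    next
      have "real d ^ 4 \<le> 2 ^ k"
      proof -
        have "real d ^ 4 = exp (4 * ln (real d))" using d exp_of_nat_mult[of 4 "ln (real d)"] by simp
        also have "4 * ln (real d) \<le> real k * ln 2"
        proof -
          have "4 * ln (real d) \<le> real k * (2 / 3)" using k by simp
          also have "\<dots> \<le> real k * ln 2" using ln2_ge_two_thirds by (intro mult_left_mono) auto
          finally show ?thesis .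
        qed
        also have "exp (real k * ln 2) = 2 ^ k" by (simp add: exp_of_nat_mult)
        finally show ?thesis by simp
      qed
      hence 1: "real d ^ 3 * \<delta> / 2 ^ k \<le> \<delta> / real d"
        using d \<delta> by (simp add: field_simps power_numeral_reduce)
      have 2: "(4 * \<delta>) ^ k * \<delta> \<le> (4 * \<delta>) ^ 4 * \<delta>"
        using \<delta> k4 by (intro mult_right_mono power_decreasing) auto
      have 3: "(2::real) ^ (k + 1) \<le> exp (6 * ln (real d) + 2)"
      proof -
        have "(2::real) \<le> exp 1" using exp_ge_add_one_self[of 1] by simp
        hence "(2::real) ^ (k + 1) \<le> exp 1 ^ (k + 1)" by (intro power_mono) auto
        also have "\<dots> = exp (real (k + 1))" by (metis exp_of_nat_mult mult.right_neutral)
        also have "\<dots> \<le> exp (6 * ln (real d) + 2)" using k by simp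
        finally show ?thesis .
      qed
      have 4: "x powr - (\<delta> / 4) = exp (- (real d powr (19 / 20) * (\<delta> / 4)))"
        by (simp add: x_def powr_def)
      have 5: "real (k + 1) * 2 ^ (k + 1) * x powr - (\<delta> / 4) * (4 / \<delta> + 2) \<le>
          (6 * ln (real d) + 2) * exp (6 * ln (real d) + 2) * x powr - (\<delta> / 4) * (4 / \<delta> + 2)"
        using 3 k \<delta> lnd by (intro mult_right_mono mult_mono) auto
      have "real d ^ 3 * \<delta> / 2 ^ k + real d * (8 * K * ((4 * \<delta>) ^ k * \<delta>) + real (k + 1) * 2 ^ (k + 1) * x powr - (\<delta> / 4) * (4 / \<delta> + 2))
         \<le> \<delta> / real d + real d * (8 * K * ((4 * \<delta>) ^ 4 * \<delta>)
      + (6 * ln (real d) + 2) * exp (6 * ln (real d) + 2) * x powr - (\<delta> / 4) * (4 / \<delta> + 2))"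
        using 1 2 5 K by (intro add_mono mult_left_mono) auto
      also have "\<dots> < 1" using E(9) unfolding 4 by simp
      finally have "(real d ^ 3 * \<delta> / 2 ^ k + real d * (8 * K * ((4 * \<delta>) ^ k * \<delta>) + real (k + 1) * 2 ^ (k + 1) * x powr - (\<delta> / 4) * (4 / \<delta> + 2))) * (1 / \<delta>) ^ (k + 1)
         < 1 * (1 / \<delta>) ^ (k + 1)" using \<delta> by (intro mult_strict_right_mono) auto
      moreover have "(real d ^ 3 * \<delta> / 2 ^ k + real d * (8 * K * ((4 * \<delta>) ^ k * \<delta>) + real (k + 1) * 2 ^ (k + 1) * y * z)) * (1 / \<delta>) ^ (k + 1) =
        real d * real d ^ 2 / (2 * \<delta>) ^ k + real d * (8 * 4 ^ k * K + real (k + 1) * (2 / \<delta>) ^ (k + 1) * y * z)" for y z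
        using \<delta>(1) by (simp add: field_simps power_mult_distrib power2_eq_square power3_eq_cube)
      ultimately show "real d * real d ^ 2 / (2 * \<delta>) ^ k + real d * (8 * 4 ^ k * (\<Sum>a. real a powr (- 5 / 4))
          + real (k + 1) * (2 / \<delta>) ^ (k + 1) * x powr - (\<delta> / 4) * (4 / \<delta> + 2)) < (1 / \<delta>) ^ (k + 1)"
        unfolding K_def [symmetric] by (simp only: mult_1)
    qed
  qed
qed

lemma small_prime_cong_1:
  assumes "\<epsilon> > 0"
  shows "\<forall>\<^sub>F d in sequentially. \<exists>p. prime p \<and> [p = 1] (mod d) \<and> ln (real p) \<le> \<epsilon> * real (totient d)"
proof -
  have "\<forall>\<^sub>F d in sequentially. real d powr (19 / 20) \<le> \<epsilon> * (real d * (1 / (2 + 2 * ln (real d))))"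
    using assms by real_asymp
  thus ?thesis using prime_cong_1_exists_exp eventually_gt_at_top[of 0]
  proof eventually_elim
    case (elim d)
    then obtain p where p: "prime p" "[p = 1] (mod d)" "real p \<le> exp (real d powr (19 / 20))" by auto
    have "ln (real p) \<le> ln (exp (real d powr (19 / 20)))"
      using p prime_gt_0_nat[OF p(1)] by (subst ln_le_cancel_iff) auto
    also have "\<dots> \<le> \<epsilon> * (real d * (1 / (2 + 2 * ln (real d))))" using elim by simp
    also have "\<dots> \<le> \<epsilon> * real (totient d)" using totient_lower_bound[of d] elim assms by (intro mult_left_mono) auto
    finally show ?case using p by auto
  qed
qed

section \<open>Products of cyclic groups\<close>

text \<open>Coprimality of \<open>a ^ j - 1\<close> means that multiplication by
  \<open>a ^ j\<close> fixes only 0. It can be tested modulo \<open>p\<close>, where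
  \<open>a\<close> has order \<open>d\<close>: its exponent over the primitive root is the cofactor
  \<open>e = (p - 1) / d\<close> times a power of \<open>p\<close>, which is prime to
  \<open>d\<close>.\<close>

lemma cyclic_factor_exists:
  fixes p d k :: nat
  assumes p: "prime p" "[p = 1] (mod d)" and d: "d > 0"
  shows "\<exists>a. [a ^ d = 1] (mod (p ^ k)) \<and> (\<forall>j. \<not> d dvd j \<longrightarrow> coprime (int a ^ j - 1) (int (p ^ k)))"
proof (cases "k = 0")
  case False
  have p1: "p > 1" using prime_gt_1_nat[OF p(1)] .
  have dp: "d dvd p - 1" using p p1 by (metis cong_altdef_nat less_imp_le)
  then obtain e where e: "p - 1 = d * e" by auto
  have e0: "e > 0" using e p1 by (metis gr0I mult_0_right zero_less_diff less_irrefl)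
  obtain g where g: "g \<in> totatives p" "ord p g = p - 1" using residue_prime_has_primroot[OF p(1)] by blast
  have cop_g: "coprime g p" using g by (auto simp: totatives_def)
  have cop_dp: "coprime d p"
  proof -
    have "coprime p d" using cong_imp_coprime[OF cong_sym[OF p(2)]] by simp
    thus ?thesis by (simp add: coprime_commute)
  qed
  \<comment> \<open>The exponent makes \<open>a\<^sup>d = g\<^bsup>totient (p\<^sup>k)\<^esup>\<close>, so no lifting of roots of unity from \<open>p\<close> to \<open>p\<^sup>k\<close> is needed.\<close>
  define a where "a = g ^ (p ^ (k - 1) * e)"
  have "totient (p ^ k) = p ^ (k - 1) * e * d"
    using totient_prime_power[OF p(1), of k] False by (simp only: e mult_ac)
  hence "a ^ d = g ^ totient (p ^ k)" by (simp add: a_def flip: power_mult)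
  moreover have "[g ^ totient (p ^ k) = 1] (mod (p ^ k))" using cop_g by (intro euler_theorem) simp
  ultimately have 1: "[a ^ d = 1] (mod (p ^ k))" by simp
  have 2: "coprime (int a ^ j - 1) (int (p ^ k))" if j: "\<not> d dvd j" for j
  proof -
    have "\<not> [a ^ j = 1] (mod p)"
    proof
      assume "[a ^ j = 1] (mod p)"
      hence "[g ^ (p ^ (k - 1) * e * j) = 1] (mod p)" by (simp add: a_def power_mult)
      hence "d * e dvd p ^ (k - 1) * e * j" using ord_divides[of g _ p] g e by auto
      hence "d * e dvd (p ^ (k - 1) * j) * e" by (simp add: mult_ac)
      hence "d dvd p ^ (k - 1) * j" using e0 by simp
      moreover have "coprime d (p ^ (k - 1))" using cop_dp by simp
      ultimately show False using j by (simp add: coprime_dvd_mult_right_iff)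
    qed
    hence "\<not> int p dvd int a ^ j - 1"
      by (metis cong_iff_dvd_diff cong_int_iff of_nat_1 of_nat_power)
    hence "coprime (int p) (int a ^ j - 1)" using p by (intro prime_imp_coprime) auto
    thus ?thesis by (simp add: coprime_commute)
  qed
  show ?thesis using 1 2 by blast
qed auto

text \<open>
  The index \<open>0\<close> divides no positive number, hence carries the trivial group.
\<close>

locale cyclic_factors =
  fixes m a :: "nat \<Rightarrow> nat"
  assumes m_pos: "m i > 0" and m_0: "m 0 = 1"
    and period: "[a i ^ i = 1] (mod m i)"
    and free: "\<not> i dvd j \<Longrightarrow> coprime (int (a i) ^ j - 1) (int (m i))"
begin

definition G :: "point monoid" where
  "G = \<lparr>carrier = {x. \<forall>i. x i \<in> {0..<int (m i)}},
        monoid.mult = (\<lambda>x y i. (x i + y i) mod int (m i)), one = (\<lambda>_. 0)\<rparr>"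

definition X :: "point topology" where
  "X = product_topology (\<lambda>i. discrete_topology {0..<int (m i)}) UNIV"

text \<open>Arbitrary multipliers give the powers and the inverse of \<open>T\<close> the same
  form.\<close>

definition scale :: "(nat \<Rightarrow> int) \<Rightarrow> point \<Rightarrow> point" where
  "scale b x = (\<lambda>i. (b i * x i) mod int (m i))"

abbreviation T :: "point \<Rightarrow> point" where
  "T \<equiv> scale (\<lambda>i. int (a i))"

lemma carrier_iff: "x \<in> carrier G \<longleftrightarrow> (\<forall>i. 0 \<le> x i \<and> x i < int (m i))"
  by (auto simp: G_def)

lemma mod_carrier: "(\<lambda>i. f i mod int (m i)) \<in> carrier G"
  using m_pos by (simp add: carrier_iff)

lemma carrier_mod: "x \<in> carrier G \<Longrightarrow> x i mod int (m i) = x i"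
  by (simp add: carrier_iff)

lemma group_G: "group G"
proof (rule groupI)
  fix x y assume "x \<in> carrier G" "y \<in> carrier G"
  have "x \<otimes>\<^bsub>G\<^esub> y = (\<lambda>i. (x i + y i) mod int (m i))" by (simp add: G_def)
  thus "x \<otimes>\<^bsub>G\<^esub> y \<in> carrier G" using mod_carrier by simp
next
  show "\<one>\<^bsub>G\<^esub> \<in> carrier G" using m_pos by (simp add: G_def)
next
  fix x y z
  show "x \<otimes>\<^bsub>G\<^esub> y \<otimes>\<^bsub>G\<^esub> z = x \<otimes>\<^bsub>G\<^esub> (y \<otimes>\<^bsub>G\<^esub> z)"
    by (simp add: G_def mod_simps add.assoc)
next
  fix x assume x: "x \<in> carrier G"
  show "\<one>\<^bsub>G\<^esub> \<otimes>\<^bsub>G\<^esub> x = x" using carrier_mod[OF x] by (simp add: G_def)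
  have "(\<lambda>i. (- x i) mod int (m i)) \<otimes>\<^bsub>G\<^esub> x = \<one>\<^bsub>G\<^esub>" by (simp add: G_def mod_simps)
  thus "\<exists>y\<in>carrier G. y \<otimes>\<^bsub>G\<^esub> x = \<one>\<^bsub>G\<^esub>" using mod_carrier[of "\<lambda>i. - x i"] by blast
qed

lemma inv_G: "x \<in> carrier G \<Longrightarrow> inv\<^bsub>G\<^esub> x = (\<lambda>i. (- x i) mod int (m i))"
  by (rule group.inv_equality[OF group_G]) (auto simp: G_def mod_simps m_pos)

lemma topspace_X: "topspace X = carrier G"
  by (auto simp: X_def G_def PiE_iff)

lemma continuous_coordinatewise:
  assumes "\<And>i y. 0 \<le> y \<Longrightarrow> y < int (m i) \<Longrightarrow> 0 \<le> f i y \<and> f i y < int (m i)"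
  shows "continuous_map X X (\<lambda>x i. f i (x i))"
proof -
  have "continuous_map X (discrete_topology {0..<int (m i)}) (f i \<circ> (\<lambda>x. x i))" for i
  proof (rule continuous_map_compose)
    show "continuous_map X (discrete_topology {0..<int (m i)}) (\<lambda>x. x i)"
      unfolding X_def by (rule continuous_map_product_projection) simp
    show "continuous_map (discrete_topology {0..<int (m i)}) (discrete_topology {0..<int (m i)}) (f i)"
      using assms[of _ i] by auto
  qed
  thus ?thesis
    by (subst (2) X_def) (simp add: continuous_map_componentwise_UNIV o_def)
qed

lemma continuous_mult: "continuous_map (prod_topology X X) X (\<lambda>(x, y). x \<otimes>\<^bsub>G\<^esub> y)"
proof -
  let ?D = "\<lambda>i. discrete_topology {0..<int (m i)}"
  have "continuous_map (prod_topology X X) (?D i) ((\<lambda>(u, v). (u + v) mod int (m i)) \<circ> (\<lambda>z. (fst z i, snd z i)))" for i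
  proof (rule continuous_map_compose)
    have pr: "continuous_map X (?D i) (\<lambda>x. x i)"
      unfolding X_def by (rule continuous_map_product_projection) simp
    show "continuous_map (prod_topology X X) (prod_topology (?D i) (?D i)) (\<lambda>z. (fst z i, snd z i))"
      using continuous_map_compose[OF continuous_map_fst pr] continuous_map_compose[OF continuous_map_snd pr]
      by (intro continuous_map_pairedI) (simp_all add: o_def)
    show "continuous_map (prod_topology (?D i) (?D i)) (?D i) (\<lambda>(u, v). (u + v) mod int (m i))"
      using m_pos[of i] by (simp flip: prod_topology_discrete_topology) auto
  qed
  thus ?thesis
    by (subst (3) X_def) (simp add: continuous_map_componentwise_UNIV o_def G_def case_prod_unfold)
qed

lemma compact_group_G: "compact_group G X"
  unfolding compact_group_def topological_group_def
proof (intro conjI group_G topspace_X continuous_mult)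
  have "continuous_map X X (\<lambda>x i. (- x i) mod int (m i))"
    using m_pos by (intro continuous_coordinatewise[where f = "\<lambda>i y. (- y) mod int (m i)"]) simp
  thus "continuous_map X X (\<lambda>x. inv\<^bsub>G\<^esub> x)"
    by (rule continuous_map_eq) (simp add: inv_G topspace_X)
  show "compact_space X" unfolding X_def compact_space_product_topology by (simp add: compact_space_discrete_topology)
  show "Hausdorff_space X" unfolding X_def Hausdorff_space_product_topology by simp
qed

lemma scale_scale: "scale b (scale c x) = scale (\<lambda>i. b i * c i) x"
  by (simp add: scale_def mod_simps mult.assoc)

lemma scale_in_carrier: "scale b x \<in> carrier G"
  unfolding scale_def by (rule mod_carrier)

lemma scale_id: "x \<in> carrier G \<Longrightarrow> (\<And>i. [b i = 1] (mod int (m i))) \<Longrightarrow> scale b x = x"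
proof
  fix i
  assume x: "x \<in> carrier G" and b: "\<And>i. [b i = 1] (mod int (m i))"
  have "[b i * x i = 1 * x i] (mod int (m i))" by (intro cong_scalar_right b)
  thus "scale b x i = x i" using carrier_mod[OF x, of i] by (simp add: scale_def cong_def)
qed

lemma scale_continuous: "continuous_map X X (scale b)"
  unfolding scale_def [abs_def] using m_pos
  by (intro continuous_coordinatewise[where f = "\<lambda>i y. (b i * y) mod int (m i)"]) simp

lemma inverse_multiplier: "\<exists>b. \<forall>i. [int (a i) * b i = 1] (mod int (m i))"
proof -
  have "\<exists>b. [int (a i) * b = 1] (mod int (m i))" for i
  proof (cases "i = 0")
    case True thus ?thesis using m_0 by simp
  next
    case False
    hence "int (a i) * int (a i) ^ (i - 1) = int (a i ^ i)" by (cases i) simp_all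
    moreover have "[int (a i ^ i) = int 1] (mod int (m i))" using period[of i] by (simp only: cong_int_iff)
    ultimately show ?thesis by (intro exI[of _ "int (a i) ^ (i - 1)"]) simp
  qed
  thus ?thesis by metis
qed

lemma automorphism_T: "compact_group_automorphism G X T"
proof -
  obtain b where b: "[int (a i) * b i = 1] (mod int (m i))" for i using inverse_multiplier by blast
  have inv1: "scale b (T x) = x" if "x \<in> carrier G" for x
    unfolding scale_scale using b by (intro scale_id that) (simp add: mult.commute)
  have inv2: "T (scale b x) = x" if "x \<in> carrier G" for x
    unfolding scale_scale using b by (intro scale_id that)
  have "homeomorphic_maps X X T (scale b)"
    unfolding homeomorphic_maps_def topspace_X by (auto intro: scale_continuous inv1 inv2)
  moreover have "T \<in> hom G G"
  proof (rule homI)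
    fix x y
    show "T (x \<otimes>\<^bsub>G\<^esub> y) = T x \<otimes>\<^bsub>G\<^esub> T y"
      by (simp add: G_def scale_def mod_simps distrib_left)
  qed (rule scale_in_carrier)
  moreover have "bij_betw T (carrier G) (carrier G)"
    by (rule bij_betw_byWitness[where f' = "scale b"]) (use inv1 inv2 scale_in_carrier in auto)
  ultimately show ?thesis
    unfolding compact_group_automorphism_def iso_def homeomorphic_map_maps by blast
qed

lemma T_funpow: "x \<in> carrier G \<Longrightarrow> (T ^^ n) x = scale (\<lambda>i. int (a i) ^ n) x"
proof (induction n)
  case 0
  thus ?case by (simp add: scale_id)
next
  case (Suc n)
  thus ?case by (simp add: scale_scale)
qed

text \<open>The condition decouples into \<open>m i dvd (a i ^ n - 1) * x i\<close>. If
  \<open>i dvd n\<close>, the first factor is 0 modulo \<open>m i\<close> and the coordinate is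
  free; otherwise it is a unit and the coordinate must vanish.\<close>

lemma periodic_points_eq:
  "periodic_points G T n = {x \<in> carrier G. \<forall>i. \<not> i dvd n \<longrightarrow> x i = 0}"
proof -
  have "(T ^^ n) x = x \<longleftrightarrow> (\<forall>i. \<not> i dvd n \<longrightarrow> x i = 0)" if x: "x \<in> carrier G" for x
  proof -
    have "(int (a i) ^ n * x i) mod int (m i) = x i \<longleftrightarrow> i dvd n \<or> x i = 0" for i
    proof -
      have "(int (a i) ^ n * x i) mod int (m i) = x i \<longleftrightarrow> [int (a i) ^ n * x i = x i] (mod int (m i))"
        using carrier_mod[OF x, of i] by (simp add: cong_def)
      also have "\<dots> \<longleftrightarrow> int (m i) dvd (int (a i) ^ n - 1) * x i"
        by (simp add: cong_iff_dvd_diff algebra_simps)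
      also have "\<dots> \<longleftrightarrow> i dvd n \<or> x i = 0"
      proof (cases "i dvd n")
        case True
        then obtain l where l: "n = i * l" by auto
        have "[(a i ^ i) ^ l = 1 ^ l] (mod m i)" by (intro cong_pow period)
        hence "[int (a i ^ n) = int 1] (mod int (m i))" by (simp only: cong_int_iff) (simp add: l power_mult)
        hence "int (m i) dvd int (a i) ^ n - 1" by (simp add: cong_iff_dvd_diff)
        thus ?thesis using True by simp
      next
        case False
        hence "int (m i) dvd (int (a i) ^ n - 1) * x i \<longleftrightarrow> int (m i) dvd x i"
          using free[OF False] by (simp add: coprime_dvd_mult_right_iff coprime_commute)
        also have "\<dots> \<longleftrightarrow> x i = 0"
          using x zdvd_not_zless[of "x i" "int (m i)"] by (auto simp: carrier_iff order_less_le)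
        finally show ?thesis using False by simp
      qed
      finally show ?thesis .
    qed
    thus ?thesis unfolding T_funpow[OF x] scale_def fun_eq_iff by blast
  qed
  thus ?thesis unfolding periodic_points_def by auto
qed

lemma
  assumes n: "n \<ge> 1"
  shows finite_periodic_points: "finite (periodic_points G T n)"
    and num_periodic_points_eq: "num_periodic_points G T n = (\<Prod>i | i dvd n. m i)"
proof -
  let ?I = "{i. i dvd n}"
  let ?E = "PiE ?I (\<lambda>i. {0..<int (m i)})"
  have fin: "finite ?I" using n by simp
  have bij: "bij_betw (\<lambda>f i. if i dvd n then f i else 0) ?E (periodic_points G T n)"
  proof (rule bij_betw_byWitness[where f' = "\<lambda>x. restrict x ?I"])
    show "\<forall>f\<in>?E. restrict (\<lambda>i. if i dvd n then f i else 0) ?I = f"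
      by (auto simp: fun_eq_iff PiE_iff extensional_def restrict_def)
    show "\<forall>x\<in>periodic_points G T n. (\<lambda>i. if i dvd n then restrict x ?I i else 0) = x"
      by (auto simp: periodic_points_eq fun_eq_iff)
    show "(\<lambda>f i. if i dvd n then f i else 0) ` ?E \<subseteq> periodic_points G T n"
      using m_pos by (auto simp: periodic_points_eq carrier_iff PiE_iff)
    show "(\<lambda>x. restrict x ?I) ` periodic_points G T n \<subseteq> ?E"
      by (intro image_subsetI, subst restrict_PiE_iff) (auto simp: periodic_points_eq carrier_iff)
  qed
  have "finite ?E" using fin by (intro finite_PiE) auto
  thus "finite (periodic_points G T n)" using bij_betw_finite[OF bij] by simp
  show "num_periodic_points G T n = (\<Prod>i | i dvd n. m i)"
    unfolding num_periodic_points_def using bij_betw_same_card[OF bij] fin by (simp add: card_PiE)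
qed

end

text \<open>Where no such prime exists the value is unspecified. Minimality transfers the size bound
  of some prime to this one.\<close>

definition least_prime_cong_1 :: "nat \<Rightarrow> nat" where
  "least_prime_cong_1 d = (LEAST p. prime p \<and> [p = 1] (mod d))"

text \<open>A prime is guaranteed only for large \<open>d\<close>; where there is none the order is
  1. The exponents \<open>k d\<close> remain free for tuning the growth rate.\<close>

lemma cyclic_factors_exist:
  fixes k :: "nat \<Rightarrow> nat"
  shows "\<exists>m a. cyclic_factors m a \<and>
    (\<forall>d. m d = (if d > 0 \<and> (\<exists>p. prime p \<and> [p = 1] (mod d)) then least_prime_cong_1 d ^ k d else 1))"
proof -
  let ?P = "\<lambda>d :: nat. d > 0 \<and> (\<exists>p. prime p \<and> [p = 1] (mod d))"
  define m where "m = (\<lambda>d. if ?P d then least_prime_cong_1 d ^ k d else 1)"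
  have q: "prime (least_prime_cong_1 d)" "[least_prime_cong_1 d = 1] (mod d)" if "?P d" for d
    using LeastI_ex[of "\<lambda>p. prime p \<and> [p = 1] (mod d)"] that by (auto simp: least_prime_cong_1_def)
  have "\<exists>a. [a ^ d = 1] (mod m d) \<and> (\<forall>j. \<not> d dvd j \<longrightarrow> coprime (int a ^ j - 1) (int (m d)))" for d
  proof (cases "?P d")
    case True
    thus ?thesis using cyclic_factor_exists[OF q[OF True], of "k d"] by (simp add: m_def)
  next
    case False
    thus ?thesis by (auto simp: m_def)
  qed
  then obtain a where a: "\<And>d. [a d ^ d = 1] (mod m d)" "\<And>d j. \<not> d dvd j \<Longrightarrow> coprime (int (a d) ^ j - 1) (int (m d))"
    by metis
  have "cyclic_factors m a"
  proof
    show "m d > 0" for d using q[of d] by (auto simp: m_def prime_gt_0_nat)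
    show "m 0 = 1" by (simp add: m_def)
  qed (use a in auto)
  moreover have "\<forall>d. m d = (if ?P d then least_prime_cong_1 d ^ k d else 1)" unfolding m_def by (intro allI refl)
  ultimately show ?thesis by blast
qed

theorem theorem2:
  fixes C :: ereal
  assumes "0 \<le> C"
  shows "\<exists>(G :: point monoid) (X :: point topology) (T :: point \<Rightarrow> point).
           compact_group G X \<and>
           compact_group_automorphism G X T \<and>
           (\<forall>n\<ge>1. finite (periodic_points G T n)) \<and>
           (\<lambda>n. ereal (ln (real (num_periodic_points G T n)) / real n)) \<longlonglongrightarrow> C"
proof -
  let ?P = "\<lambda>d :: nat. d > 0 \<and> (\<exists>p. prime p \<and> [p = 1] (mod d))"
  let ?q = least_prime_cong_1
  have q: "?q d > 1" if "?P d" for d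
    using LeastI_ex[of "\<lambda>p. prime p \<and> [p = 1] (mod d)"] that prime_gt_1_nat by (auto simp: least_prime_cong_1_def)
  \<comment> \<open>The count of periodic points leaves only the sums of
    \<open>k d * ln (?q d)\<close> over the divisors of \<open>n\<close>; the groups can be
    forgotten from here on.\<close>
  have reduction: ?thesis
    if k: "\<And>f. (\<And>n. n > 0 \<Longrightarrow> f n = (\<Sum>d | d dvd n. if ?P d then k d * ln (?q d) else 0)) \<Longrightarrow> (\<lambda>n. ereal (f n / n)) \<longlonglongrightarrow> C"
    for k :: "nat \<Rightarrow> nat"
  proof -
    obtain m a where ma: "cyclic_factors m a" and m: "\<And>d. m d = (if ?P d then ?q d ^ k d else 1)"
      using cyclic_factors_exist[of k] by blast
    interpret cyclic_factors m a by (rule ma)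
    have "ln (real (num_periodic_points G T n)) = (\<Sum>d | d dvd n. if ?P d then k d * ln (?q d) else 0)" if n: "n > 0" for n
    proof -
      have "ln (real (num_periodic_points G T n)) = (\<Sum>d | d dvd n. ln (real (m d)))"
        using n m_pos by (subst num_periodic_points_eq) (auto simp: ln_prod)
      also have "\<dots> = (\<Sum>d | d dvd n. if ?P d then k d * ln (?q d) else 0)"
      proof (intro sum.cong refl)
        fix d
        show "ln (real (m d)) = (if ?P d then k d * ln (?q d) else 0)"
        proof (cases "?P d")
          case True
          thus ?thesis using m[of d] q[OF True] by (simp add: ln_realpow)
        next
          case False
          thus ?thesis using m[of d] by (simp only: if_False) simp
        qed
      qed
      finally show ?thesis .
    qed
    hence "(\<lambda>n. ereal (ln (real (num_periodic_points G T n)) / real n)) \<longlonglongrightarrow> C" by (rule k)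
    thus ?thesis using compact_group_G automorphism_T finite_periodic_points by blast
  qed
  have lnq: "ln (real (?q d)) \<ge> ln 2" if "?P d" for d
    using q[OF that] by (subst ln_le_cancel_iff) auto
  have qle: "?q d \<le> p" if "prime p" "[p = 1] (mod d)" for p d
    unfolding least_prime_cong_1_def using that by (intro Least_le) auto
  show ?thesis
  proof (cases C)
    case (real c)
    hence c: "c \<ge> 0" using assms by simp
    \<comment> \<open>This gives the largest multiple of \<open>ln (?q d)\<close> not exceeding
      \<open>c * totient d\<close>. The defect \<open>e d\<close> is at most
      \<open>ln (?q d)\<close>, or all of \<open>c * totient d\<close> if there is no prime.\<close>
    define k where "k = (\<lambda>d. nat \<lfloor>c * totient d / ln (?q d)\<rfloor>)"
    define e where "e = (\<lambda>d. c * totient d - (if ?P d then k d * ln (?q d) else 0))"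
    have e: "0 \<le> e d" "e d \<le> c * totient d" "?P d \<Longrightarrow> e d \<le> ln (?q d)" for d
    proof -
      have "0 \<le> e d \<and> e d \<le> c * totient d \<and> (?P d \<longrightarrow> e d \<le> ln (?q d))"
      proof (cases "?P d")
        case True
        have ln0: "ln (real (?q d)) > 0" using q[OF True] by simp
        have "0 \<le> c * totient d / ln (?q d)" using c ln0 by simp
        hence "real (k d) \<le> c * totient d / ln (?q d)" "c * totient d / ln (?q d) \<le> real (k d) + 1"
          by (auto simp: k_def)
        hence "real (k d) * ln (?q d) \<le> c * totient d" "c * totient d \<le> (real (k d) + 1) * ln (?q d)"
          using ln0 by (auto simp: field_simps)
        thus ?thesis using True ln0 by (simp add: e_def algebra_simps)
      next
        case False
        thus ?thesis using c by (auto simp: e_def)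
      qed
      thus "0 \<le> e d" "e d \<le> c * totient d" "?P d \<Longrightarrow> e d \<le> ln (?q d)" by blast+
    qed
    show ?thesis
    proof (rule reduction[of k])
      fix f :: "nat \<Rightarrow> real"
      assume f: "\<And>n. n > 0 \<Longrightarrow> f n = (\<Sum>d | d dvd n. if ?P d then k d * ln (?q d) else 0)"
      have f': "f n = c * n - (\<Sum>d | d dvd n. e d)" if "n > 0" for n
      proof -
        have "(\<Sum>d | d dvd n. e d) = c * real (\<Sum>d | d dvd n. totient d) - f n"
          unfolding e_def f[OF that] by (simp add: sum_subtractf sum_distrib_left)
        thus ?thesis by (simp add: totient_divisor_sum)
      qed
      have "(\<lambda>n. f n / n) \<longlonglongrightarrow> c"
      proof (rule LIMSEQ_I)
        fix r :: real assume r: "r > 0"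
        have "\<forall>\<^sub>F d in sequentially. d > 0 \<and> (\<exists>p. prime p \<and> [p = 1] (mod d) \<and> ln (real p) \<le> r / 2 * real (totient d))"
          using r by (intro eventually_conj eventually_gt_at_top small_prime_cong_1) auto
        then obtain D where D: "\<And>d. d \<ge> D \<Longrightarrow> d > 0 \<and> (\<exists>p. prime p \<and> [p = 1] (mod d) \<and> ln (real p) \<le> r / 2 * real (totient d))"
          unfolding eventually_sequentially by blast
        have eD: "e d \<le> r / 2 * totient d" if d: "d \<ge> D" for d
        proof -
          obtain p where p: "prime p" "[p = 1] (mod d)" "ln (real p) \<le> r / 2 * real (totient d)" using D[OF d] by blast
          have P: "?P d" using D[OF d] by blast
          have "ln (real (?q d)) \<le> ln (real p)" using qle[OF p(1,2)] q[OF P] by (subst ln_le_cancel_iff) auto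
          thus ?thesis using e(3)[OF P] p(3) by linarith
        qed
        \<comment> \<open>The divisors below \<open>D\<close> contribute at most this constant,
          which disappears after division by \<open>n\<close>; the others contribute at most
          \<open>r / 2 * n\<close>.\<close>
        define B where "B = (\<Sum>d<D. e d)"
        have bound: "(\<Sum>d | d dvd n. e d) \<le> B + r / 2 * n" if n: "n > 0" for n
        proof -
          have fin: "finite {d. d dvd n}" using n by simp
          have "(\<Sum>d | d dvd n. e d) \<le> (\<Sum>d | d dvd n. (if d < D then e d else 0) + r / 2 * totient d)"
            using eD e(1) r by (intro sum_mono) (auto simp: not_less)
          also have "\<dots> = (\<Sum>d | d dvd n. if d < D then e d else 0) + r / 2 * real (\<Sum>d | d dvd n. totient d)"
            by (simp add: sum.distrib sum_distrib_left)
          also have "(\<Sum>d | d dvd n. if d < D then e d else 0) = (\<Sum>d | d dvd n \<and> d < D. e d)"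
            using fin by (simp add: sum.If_cases Int_def)
          also have "\<dots> \<le> B" unfolding B_def using e(1) by (intro sum_mono2) auto
          finally show ?thesis by (simp add: totient_divisor_sum)
        qed
        obtain N :: nat where N: "real N > 2 * \<bar>B\<bar> / r" using reals_Archimedean2 by blast
        show "\<exists>no. \<forall>n\<ge>no. norm (f n / n - c) < r"
        proof (intro exI allI impI)
          fix n assume "n \<ge> Suc N"
          hence n: "n > 0" "real n > 2 * \<bar>B\<bar> / r" using N by auto
          have "B < r / 2 * n" using n r by (simp add: field_simps)
          hence "(\<Sum>d | d dvd n. e d) < r * n" using bound[OF n(1)] by (simp add: algebra_simps)
          hence "(\<Sum>d | d dvd n. e d) / n < r" using n by (simp add: field_simps)
          moreover have "0 \<le> (\<Sum>d | d dvd n. e d) / n" using e(1) by (intro divide_nonneg_nonneg sum_nonneg) auto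
          moreover have "f n / n - c = - ((\<Sum>d | d dvd n. e d) / n)"
            using n unfolding f'[OF n(1)] by (simp add: diff_divide_distrib)
          ultimately show "norm (f n / n - c) < r" by simp
        qed
      qed
      thus "(\<lambda>n. ereal (f n / n)) \<longlonglongrightarrow> C" unfolding real by (rule tendsto_ereal)
    qed
  next
    case PInf
    have "\<forall>\<^sub>F d in sequentially. d > 0 \<and> (\<exists>p. prime p \<and> [p = 1] (mod d))"
      by (rule eventually_mono[OF eventually_conj[OF eventually_gt_at_top[of 0] small_prime_cong_1[OF zero_less_one]]]) blast
    then obtain D where D: "\<And>d. d \<ge> D \<Longrightarrow> ?P d" unfolding eventually_sequentially by blast
    show ?thesis
    \<comment> \<open>Any exponents growing faster than \<open>d\<close> would do: the divisor
      \<open>d = n\<close> alone contributes at least \<open>n ^ 2 * ln 2\<close>.\<close>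
    proof (rule reduction[of "\<lambda>d. d ^ 2"])
      fix f :: "nat \<Rightarrow> real"
      assume f: "\<And>n. n > 0 \<Longrightarrow> f n = (\<Sum>d | d dvd n. if ?P d then real (d ^ 2) * ln (?q d) else 0)"
      have low: "f n / n \<ge> n * ln 2" if n: "n \<ge> D" for n
      proof -
        note P = D[OF n]
        have "real n ^ 2 * ln 2 \<le> real n ^ 2 * ln (?q n)" using lnq[OF P] by (intro mult_left_mono) auto
        also have "\<dots> = (\<Sum>d\<in>{n}. if ?P d then real (d ^ 2) * ln (?q d) else 0)" using P by simp
        also have "\<dots> \<le> (\<Sum>d | d dvd n. if ?P d then real (d ^ 2) * ln (?q d) else 0)"
        proof (intro sum_mono2)
          fix d
          have "0 \<le> ln (real (?q d))" if "?P d" using q[OF that] by simp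
          thus "0 \<le> (if ?P d then real (d ^ 2) * ln (?q d) else 0)" by simp
        qed (use P in auto)
        also have "\<dots> = f n" using f P by simp
        finally show ?thesis using P by (simp add: field_simps power2_eq_square)
      qed
      have "filterlim (\<lambda>n. f n / n) at_top sequentially"
      proof (rule filterlim_at_top_mono)
        show "filterlim (\<lambda>n. real n * ln 2) at_top sequentially" by real_asymp
        show "\<forall>\<^sub>F n in sequentially. real n * ln 2 \<le> f n / n"
          by (rule eventually_sequentiallyI[of D]) (rule low)
      qed
      thus "(\<lambda>n. ereal (f n / n)) \<longlonglongrightarrow> C" unfolding PInf tendsto_PInfty_eq_at_top .
    qed
  next
    case MInf
    thus ?thesis using assms by simp
  qed
qed

end
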